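(* Let $k\ge 2$ and $d\ge 1$ be integers, let $0<\theta<1$ be real with $d\theta>1$, and let $p\in(1,\infty)$ be determined by $d\theta=d^{1/p}$. Then $T(\mathcal A_d^k,\theta)$ is $\ell_p$-saturated: every infinite dimensional closed subspace of $T(\mathcal A_d^k,\theta)$ contains a closed subspace isomorphic to $\ell_p$.
   Context: Sequences and orders. $\omega=\{0,1,2,\dots\}$. For an integer $k\ge1$, $\omega^{\not\downarrow\le k}$ is the set of all non-decreasing finite sequences of elements of $\omega$ of length at most $k$ (including the empty sequence $()$), and $\omega^{\not\downarrow k}$ is the set of those of length exactly $k$. Write $s\sqsubset t$ if $s$ is a proper initial segment of $t$. Let $<_{\mathrm{lex}}$ be the lexicographic order in which a proper initial segment precedes the longer sequence. The well-order $\prec$ (of order type $\omega$) on $\omega^{\not\downarrow\le k}$ is: $()\prec s$ for all nonempty $s$; and for nonempty sequences, $(s_1,\dots,s_i)\prec(t_1,\dots,t_j)$ iff $s_i<t_j$, or $s_i=t_j$ and $(s_1,\dots,s_i)<_{\mathrm{lex}}(t_1,\dots,t_j)$. The spaces $\mathcal E_k$. An $\mathcal E_k$-tree is a function $\widehat X:\omega^{\not\downarrow\le k}\to\omega^{\not\downarrow\le k}$ preserving $\prec$ and $\sqsubset$ (hence preserving lengths). $\mathcal E_k$ is the collection of all sets $X=\widehat X[\omega^{\not\downarrow k}]$, for $\widehat X$ an $\mathcal E_k$-tree. For $X\in\mathcal E_k$ and $n\ge1$, $r_n(X)$ is the set of the $\prec$-least $n$ elements of $X$; $\mathcal{AR}^k_n=\{r_n(X):X\in\mathcal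 E_k\}$, $\mathcal{AR}^k=\bigcup_{n\ge1}\mathcal{AR}^k_n$ and $\mathcal A_d^k=\bigcup_{i=1}^d\mathcal{AR}_i^k$. The Banach space $T(\mathcal A_d^k,\theta)$. For nonempty finite $E,F\subset\omega^{\not\downarrow k}$, $E<F$ (resp. $E\le F$) means $\max_\prec E\prec\min_\prec F$ (resp. $\preceq$); an element $v$ is treated as $\{v\}$. For $1\le m\le d$, a sequence $(E_i)_{i=1}^m$ in $\mathcal{AR}^k$ is $\mathcal A_d^k$-admissible if there is $\{v_1,\dots,v_m\}\in\mathcal A_d^k$ with $v_1\le E_1<v_2\le E_2<\cdots<v_m\le E_m$. On the space $c_{00}(\omega^{\not\downarrow k})$ of finitely supported functions $x:\omega^{\not\downarrow k}\to\mathbb R$, with canonical basis $(e_v)$ and $Ex=\sum_{v\in E}x_ve_v$, put $|x|_0=\max_v|x_v|$, $|x|_{j+1}=\max\{|x|_j,\ \theta\max\{\sum_{i=1}^m|E_ix|_j:1\le m\le d,\ (E_i)_{i=1}^m\ \mathcal A_d^k\text{-admissible}\}\}$, and $\|x\|=\sup_j|x|_j$. $T(\mathcal A_d^k,\theta)$ is the completion of $c_{00}(\omega^{\not\downarrow k})$ in this norm. "Isomorphic" means linearly homeomorphic. *)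

theory Defs
  imports
    "HOL-Analysis.Analysis"
    "HOL-Library.Sublist"
    "HOL-Probability.Discrete_Topology"
begin

section \<open>Non-decreasing sequences and the spaces \<open>\<E>\<^sub>k\<close>\<close>

definition ndseqs_le :: "nat \<Rightarrow> nat list set" where
  "ndseqs_le k = {s. sorted s \<and> length s \<le> k}"

definition ndseqs :: "nat \<Rightarrow> nat list set" where
  "ndseqs k = {s. sorted s \<and> length s = k}"

text \<open>In \<open>lexord\<close>, a proper initial segment precedes the longer sequence.\<close>

definition prec :: "nat list \<Rightarrow> nat list \<Rightarrow> bool" (infix \<open>\<prec>\<^sub>s\<close> 50) where
  "s \<prec>\<^sub>s t \<longleftrightarrow>
     (s = [] \<and> t \<noteq> []) \<or>
     (s \<noteq> [] \<and> t \<noteq> [] \<and>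
       (last s < last t \<or> (last s = last t \<and> (s, t) \<in> lexord {(a, b). a < b})))"

definition preceq :: "nat list \<Rightarrow> nat list \<Rightarrow> bool" (infix \<open>\<preceq>\<^sub>s\<close> 50) where
  "s \<preceq>\<^sub>s t \<longleftrightarrow> s \<prec>\<^sub>s t \<or> s = t"

text \<open>The values of a tree function outside \<open>ndseqs_le k\<close> are irrelevant.\<close>

definition ek_tree :: "nat \<Rightarrow> (nat list \<Rightarrow> nat list) \<Rightarrow> bool" where
  "ek_tree k T \<longleftrightarrow>
     T ` ndseqs_le k \<subseteq> ndseqs_le k \<and>
     (\<forall>s\<in>ndseqs_le k. \<forall>t\<in>ndseqs_le k. s \<prec>\<^sub>s t \<longrightarrow> T s \<prec>\<^sub>s T t) \<and>
     (\<forall>s\<in>ndseqs_le k. \<forall>t\<in>ndseqs_le k. strict_prefix s t \<longrightarrow> strict_prefix (T s) (T t))"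

definition ek_space :: "nat \<Rightarrow> nat list set set" where
  "ek_space k = {T ` ndseqs k | T. ek_tree k T}"

text \<open>An element is among the \<open>n\<close> least ones iff it has fewer than \<open>n\<close> predecessors. Every set
  of predecessors is finite (lemma \<open>finite_preds\<close>), so \<open>card\<close> is meaningful here.\<close>

definition restr :: "nat \<Rightarrow> nat list set \<Rightarrow> nat list set" where
  "restr n X = {x \<in> X. card {y \<in> X. y \<prec>\<^sub>s x} < n}"

definition AR_n :: "nat \<Rightarrow> nat \<Rightarrow> nat list set set" where
  "AR_n k n = {restr n X | X. X \<in> ek_space k}"

definition AR :: "nat \<Rightarrow> nat list set set" where
  "AR k = (\<Union>n\<in>{1..}. AR_n k n)"

definition A_fam :: "nat \<Rightarrow> nat \<Rightarrow> nat list set set" where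
  "A_fam k d = (\<Union>i\<in>{1..d}. AR_n k i)"


section \<open>Admissible sequences and the norm\<close>

definition prec_max :: "nat list set \<Rightarrow> nat list" where
  "prec_max E = (THE x. x \<in> E \<and> (\<forall>y\<in>E. y \<preceq>\<^sub>s x))"

definition prec_min :: "nat list set \<Rightarrow> nat list" where
  "prec_min E = (THE x. x \<in> E \<and> (\<forall>y\<in>E. x \<preceq>\<^sub>s y))"

definition set_less :: "nat list set \<Rightarrow> nat list set \<Rightarrow> bool" where
  "set_less E F \<longleftrightarrow> prec_max E \<prec>\<^sub>s prec_min F"

definition set_le :: "nat list set \<Rightarrow> nat list set \<Rightarrow> bool" where
  "set_le E F \<longleftrightarrow> prec_max E \<preceq>\<^sub>s prec_min F"

text \<open>Finite sequences of sets are given by their values at \<open>1, \<dots>, m\<close>.\<close>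

definition admissible :: "nat \<Rightarrow> nat \<Rightarrow> nat \<Rightarrow> (nat \<Rightarrow> nat list set) \<Rightarrow> bool" where
  "admissible k d m E \<longleftrightarrow>
     1 \<le> m \<and> m \<le> d \<and> (\<forall>i\<in>{1..m}. E i \<in> AR k) \<and>
     (\<exists>v. v ` {1..m} \<in> A_fam k d \<and>
        (\<forall>i\<in>{1..m}. set_le {v i} (E i)) \<and>
        (\<forall>i\<in>{1..<m}. set_less (E i) {v (Suc i)}))"

text \<open>Functions on \<open>ndseqs k\<close> are extended by zero to all lists.\<close>

definition c00 :: "nat \<Rightarrow> (nat list \<Rightarrow> real) set" where
  "c00 k = {x. finite {v. x v \<noteq> 0} \<and> {v. x v \<noteq> 0} \<subseteq> ndseqs k}"

definition proj :: "nat list set \<Rightarrow> (nat list \<Rightarrow> real) \<Rightarrow> nat list \<Rightarrow> real" where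
  "proj E x = (\<lambda>v. if v \<in> E then x v else 0)"

primrec tnorm_seq :: "nat \<Rightarrow> nat \<Rightarrow> real \<Rightarrow> nat \<Rightarrow> (nat list \<Rightarrow> real) \<Rightarrow> real" where
  "tnorm_seq k d \<theta> 0 = (\<lambda>x. Max {\<bar>x v\<bar> | v. v \<in> ndseqs k})"
| "tnorm_seq k d \<theta> (Suc j) = (\<lambda>x. max (tnorm_seq k d \<theta> j x)
     (\<theta> * Max {\<Sum>i=1..m. tnorm_seq k d \<theta> j (proj (E i) x) | m E. admissible k d m E}))"

definition tnorm :: "nat \<Rightarrow> nat \<Rightarrow> real \<Rightarrow> (nat list \<Rightarrow> real) \<Rightarrow> real" where
  "tnorm k d \<theta> x = (SUP j. tnorm_seq k d \<theta> j x)"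


section \<open>Completions, \<open>\<ell>\<^sub>p\<close>, and saturation\<close>

definition linear_map_on :: "('x \<Rightarrow> real) set \<Rightarrow> (('x \<Rightarrow> real) \<Rightarrow> 'b::real_vector) \<Rightarrow> bool" where
  "linear_map_on V f \<longleftrightarrow>
     (\<forall>x\<in>V. \<forall>y\<in>V. f (\<lambda>v. x v + y v) = f x + f y) \<and>
     (\<forall>c. \<forall>x\<in>V. f (\<lambda>v. c * x v) = c *\<^sub>R f x)"

text \<open>\<open>C\<close> is a completion of the function space \<open>V\<close> with norm \<open>N\<close>, via the embedding \<open>J\<close>: a linear
  isometry of \<open>V\<close> onto a dense subspace of \<open>C\<close>, which is a closed subspace of a Banach space. The
  ambient Banach space is needed since a type cannot depend on the parameters of \<open>N\<close>.\<close>

definition is_completion ::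
  "('x \<Rightarrow> real) set \<Rightarrow> (('x \<Rightarrow> real) \<Rightarrow> real) \<Rightarrow> (('x \<Rightarrow> real) \<Rightarrow> 'b::banach) \<Rightarrow> 'b set \<Rightarrow> bool" where
  "is_completion V N J C \<longleftrightarrow>
     linear_map_on V J \<and> (\<forall>x\<in>V. norm (J x) = N x) \<and> closure (J ` V) = C"

definition lp :: "real \<Rightarrow> (nat \<Rightarrow> real) set" where
  "lp p = {a. summable (\<lambda>n. \<bar>a n\<bar> powr p)}"

definition lp_norm :: "real \<Rightarrow> (nat \<Rightarrow> real) \<Rightarrow> real" where
  "lp_norm p a = (\<Sum>n. \<bar>a n\<bar> powr p) powr (1 / p)"

text \<open>A linear homeomorphism of \<open>V\<close>, normed by \<open>N\<close>, onto \<open>Z\<close>; the last two conjuncts are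
  continuity of \<open>U\<close> and of its inverse.\<close>

definition isomorphic_to ::
  "('x \<Rightarrow> real) set \<Rightarrow> (('x \<Rightarrow> real) \<Rightarrow> real) \<Rightarrow> 'b::real_normed_vector set \<Rightarrow> bool" where
  "isomorphic_to V N Z \<longleftrightarrow>
     (\<exists>U. linear_map_on V U \<and> bij_betw U V Z \<and>
        (\<forall>a\<in>V. \<forall>\<epsilon>>0. \<exists>\<delta>>0. \<forall>b\<in>V. N (\<lambda>n. b n - a n) < \<delta> \<longrightarrow> norm (U b - U a) < \<epsilon>) \<and>
        (\<forall>a\<in>V. \<forall>\<epsilon>>0. \<exists>\<delta>>0. \<forall>b\<in>V. norm (U b - U a) < \<delta> \<longrightarrow> N (\<lambda>n. b n - a n) < \<epsilon>))"

definition infinite_dimensional :: "'b::real_vector set \<Rightarrow> bool" where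
  "infinite_dimensional Y \<longleftrightarrow> \<not> (\<exists>B. finite B \<and> Y \<subseteq> span B)"

definition lp_saturated :: "real \<Rightarrow> 'b::real_normed_vector set \<Rightarrow> bool" where
  "lp_saturated p C \<longleftrightarrow>
     (\<forall>Y. Y \<subseteq> C \<and> subspace Y \<and> closed Y \<and> infinite_dimensional Y \<longrightarrow>
        (\<exists>Z. Z \<subseteq> Y \<and> subspace Z \<and> closed Z \<and> isomorphic_to (lp p) (lp_norm p) Z))"


section \<open>Existence of the completion\<close>

lemma lexord_nat_linear: "(s, t) \<in> lexord {(a, b). a < (b::nat)} \<or> s = t \<or> (t, s) \<in> lexord {(a, b). a < b}"
  by (rule lexord_linear) auto

lemma lexord_nat_trans:
  "(s, t) \<in> lexord {(a, b). a < (b::nat)} \<Longrightarrow> (t, u) \<in> lexord {(a, b). a < b} \<Longrightarrow> (s, u) \<in> lexord {(a, b). a < b}"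
  by (rule lexord_trans) (auto simp: trans_def)

lemma prec_irrefl: "\<not> s \<prec>\<^sub>s s"
  by (auto simp: prec_def lexord_irreflexive)

lemma prec_trans: "s \<prec>\<^sub>s t \<Longrightarrow> t \<prec>\<^sub>s u \<Longrightarrow> s \<prec>\<^sub>s u"
  unfolding prec_def using lexord_nat_trans[of s t u] by auto

lemma prec_linear: "s \<prec>\<^sub>s t \<or> s = t \<or> t \<prec>\<^sub>s s"
  unfolding prec_def using lexord_nat_linear[of s t] by auto

lemma preceq_trans: "s \<preceq>\<^sub>s t \<Longrightarrow> t \<preceq>\<^sub>s u \<Longrightarrow> s \<preceq>\<^sub>s u"
  and prec_preceq_trans: "s \<prec>\<^sub>s t \<Longrightarrow> t \<preceq>\<^sub>s u \<Longrightarrow> s \<prec>\<^sub>s u"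
  and preceq_prec_trans: "s \<preceq>\<^sub>s t \<Longrightarrow> t \<prec>\<^sub>s u \<Longrightarrow> s \<prec>\<^sub>s u"
  unfolding preceq_def using prec_trans by blast+

lemma finite_preds: "finite {y \<in> ndseqs_le k. y \<prec>\<^sub>s x}"
proof -
  have "y \<in> {xs. set xs \<subseteq> {0..last x} \<and> length xs \<le> k}" if "y \<in> ndseqs_le k" "y \<prec>\<^sub>s x" for y
  proof -
    have "z \<le> last x" if "z \<in> set y" for z
    proof -
      obtain ys l where y: "y = ys @ [l]" using \<open>z \<in> set y\<close> by (cases y rule: rev_cases) auto
      then have "z \<le> last y" using \<open>y \<in> ndseqs_le k\<close> \<open>z \<in> set y\<close>
        by (auto simp: ndseqs_le_def sorted_append)
      also have "last y \<le> last x" using \<open>y \<prec>\<^sub>s x\<close> y by (auto simp: prec_def)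
      finally show ?thesis .
    qed
    then show ?thesis using that by (auto simp: ndseqs_le_def)
  qed
  then have "{y \<in> ndseqs_le k. y \<prec>\<^sub>s x} \<subseteq> {xs. set xs \<subseteq> {0..last x} \<and> length xs \<le> k}" by blast
  then show ?thesis by (rule finite_subset) (simp add: finite_lists_length_le)
qed

lemma finite_preds': "X \<subseteq> ndseqs_le k \<Longrightarrow> finite {y \<in> X. y \<prec>\<^sub>s x}"
  by (rule finite_subset[OF _ finite_preds[of k x]]) auto

lemma ex_prec_max:
  assumes "finite E" "E \<noteq> {}" shows "\<exists>x\<in>E. \<forall>y\<in>E. y \<preceq>\<^sub>s x"
  using assms
proof (induction rule: finite_ne_induct)
  case (singleton x) then show ?case by (auto simp: preceq_def)
next
  case (insert x F)
  then obtain m where "m \<in> F" "\<forall>y\<in>F. y \<preceq>\<^sub>s m" by blast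
  then show ?case using prec_linear[of x m] prec_trans unfolding preceq_def by blast
qed

lemma ex_prec_min:
  assumes "finite E" "E \<noteq> {}" shows "\<exists>x\<in>E. \<forall>y\<in>E. x \<preceq>\<^sub>s y"
  using assms
proof (induction rule: finite_ne_induct)
  case (singleton x) then show ?case by (auto simp: preceq_def)
next
  case (insert x F)
  then obtain m where "m \<in> F" "\<forall>y\<in>F. m \<preceq>\<^sub>s y" by blast
  then show ?case using prec_linear[of x m] prec_trans unfolding preceq_def by blast
qed

lemma preceq_antisym: "x \<preceq>\<^sub>s y \<Longrightarrow> y \<preceq>\<^sub>s x \<Longrightarrow> x = y"
  unfolding preceq_def using prec_trans prec_irrefl by blast

lemma prec_max:
  assumes "finite E" "E \<noteq> {}" shows "prec_max E \<in> E \<and> (\<forall>y\<in>E. y \<preceq>\<^sub>s prec_max E)"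
proof -
  obtain x where x: "x \<in> E \<and> (\<forall>y\<in>E. y \<preceq>\<^sub>s x)" using ex_prec_max[OF assms] by blast
  then show ?thesis unfolding prec_max_def by (rule theI) (use x preceq_antisym in blast)
qed

lemma prec_min:
  assumes "finite E" "E \<noteq> {}" shows "prec_min E \<in> E \<and> (\<forall>y\<in>E. prec_min E \<preceq>\<^sub>s y)"
proof -
  obtain x where x: "x \<in> E \<and> (\<forall>y\<in>E. x \<preceq>\<^sub>s y)" using ex_prec_min[OF assms] by blast
  then show ?thesis unfolding prec_min_def by (rule theI) (use x preceq_antisym in blast)
qed

lemma prec_max_single [simp]: "prec_max {v} = v" and prec_min_single [simp]: "prec_min {v} = v"
  using prec_max[of "{v}"] prec_min[of "{v}"] by auto

lemma ndseqs_subset: "ndseqs k \<subseteq> ndseqs_le k"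
  by (auto simp: ndseqs_def ndseqs_le_def)

lemma ek_tree_length:
  assumes "ek_tree k T" "s \<in> ndseqs_le k" shows "length s \<le> length (T s)"
  using assms(2)
proof (induction s rule: rev_induct)
  case (snoc a s)
  then have s: "s \<in> ndseqs_le k" by (auto simp: ndseqs_le_def sorted_append)
  then have "strict_prefix (T s) (T (s @ [a]))"
    using assms(1) snoc.prems unfolding ek_tree_def by (auto simp: strict_prefix_def)
  then show ?case using snoc.IH[OF s] prefix_length_less by fastforce
qed simp

lemma ek_space_subset:
  assumes "X \<in> ek_space k" shows "X \<subseteq> ndseqs k"
proof
  fix x assume "x \<in> X"
  then obtain T s where T: "ek_tree k T" and s: "s \<in> ndseqs k" "x = T s"
    using assms by (auto simp: ek_space_def)
  then have "x \<in> ndseqs_le k" using ndseqs_subset by (auto simp: ek_tree_def)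
  moreover have "k \<le> length x"
    using ek_tree_length[OF T, of s] s ndseqs_subset by (auto simp: ndseqs_def)
  ultimately show "x \<in> ndseqs k" by (auto simp: ndseqs_def ndseqs_le_def)
qed

lemma ek_space_nonempty:
  assumes "X \<in> ek_space k" shows "X \<noteq> {}"
proof -
  have "replicate k 0 \<in> ndseqs k" by (auto simp: ndseqs_def)
  then show ?thesis using assms by (auto simp: ek_space_def)
qed

lemma AR_props:
  assumes "E \<in> AR k" shows "finite E" "E \<noteq> {}" "E \<subseteq> ndseqs k"
proof -
  obtain X n where X: "X \<in> ek_space k" and n: "n \<ge> 1" and E: "E = restr n X"
    using assms by (auto simp: AR_def AR_n_def)
  have X': "X \<subseteq> ndseqs k" "X \<subseteq> ndseqs_le k"
    using ek_space_subset[OF X] ndseqs_subset by auto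
  note fin = finite_preds'[OF X'(2)]
  show "E \<subseteq> ndseqs k" using X' by (auto simp: E restr_def)
  show "E \<noteq> {}"
  proof -
    obtain x where x: "x \<in> X" using ek_space_nonempty[OF X] by blast
    then have "finite (insert x {y \<in> X. y \<prec>\<^sub>s x})" using fin by auto
    then obtain m where m: "m \<in> insert x {y \<in> X. y \<prec>\<^sub>s x}"
      "\<forall>y\<in>insert x {y \<in> X. y \<prec>\<^sub>s x}. m \<preceq>\<^sub>s y" using ex_prec_min by blast
    have "{y \<in> X. y \<prec>\<^sub>s m} = {}"
    proof -
      have False if y: "y \<in> X" "y \<prec>\<^sub>s m" for y
      proof -
        have "m \<preceq>\<^sub>s x" using m by auto
        then have "y \<prec>\<^sub>s x" using y prec_preceq_trans by blast
        then have "m \<preceq>\<^sub>s y" using m y by auto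
        then show False using y prec_preceq_trans prec_irrefl by blast
      qed
      then show ?thesis by blast
    qed
    moreover have "m \<in> X" using m x by auto
    ultimately have "m \<in> E" using n by (simp only: E restr_def mem_Collect_eq card.empty) simp
    then show ?thesis by blast
  qed
  show "finite E"
  proof (rule ccontr)
    assume "infinite E"
    then obtain F where F: "F \<subseteq> E" "card F = Suc n" "finite F"
      using infinite_arbitrarily_large by blast
    then obtain m where m: "m \<in> F" "\<forall>y\<in>F. y \<preceq>\<^sub>s m" using ex_prec_max[of F] by fastforce
    have "F - {m} \<subseteq> {y \<in> X. y \<prec>\<^sub>s m}" using m F by (auto simp: preceq_def E restr_def)
    then have "card (F - {m}) \<le> card {y \<in> X. y \<prec>\<^sub>s m}" using fin card_mono by blast
    moreover have "card (F - {m}) = n" using F m by simp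
    moreover have "card {y \<in> X. y \<prec>\<^sub>s m} < n" using m F by (auto simp: E restr_def)
    ultimately show False by simp
  qed
qed

lemma admissible_disjoint:
  assumes "admissible k d m E" "1 \<le> i" "i < j" "j \<le> m" shows "E i \<inter> E j = {}"
proof -
  obtain v where v: "\<forall>i\<in>{1..m}. set_le {v i} (E i)" "\<forall>i\<in>{1..<m}. set_less (E i) {v (Suc i)}"
    using assms(1) by (auto simp: admissible_def)
  have AR: "E i \<in> AR k" if "1 \<le> i" "i \<le> m" for i using assms(1) that by (auto simp: admissible_def)
  have mx: "\<forall>y\<in>E i. y \<preceq>\<^sub>s prec_max (E i)" and mn: "\<forall>y\<in>E i. prec_min (E i) \<preceq>\<^sub>s y"
    and mm: "prec_max (E i) \<in> E i"
    if "1 \<le> i" "i \<le> m" for i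
    using prec_max[of "E i"] prec_min[of "E i"] AR_props[OF AR[OF that]] by auto
  have step: "prec_max (E i) \<prec>\<^sub>s prec_min (E (Suc i))" if "1 \<le> i" "Suc i \<le> m" for i
    using v(1)[rule_format, of "Suc i"] v(2)[rule_format, of i] that
    by (auto simp: set_le_def set_less_def intro: prec_preceq_trans)
  have "prec_max (E i) \<prec>\<^sub>s prec_min (E j)"
    using assms(3,4)
  proof (induction j)
    case (Suc j)
    show ?case
    proof (cases "i = j")
      case True then show ?thesis using step[of i] assms(2) Suc.prems by simp
    next
      case False
      then have j: "i < j" "j \<le> m" using Suc.prems by auto
      have "prec_min (E j) \<preceq>\<^sub>s prec_max (E j)" using mn mm j assms(2) by auto
      moreover have "prec_max (E j) \<prec>\<^sub>s prec_min (E (Suc j))"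
        using step[of j] j assms(2) Suc.prems by auto
      ultimately show ?thesis by (rule prec_trans[OF Suc.IH[OF j] preceq_prec_trans])
    qed
  qed simp
  then have lt: "prec_max (E i) \<prec>\<^sub>s prec_min (E j)" .
  have False if y: "y \<in> E i" "y \<in> E j" for y
  proof -
    have "y \<preceq>\<^sub>s prec_max (E i)" using mx[of i] y(1) assms by simp
    moreover have "prec_min (E j) \<preceq>\<^sub>s y" using mn[of j] y(2) assms by simp
    ultimately have "y \<prec>\<^sub>s y" using lt by (meson preceq_prec_trans prec_preceq_trans)
    then show False using prec_irrefl by simp
  qed
  then show ?thesis by blast
qed

lemma restr_1_ndseqs:
  assumes "k \<ge> 1" shows "restr 1 (ndseqs k) = {replicate k 0}"
proof -
  let ?z = "replicate k (0::nat)"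
  have z: "?z \<noteq> []" "last ?z = 0" using assms by simp_all
  have min: "?z \<preceq>\<^sub>s s" if s: "s \<in> ndseqs k" for s
  proof (cases "last s = 0")
    case True
    have "s \<noteq> []" using s assms by (auto simp: ndseqs_def)
    then obtain t l where t: "s = t @ [l]" by (cases s rule: rev_cases) simp_all
    have zero: "x = 0" if x: "x \<in> set s" for x
    proof -
      have "x \<le> l" using s x unfolding t by (auto simp: ndseqs_def sorted_append)
      then show ?thesis using True by (simp add: t)
    qed
    have len: "length s = k" using s by (simp add: ndseqs_def)
    have "s = ?z" by (rule replicate_eqI[OF len zero])
    then show ?thesis by (simp add: preceq_def)
  next
    case False
    have "s \<noteq> []" using s assms by (auto simp: ndseqs_def)
    then show ?thesis using False z by (simp add: preceq_def prec_def)
  qed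
  have mem: "?z \<in> ndseqs k" by (simp add: ndseqs_def)
  have card: "card {y \<in> ndseqs k. y \<prec>\<^sub>s x} < 1 \<longleftrightarrow> {y \<in> ndseqs k. y \<prec>\<^sub>s x} = {}" for x
    unfolding less_one card_0_eq[OF finite_preds'[OF ndseqs_subset, of k x]] ..
  have "\<not> y \<prec>\<^sub>s ?z" if "y \<in> ndseqs k" for y
    using preceq_prec_trans[OF min[OF that]] prec_irrefl[of ?z] by blast
  then have "?z \<in> restr 1 (ndseqs k)" unfolding restr_def card using mem by blast
  moreover have "x = ?z" if x: "x \<in> restr 1 (ndseqs k)" for x
  proof -
    have "x \<in> ndseqs k" "\<not> ?z \<prec>\<^sub>s x" using x mem unfolding restr_def card by blast+
    then show ?thesis using min[of x] unfolding preceq_def by simp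
  qed
  ultimately show ?thesis by blast
qed

lemma ex_admissible:
  assumes "k \<ge> 1" "d \<ge> 1" shows "\<exists>m E. admissible k d m E"
proof -
  define z where "z = replicate k (0::nat)"
  have "ek_tree k id" by (simp add: ek_tree_def)
  then have "ndseqs k \<in> ek_space k" unfolding ek_space_def
    by (intro CollectI exI[of _ id] conjI) simp_all
  then have "restr 1 (ndseqs k) \<in> AR_n k 1" unfolding AR_n_def by blast
  then have A: "{z} \<in> AR_n k 1" unfolding z_def restr_1_ndseqs[OF assms(1)] .
  have AR: "{z} \<in> AR k" unfolding AR_def using A by (intro UN_I[of 1]) simp_all
  have A_fam: "{z} \<in> A_fam k d" unfolding A_fam_def
    using A assms(2) by (intro UN_I[of 1]) simp_all
  have "admissible k d 1 (\<lambda>_. {z})"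
    unfolding admissible_def
  proof (intro conjI exI[of _ "\<lambda>_. z"])
    show "(\<lambda>_. z) ` {1..1::nat} \<in> A_fam k d" using A_fam by simp
  qed (use assms(2) AR in \<open>auto simp: set_le_def preceq_def\<close>)
  then show ?thesis by blast
qed

lemma c00_subset:
  assumes "x \<in> c00 k" "{v. y v \<noteq> 0} \<subseteq> {v. x v \<noteq> 0}" shows "y \<in> c00 k"
  using assms finite_subset[OF assms(2)] unfolding c00_def by blast

lemma proj_c00: "x \<in> c00 k \<Longrightarrow> proj E x \<in> c00 k"
  by (rule c00_subset) (auto simp: proj_def)

lemma finite_tnorm_values:
  assumes "x \<in> c00 k"
  shows "finite {\<Sum>i=1..m. f (proj (E i) x) | m E. admissible k d m E}" (is "finite ?A")
proof -
  define S where "S = (\<lambda>D. f (proj D x)) ` Pow {v. x v \<noteq> 0}"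
  have S: "finite S" using assms by (simp add: S_def c00_def)
  have mem: "f (proj D x) \<in> S" for D
  proof -
    have "proj D x = proj (D \<inter> {v. x v \<noteq> 0}) x" by (auto simp: proj_def)
    then show ?thesis by (auto simp: S_def)
  qed
  let ?B = "\<Union>m\<in>{1..d}. (\<lambda>g. \<Sum>i=1..m. g i) ` PiE {1..m} (\<lambda>_. S)"
  have "?A \<subseteq> ?B"
  proof safe
    fix m E assume "admissible k d m E"
    then have m: "m \<in> {1..d}" by (auto simp: admissible_def)
    have "(\<Sum>i=1..m. f (proj (E i) x)) = (\<Sum>i=1..m. restrict (\<lambda>i. f (proj (E i) x)) {1..m} i)"
      by (rule sum.cong) auto
    moreover have "restrict (\<lambda>i. f (proj (E i) x)) {1..m} \<in> PiE {1..m} (\<lambda>_. S)"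
      using mem by auto
    ultimately show "(\<Sum>i=1..m. f (proj (E i) x)) \<in> ?B" using m by blast
  qed
  moreover have "finite ?B" using S by (intro finite_UN_I finite_imageI finite_PiE) auto
  ultimately show ?thesis by (rule finite_subset)
qed

lemma finite_tnorm_0_values:
  assumes "x \<in> c00 k" shows "finite {\<bar>x v\<bar> | v. v \<in> ndseqs k}"
proof -
  have "{\<bar>x v\<bar> | v. v \<in> ndseqs k} \<subseteq> insert 0 ((\<lambda>v. \<bar>x v\<bar>) ` {v. x v \<noteq> 0})" by auto
  then show ?thesis by (rule finite_subset) (use assms in \<open>simp add: c00_def\<close>)
qed

lemma ndseqs_nonempty: "ndseqs k \<noteq> {}"
proof -
  have "replicate k 0 \<in> ndseqs k" by (auto simp: ndseqs_def)
  then show ?thesis by blast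
qed

lemma tnorm_seq_bound:
  assumes "k \<ge> 1" "d \<ge> 1" "0 < \<theta>" "\<theta> < 1" "x \<in> c00 k"
  shows "tnorm_seq k d \<theta> j x \<le> (\<Sum>v | x v \<noteq> 0. \<bar>x v\<bar>)"
  using assms(5)
proof (induction j arbitrary: x)
  case 0
  let ?A = "{\<bar>x v\<bar> | v. v \<in> ndseqs k}"
  have "Max ?A \<in> ?A"
    using finite_tnorm_0_values[OF 0] ndseqs_nonempty by (intro Max_in) auto
  then obtain v where v: "Max ?A = \<bar>x v\<bar>" by blast
  have "\<bar>x v\<bar> \<le> (\<Sum>v | x v \<noteq> 0. \<bar>x v\<bar>)"
  proof (cases "x v = 0")
    case True then show ?thesis by (simp add: sum_nonneg)
  next
    case False then show ?thesis using 0 by (intro member_le_sum) (auto simp: c00_def)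
  qed
  then show ?case using v by simp
next
  case (Suc j)
  let ?s = "{v. x v \<noteq> 0}"
  let ?A = "{\<Sum>i=1..m. tnorm_seq k d \<theta> j (proj (E i) x) | m E. admissible k d m E}"
  have fin: "finite ?s" using Suc.prems by (simp add: c00_def)
  have "Max ?A \<in> ?A"
    using finite_tnorm_values[OF Suc.prems] ex_admissible[OF assms(1,2)] by (intro Max_in) auto
  then obtain m E where mE: "admissible k d m E"
    "Max ?A = (\<Sum>i=1..m. tnorm_seq k d \<theta> j (proj (E i) x))" by blast
  have "Max ?A \<le> (\<Sum>i=1..m. \<Sum>v\<in>E i \<inter> ?s. \<bar>x v\<bar>)"
    unfolding mE(2)
  proof (rule sum_mono)
    fix i
    have "tnorm_seq k d \<theta> j (proj (E i) x) \<le> (\<Sum>v | proj (E i) x v \<noteq> 0. \<bar>proj (E i) x v\<bar>)"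
      by (rule Suc.IH[OF proj_c00[OF Suc.prems]])
    also have "\<dots> = (\<Sum>v\<in>E i \<inter> ?s. \<bar>x v\<bar>)"
      by (rule sum.cong) (auto simp: proj_def split: if_splits)
    finally show "tnorm_seq k d \<theta> j (proj (E i) x) \<le> (\<Sum>v\<in>E i \<inter> ?s. \<bar>x v\<bar>)" .
  qed
  also have "\<dots> = (\<Sum>v\<in>(\<Union>i\<in>{1..m}. E i \<inter> ?s). \<bar>x v\<bar>)"
  proof (rule sum.UNION_disjoint[symmetric])
    show "\<forall>i\<in>{1..m}. \<forall>j\<in>{1..m}. i \<noteq> j \<longrightarrow> E i \<inter> ?s \<inter> (E j \<inter> ?s) = {}"
    proof (intro ballI impI)
      fix i j assume "i \<in> {1..m}" "j \<in> {1..m}" "i \<noteq> j"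
      then have "E i \<inter> E j = {}"
        using admissible_disjoint[OF mE(1), of i j] admissible_disjoint[OF mE(1), of j i]
        by (cases "i < j") auto
      then show "E i \<inter> ?s \<inter> (E j \<inter> ?s) = {}" by blast
    qed
  qed (use fin in auto)
  also have "\<dots> \<le> (\<Sum>v\<in>?s. \<bar>x v\<bar>)" by (rule sum_mono2) (use fin in auto)
  finally have le: "Max ?A \<le> (\<Sum>v\<in>?s. \<bar>x v\<bar>)" .
  have "\<theta> * Max ?A \<le> \<theta> * (\<Sum>v\<in>?s. \<bar>x v\<bar>)" using le assms(3) by simp
  also have "\<dots> \<le> 1 * (\<Sum>v\<in>?s. \<bar>x v\<bar>)"
    using assms(4) by (intro mult_right_mono) (auto intro: sum_nonneg)
  finally show ?case using Suc.IH[OF Suc.prems] by simp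
qed

text \<open>Norming functionals for the norms \<open>tnorm_seq k d \<theta> j\<close>.\<close>

inductive nfun :: "nat \<Rightarrow> nat \<Rightarrow> real \<Rightarrow> nat \<Rightarrow> ((nat list \<Rightarrow> real) \<Rightarrow> real) \<Rightarrow> bool"
  for k d \<theta> where
  coord: "\<bar>s\<bar> = 1 \<Longrightarrow> v \<in> ndseqs k \<Longrightarrow> nfun k d \<theta> 0 (\<lambda>x. s * x v)"
| lift: "nfun k d \<theta> j f \<Longrightarrow> nfun k d \<theta> (Suc j) f"
| step: "admissible k d m E \<Longrightarrow> (\<And>i. nfun k d \<theta> j (g i)) \<Longrightarrow>
    nfun k d \<theta> (Suc j) (\<lambda>x. \<theta> * (\<Sum>i=1..m. g i (proj (E i) x)))"

lemma nfun_add: "nfun k d \<theta> j f \<Longrightarrow> f (\<lambda>v. x v + y v) = f x + f y"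
proof (induction arbitrary: x y rule: nfun.induct)
  case (coord s v)
  show ?case by (rule distrib_left)
next
  case (lift j f)
  show ?case by (rule lift.IH)
next
  case (step m E j g)
  have "proj D (\<lambda>v. x v + y v) = (\<lambda>v. proj D x v + proj D y v)" for D
    by (auto simp: proj_def)
  then have "g i (proj (E i) (\<lambda>v. x v + y v)) = g i (proj (E i) x) + g i (proj (E i) y)" for i
    using step.IH[of i "proj (E i) x" "proj (E i) y"] by metis
  then have "(\<Sum>i=1..m. g i (proj (E i) (\<lambda>v. x v + y v))) =
      (\<Sum>i=1..m. g i (proj (E i) x)) + (\<Sum>i=1..m. g i (proj (E i) y))"
    by (simp only: sum.distrib)
  then show ?case by (simp only: distrib_left)
qed

lemma nfun_scale: "nfun k d \<theta> j f \<Longrightarrow> f (\<lambda>v. c * x v) = c * f x"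
proof (induction arbitrary: x rule: nfun.induct)
  case (coord s v)
  show ?case by (rule mult.left_commute)
next
  case (lift j f)
  show ?case by (rule lift.IH)
next
  case (step m E j g)
  have "proj D (\<lambda>v. c * x v) = (\<lambda>v. c * proj D x v)" for D
    by (auto simp: proj_def)
  then have "g i (proj (E i) (\<lambda>v. c * x v)) = c * g i (proj (E i) x)" for i
    using step.IH[of i "proj (E i) x"] by metis
  then have "(\<Sum>i=1..m. g i (proj (E i) (\<lambda>v. c * x v))) = c * (\<Sum>i=1..m. g i (proj (E i) x))"
    by (simp only: sum_distrib_left)
  then show ?case by (simp only: mult.left_commute)
qed

lemma nfun_le:
  assumes "0 < \<theta>"
  shows "nfun k d \<theta> j f \<Longrightarrow> x \<in> c00 k \<Longrightarrow> \<bar>f x\<bar> \<le> tnorm_seq k d \<theta> j x"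
proof (induction arbitrary: x rule: nfun.induct)
  case (coord s v)
  then have "\<bar>s * x v\<bar> \<in> {\<bar>x v\<bar> | v. v \<in> ndseqs k}" by (auto simp: abs_mult)
  then show ?case using finite_tnorm_0_values[OF coord.prems] by (auto intro: Max_ge)
next
  case (lift j f)
  show ?case using lift.IH[OF lift.prems] by (simp add: le_max_iff_disj)
next
  case (step m E j g)
  let ?A = "{\<Sum>i=1..m. tnorm_seq k d \<theta> j (proj (E i) x) | m E. admissible k d m E}"
  have "\<bar>\<Sum>i=1..m. g i (proj (E i) x)\<bar> \<le> (\<Sum>i=1..m. tnorm_seq k d \<theta> j (proj (E i) x))"
    by (rule order_trans[OF sum_abs sum_mono]) (rule step.IH[OF proj_c00[OF step.prems]])
  also have "\<dots> \<le> Max ?A"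
    by (rule Max_ge[OF finite_tnorm_values[OF step.prems]]) (use step.hyps(1) in blast)
  finally have "\<bar>\<theta> * (\<Sum>i=1..m. g i (proj (E i) x))\<bar> \<le> \<theta> * Max ?A"
    using assms by (simp only: abs_mult abs_of_pos mult_le_cancel_left_pos)
  then show ?case unfolding tnorm_seq.simps le_max_iff_disj by (rule disjI2)
qed

lemma nfun_attained:
  assumes "k \<ge> 1" "d \<ge> 1"
  shows "x \<in> c00 k \<Longrightarrow> \<exists>f. nfun k d \<theta> j f \<and> f x = tnorm_seq k d \<theta> j x"
proof (induction j arbitrary: x)
  case 0
  let ?A = "{\<bar>x v\<bar> | v. v \<in> ndseqs k}"
  have "Max ?A \<in> ?A"
    using finite_tnorm_0_values[OF 0] ndseqs_nonempty by (intro Max_in) auto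
  then obtain v where v: "v \<in> ndseqs k" "Max ?A = \<bar>x v\<bar>" by blast
  define s :: real where "s = (if x v \<ge> 0 then 1 else -1)"
  have "nfun k d \<theta> 0 (\<lambda>x. s * x v)" using v(1) by (intro nfun.coord) (simp_all add: s_def)
  moreover have "s * x v = tnorm_seq k d \<theta> 0 x" using v(2) by (simp add: s_def)
  ultimately show ?case by (intro exI[of _ "\<lambda>x. s * x v"] conjI)
next
  case (Suc j)
  let ?A = "{\<Sum>i=1..m. tnorm_seq k d \<theta> j (proj (E i) x) | m E. admissible k d m E}"
  have "Max ?A \<in> ?A"
    using finite_tnorm_values[OF Suc.prems] ex_admissible[OF assms] by (intro Max_in) auto
  then obtain m E where mE: "admissible k d m E"
    "Max ?A = (\<Sum>i=1..m. tnorm_seq k d \<theta> j (proj (E i) x))" by blast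
  have "\<forall>i. \<exists>f. nfun k d \<theta> j f \<and> f (proj (E i) x) = tnorm_seq k d \<theta> j (proj (E i) x)"
    using Suc.IH[OF proj_c00[OF Suc.prems]] by (intro allI)
  then obtain g where g: "\<forall>i. nfun k d \<theta> j (g i) \<and>
      g i (proj (E i) x) = tnorm_seq k d \<theta> j (proj (E i) x)"
    by (rule choice[THEN exE])
  show ?case
  proof (cases "tnorm_seq k d \<theta> j x \<ge> \<theta> * Max ?A")
    case True
    obtain f where f: "nfun k d \<theta> j f" "f x = tnorm_seq k d \<theta> j x"
      using Suc.IH[OF Suc.prems] by (elim exE conjE)
    have "f x = tnorm_seq k d \<theta> (Suc j) x" using True f(2) unfolding tnorm_seq.simps by linarith
    then show ?thesis using nfun.lift[OF f(1)] by (intro exI[of _ f] conjI)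
  next
    case False
    let ?f = "\<lambda>x. \<theta> * (\<Sum>i=1..m. g i (proj (E i) x))"
    have "nfun k d \<theta> (Suc j) ?f" by (rule nfun.step[OF mE(1)]) (use g in blast)
    moreover have "?f x = \<theta> * Max ?A" using g by (simp only: mE(2))
    then have "?f x = tnorm_seq k d \<theta> (Suc j) x" using False unfolding tnorm_seq.simps by linarith
    ultimately show ?thesis by (intro exI[of _ ?f] conjI)
  qed
qed

instance bcontfun :: (metric_space, banach) banach ..

lemma completion_exists:
  assumes "k \<ge> 1" "d \<ge> 1" "0 < \<theta>" "\<theta> < 1"
  shows "\<exists>J (T :: (((nat list \<Rightarrow> real) \<Rightarrow> real) discrete \<Rightarrow>\<^sub>C real) set).
           is_completion (c00 k) (tnorm k d \<theta>) J T"
proof -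
  let ?W = "{f. \<exists>j. nfun k d \<theta> j f}"
  let ?g = "\<lambda>x f. if of_discrete f \<in> ?W then of_discrete f x else 0"
  define J :: "(nat list \<Rightarrow> real) \<Rightarrow> ((nat list \<Rightarrow> real) \<Rightarrow> real) discrete \<Rightarrow>\<^sub>C real"
    where "J x = Bcontfun (?g x)" for x
  have bdd: "bdd_above (range (\<lambda>j. tnorm_seq k d \<theta> j x))" if "x \<in> c00 k" for x
    using tnorm_seq_bound[OF assms that] by (intro bdd_aboveI[of _ "\<Sum>v | x v \<noteq> 0. \<bar>x v\<bar>"]) auto
  have W_le: "\<bar>f x\<bar> \<le> tnorm k d \<theta> x" if x: "x \<in> c00 k" and f: "f \<in> ?W" for f x
  proof -
    obtain j where j: "nfun k d \<theta> j f" using f by (elim CollectE exE)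
    have "\<bar>f x\<bar> \<le> tnorm_seq k d \<theta> j x" by (rule nfun_le[OF assms(3) j x])
    also have "\<dots> \<le> tnorm k d \<theta> x"
      unfolding tnorm_def by (rule cSUP_upper[OF _ bdd[OF x]]) simp
    finally show ?thesis .
  qed
  have nonneg: "0 \<le> tnorm k d \<theta> x" if x: "x \<in> c00 k" for x
  proof -
    obtain f where "nfun k d \<theta> 0 f" using nfun_attained[OF assms(1,2) x] by metis
    then have "f \<in> ?W" by blast
    then show ?thesis using W_le[OF x] abs_ge_zero order_trans by blast
  qed
  have app: "apply_bcontfun (J x) f = ?g x f" if x: "x \<in> c00 k" for x f
  proof -
    have "continuous_on UNIV (?g x)"
      unfolding continuous_on_open_vimage[OF open_UNIV] using open_discrete by blast
    moreover have "norm (?g x f) \<le> tnorm k d \<theta> x" for f using W_le[OF x] nonneg[OF x] by auto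
    ultimately have "?g x \<in> bcontfun" by (rule bcontfun_normI)
    then show ?thesis by (simp add: J_def Bcontfun_inverse)
  qed
  have add: "(\<lambda>v. x v + y v) \<in> c00 k" if "x \<in> c00 k" "y \<in> c00 k" for x y
  proof -
    have "{v. x v + y v \<noteq> 0} \<subseteq> {v. x v \<noteq> 0} \<union> {v. y v \<noteq> 0}" by auto
    then show ?thesis using that by (auto simp: c00_def intro: finite_subset)
  qed
  have scale: "(\<lambda>v. c * x v) \<in> c00 k" if "x \<in> c00 k" for x c
    by (rule c00_subset[OF that]) auto
  have "linear_map_on (c00 k) J"
    unfolding linear_map_on_def
  proof (intro conjI ballI allI)
    fix x y assume xy: "x \<in> c00 k" "y \<in> c00 k"
    have "f (\<lambda>v. x v + y v) = f x + f y" if "f \<in> ?W" for f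
      using that by (elim CollectE exE) (rule nfun_add)
    then show "J (\<lambda>v. x v + y v) = J x + J y"
      by (intro bcontfun_eqI) (simp add: app[OF xy(1)] app[OF xy(2)] app[OF add[OF xy]])
  next
    fix c x assume x: "x \<in> c00 k"
    have "f (\<lambda>v. c * x v) = c * f x" if "f \<in> ?W" for f
      using that by (elim CollectE exE) (rule nfun_scale)
    then show "J (\<lambda>v. c * x v) = c *\<^sub>R J x"
      by (intro bcontfun_eqI) (simp add: app[OF x] app[OF scale[OF x]])
  qed
  moreover have "norm (J x) = tnorm k d \<theta> x" if x: "x \<in> c00 k" for x
  proof (rule antisym)
    show "norm (J x) \<le> tnorm k d \<theta> x"
      by (rule norm_bound) (use app[OF x] W_le[OF x] nonneg[OF x] in auto)
    show "tnorm k d \<theta> x \<le> norm (J x)"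
      unfolding tnorm_def
    proof (rule cSUP_least)
      fix j
      obtain f where f: "nfun k d \<theta> j f" "f x = tnorm_seq k d \<theta> j x"
        using nfun_attained[OF assms(1,2) x] by metis
      then have "apply_bcontfun (J x) (discrete f) = tnorm_seq k d \<theta> j x"
        using app[OF x] by (auto simp: discrete_inverse)
      then show "tnorm_seq k d \<theta> j x \<le> norm (J x)"
        using norm_bounded[of "J x" "discrete f"] by simp
    qed simp
  qed
  ultimately show ?thesis unfolding is_completion_def by blast
qed

end

theory Submission
  imports Defs
begin

text \<open>
  A closed subspace contains normalized vectors that are arbitrarily close to a block sequence
  \<open>(u\<^sub>i)\<close>. Every block sequence has an upper \<open>\<ell>\<^sub>p\<close> estimate: in a tree of admissible splittings,
  each block that is cut owns a subtree that acts on nothing else, and by Hoelder's inequality these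
  subtrees pay for it. For the lower estimate let \<open>C\<^sub>s\<close> be the set of extensions of \<open>s\<close>, and choose
  \<open>s\<close> maximal such that the projections of \<open>u\<^sub>i\<close> to \<open>C\<^sub>s\<close> stay bounded away from \<open>0\<close> along a
  subsequence. Then the projections to each \<open>C\<^bsub>s@[n]\<^esub>\<close> tend to \<open>0\<close>, so that, after removing
  finitely many of these cones, what remains of \<open>u\<^sub>i\<close> lives on sequences \<open>s @ t\<close> whose \<open>t\<close> has
  entries in an interval \<open>[N\<^sub>i, M\<^sub>i]\<close>. A single member of \<open>\<A>\<R>\<^sup>k\<close> covers a whole interval of such
  blocks, and if the gaps between the intervals are large, any \<open>d\<close> successive groups of blocks are
  admissible. A lower \<open>\<ell>\<^sub>p\<close> estimate follows by splitting \<open>[0, 1)\<close> repeatedly into \<open>d\<close> equal parts,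
  as in the construction of Gilbert--Moore codes.
\<close>

section \<open>Subspaces isomorphic to \<open>\<ell>\<^sub>p\<close>\<close>

text \<open>Since \<theta> = d^(1/p - 1), Hoelder's inequality shows that splitting into at most d
  pieces never beats the l_p norm, with equality for d pieces of equal mass. The lower estimate thus
  needs splittings so balanced that the loss does not accumulate over the levels. The obstacle to
  the lower estimate is that members of AR^k are thin. Let E in AR^k come from a tree T, with all
  last entries at least N. Then T(0,...,0) lies in E, and it precedes T(u) whenever the last entry
  of u is nonzero. So every member of E agrees with the stem T(0,...,0) for a while and has entries
  at least N from there on. A block whose mass is spread over many small leading entries cannot be
  kept whole by a set E placed beyond the earlier blocks. Localizing to one cone, with large entries
  after s, gives vectors of the only shape that such an E can cover. The separating vectors v_1,
  ..., v_m must themselves begin a member of E_k. Only the first d elements of a tree matter for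
  this, so a gap depending on k and d alone suffices.\<close>

lemma lp_scale: "a \<in> lp p \<Longrightarrow> (\<lambda>i. t * a i) \<in> lp p"
  by (auto simp: lp_def abs_mult powr_mult intro: summable_mult)

lemma lp_add:
  assumes "p > 0" "a \<in> lp p" "b \<in> lp p" shows "(\<lambda>i. a i + b i) \<in> lp p"
proof -
  have "\<bar>a i + b i\<bar> powr p \<le> 2 powr p * (\<bar>a i\<bar> powr p + \<bar>b i\<bar> powr p)" for i
  proof -
    have "\<bar>a i + b i\<bar> powr p \<le> (2 * max \<bar>a i\<bar> \<bar>b i\<bar>) powr p"
      using assms(1) by (intro powr_mono2) auto
    also have "\<dots> = 2 powr p * max \<bar>a i\<bar> \<bar>b i\<bar> powr p" by (simp add: powr_mult)
    also have "\<dots> \<le> 2 powr p * (\<bar>a i\<bar> powr p + \<bar>b i\<bar> powr p)"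
      by (intro mult_left_mono) (auto simp: max_def)
    finally show ?thesis .
  qed
  then have le: "norm (\<bar>a i + b i\<bar> powr p) \<le> 2 powr p * (\<bar>a i\<bar> powr p + \<bar>b i\<bar> powr p)" for i by simp
  have "summable (\<lambda>i. \<bar>a i\<bar> powr p + \<bar>b i\<bar> powr p)"
    using assms(2,3) summable_add[of "\<lambda>i. \<bar>a i\<bar> powr p" "\<lambda>i. \<bar>b i\<bar> powr p"] by (simp add: lp_def)
  then have "summable (\<lambda>i. 2 powr p * (\<bar>a i\<bar> powr p + \<bar>b i\<bar> powr p))"
    using summable_mult[of "\<lambda>i. \<bar>a i\<bar> powr p + \<bar>b i\<bar> powr p" "2 powr p"] by blast
  then have "summable (\<lambda>i. \<bar>a i + b i\<bar> powr p)"
    by (rule summable_comparison_test') (rule le)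
  then show ?thesis by (simp add: lp_def)
qed

lemma lp_diff: "p > 0 \<Longrightarrow> a \<in> lp p \<Longrightarrow> b \<in> lp p \<Longrightarrow> (\<lambda>i. a i - b i) \<in> lp p"
  using lp_add[of p a "\<lambda>i. -1 * b i"] lp_scale[of b p "-1"] by simp

lemma lp_norm_tendsto:
  assumes "p > 0" "a \<in> lp p"
  shows "(\<lambda>n. (\<Sum>i<n. \<bar>a i\<bar> powr p) powr (1 / p)) \<longlonglongrightarrow> lp_norm p a"
  unfolding lp_norm_def
  using assms
  by (intro tendsto_powr' summable_LIMSEQ tendsto_const) (auto simp: lp_def sum_nonneg)

text \<open>The two estimates pass from finite sums to series, so \<open>U\<close> is bounded above
  and below on l_p. The bound from below gives injectivity, continuity of the inverse and, with the
  completeness of l_p, a closed image; that completeness is proved along the way.\<close>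

lemma equivalent_lp_basis_isomorphic:
  fixes z :: "nat \<Rightarrow> 'b::banach"
  assumes p: "p > 0" and c: "c > 0"
    and lower: "\<And>a n. c * (\<Sum>i<n. \<bar>a i\<bar> powr p) powr (1 / p) \<le> norm (\<Sum>i<n. a i *\<^sub>R z i)"
    and upper: "\<And>a n. norm (\<Sum>i<n. a i *\<^sub>R z i) \<le> C * (\<Sum>i<n. \<bar>a i\<bar> powr p) powr (1 / p)"
  shows "\<exists>Z. Z \<subseteq> closure (span (range z)) \<and> subspace Z \<and> closed Z \<and>
    isomorphic_to (lp p) (lp_norm p) Z"
proof -
  define U where "U a = (\<Sum>i. a i *\<^sub>R z i)" for a
  have "c * 1 \<le> C * 1"
    using order_trans[OF lower[of "\<lambda>_. 1" 1] upper[of "\<lambda>_. 1" 1]] by simp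
  then have C: "C > 0" using c by simp
  have summ: "summable (\<lambda>i. a i *\<^sub>R z i)" if a: "a \<in> lp p" for a
    unfolding summable_Cauchy
  proof (intro allI impI)
    fix e :: real assume e: "e > 0"
    have "summable (\<lambda>i. \<bar>a i\<bar> powr p)" using a by (simp add: lp_def)
    moreover have "(e / C) powr p > 0" using e C by simp
    ultimately obtain N where N: "\<And>m n. m \<ge> N \<Longrightarrow> norm (\<Sum>i\<in>{m..<n}. \<bar>a i\<bar> powr p) < (e / C) powr p"
      unfolding summable_Cauchy by blast
    have "norm (\<Sum>i\<in>{m..<n}. a i *\<^sub>R z i) < e" if m: "m \<ge> N" for m n
    proof (cases "m \<le> n")
      case True
      \<comment> \<open>Deleting the first \<open>m\<close> coefficients lets \<open>upper\<close>,
        which speaks of sums starting at 0, bound a section of the series.\<close>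
      define b where "b i = (if i < m then 0 else a i)" for i
      have part: "{..<n} = {..<m} \<union> {m..<n}" using True by auto
      have "(\<Sum>i\<in>{m..<n}. a i *\<^sub>R z i) = (\<Sum>i<n. b i *\<^sub>R z i)"
        unfolding part by (subst sum.union_disjoint) (auto simp: b_def)
      moreover have "(\<Sum>i<n. \<bar>b i\<bar> powr p) = (\<Sum>i\<in>{m..<n}. \<bar>a i\<bar> powr p)"
        unfolding part by (subst sum.union_disjoint) (auto simp: b_def)
      ultimately have "norm (\<Sum>i\<in>{m..<n}. a i *\<^sub>R z i) \<le> C * (\<Sum>i\<in>{m..<n}. \<bar>a i\<bar> powr p) powr (1 / p)"
        using upper[of b n] by simp
      also have "\<dots> < C * ((e / C) powr p) powr (1 / p)"
        using N[OF m, of n] C p by (intro mult_strict_left_mono powr_less_mono2) (auto simp: sum_nonneg)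
      also have "\<dots> = e" using e C p by (simp add: powr_powr)
      finally show ?thesis .
    qed (use e in auto)
    then show "\<exists>N. \<forall>m\<ge>N. \<forall>n. norm (\<Sum>i\<in>{m..<n}. a i *\<^sub>R z i) < e" by blast
  qed
  have lim: "(\<lambda>n. \<Sum>i<n. a i *\<^sub>R z i) \<longlonglongrightarrow> U a" if "a \<in> lp p" for a
    unfolding U_def by (rule summable_LIMSEQ[OF summ[OF that]])
  have U_lower: "c * lp_norm p a \<le> norm (U a)" if a: "a \<in> lp p" for a
    by (rule LIMSEQ_le[OF tendsto_mult_left[OF lp_norm_tendsto[OF p a]] tendsto_norm[OF lim[OF a]]])
       (use lower in blast)
  have U_upper: "norm (U a) \<le> C * lp_norm p a" if a: "a \<in> lp p" for a
    by (rule LIMSEQ_le[OF tendsto_norm[OF lim[OF a]] tendsto_mult_left[OF lp_norm_tendsto[OF p a]]])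
       (use upper in blast)
  have U_add: "U (\<lambda>i. a i + b i) = U a + U b" if "a \<in> lp p" "b \<in> lp p" for a b
    unfolding U_def using suminf_add[OF summ[OF that(1)] summ[OF that(2)]]
    by (simp add: scaleR_left_distrib)
  have U_scale: "U (\<lambda>i. t * a i) = t *\<^sub>R U a" if "a \<in> lp p" for t a
    unfolding U_def using suminf_scaleR_right[OF summ[OF that], of t] by simp
  have U_diff: "U (\<lambda>i. a i - b i) = U a - U b" if "a \<in> lp p" "b \<in> lp p" for a b
    using U_add[OF that(1) lp_scale[OF that(2), of "-1"]] U_scale[OF that(2), of "-1"] by simp
  have partial_le: "(\<Sum>i<n. \<bar>a i\<bar> powr p) powr (1 / p) \<le> lp_norm p a" if "a \<in> lp p" for a n
    unfolding lp_norm_def using that p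
    by (intro powr_mono2 sum_le_suminf) (auto simp: lp_def sum_nonneg)
  have coord_le: "c * \<bar>a i\<bar> \<le> norm (U a)" if a: "a \<in> lp p" for a i
  proof -
    have "(\<bar>a i\<bar> powr p) powr (1 / p) \<le> (\<Sum>j<Suc i. \<bar>a j\<bar> powr p) powr (1 / p)"
      using p by (intro powr_mono2) (auto simp: sum_nonneg)
    then have "\<bar>a i\<bar> \<le> lp_norm p a" using partial_le[OF a, of "Suc i"] p by (simp add: powr_powr)
    then have "c * \<bar>a i\<bar> \<le> c * lp_norm p a" using c by simp
    then show ?thesis using U_lower[OF a] by linarith
  qed
  have U_inj: "inj_on U (lp p)"
  proof (rule inj_onI)
    fix a b assume ab: "a \<in> lp p" "b \<in> lp p" "U a = U b"
    have "c * \<bar>a i - b i\<bar> \<le> 0" for i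
      using coord_le[OF lp_diff[OF p ab(1,2)], of i] U_diff[OF ab(1,2)] ab(3) by simp
    then show "a = b" using c by (auto simp: fun_eq_iff mult_le_0_iff)
  qed
  let ?Z = "U ` lp p"
  have "?Z \<subseteq> closure (span (range z))"
  proof clarify
    fix a assume a: "a \<in> lp p"
    have "(\<Sum>i<n. a i *\<^sub>R z i) \<in> span (range z)" for n
      by (intro span_sum span_scale span_base) auto
    then show "U a \<in> closure (span (range z))"
      unfolding closure_sequential using lim[OF a]
      by (intro exI[of _ "\<lambda>n. \<Sum>i<n. a i *\<^sub>R z i"]) simp
  qed
  moreover have "subspace ?Z"
  proof (rule subspaceI)
    have "(\<lambda>i. 0) \<in> lp p" by (simp add: lp_def)
    moreover have "U (\<lambda>i. 0) = 0" by (simp add: U_def)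
    ultimately show "0 \<in> ?Z" by force
  next
    fix x y assume "x \<in> ?Z" "y \<in> ?Z"
    then obtain a b where ab: "a \<in> lp p" "b \<in> lp p" and xy: "x = U a" "y = U b" by blast
    show "x + y \<in> ?Z" unfolding xy U_add[OF ab, symmetric] by (rule imageI[OF lp_add[OF p ab]])
  next
    fix t x assume "x \<in> ?Z"
    then obtain a where a: "a \<in> lp p" and x: "x = U a" by blast
    show "t *\<^sub>R x \<in> ?Z" unfolding x U_scale[OF a, symmetric] by (rule imageI[OF lp_scale[OF a]])
  qed
  moreover have "closed ?Z"
    unfolding closed_sequential_limits
  proof (intro allI impI)
    fix X x assume "(\<forall>n. X n \<in> ?Z) \<and> X \<longlonglongrightarrow> x"
    then have X: "\<And>n. X n \<in> ?Z" "X \<longlonglongrightarrow> x" by auto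
    have "\<forall>n. \<exists>a. a \<in> lp p \<and> X n = U a" using X(1) by blast
    then obtain A where A: "\<And>n. A n \<in> lp p" "\<And>n. X n = U (A n)" by metis
    have cau: "Cauchy X" using X(2) by (rule LIMSEQ_imp_Cauchy)
    have "Cauchy (\<lambda>n. A n i)" for i
    proof (rule metric_CauchyI)
      fix e :: real assume "e > 0"
      then obtain M where M: "\<And>m n. m \<ge> M \<Longrightarrow> n \<ge> M \<Longrightarrow> dist (X m) (X n) < c * e"
        using cau c metric_CauchyD[OF cau, of "c * e"] by auto
      have "dist (A m i) (A n i) < e" if "m \<ge> M" "n \<ge> M" for m n
      proof -
        have "c * \<bar>A m i - A n i\<bar> \<le> norm (X m - X n)"
          using coord_le[OF lp_diff[OF p A(1)[of m] A(1)[of n]], of i] U_diff[OF A(1)[of m] A(1)[of n]] A(2)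
          by simp
        also have "\<dots> < c * e" using M[OF that] by (simp add: dist_norm)
        finally show ?thesis using c by (simp add: dist_real_def)
      qed
      then show "\<exists>M. \<forall>m\<ge>M. \<forall>n\<ge>M. dist (A m i) (A n i) < e" by blast
    qed
    then have "\<forall>i. \<exists>l. (\<lambda>n. A n i) \<longlonglongrightarrow> l" using convergent_eq_Cauchy by blast
    then obtain b where b: "\<And>i. (\<lambda>n. A n i) \<longlonglongrightarrow> b i" by metis
    have near: "\<exists>M. \<forall>n\<ge>M. (\<lambda>i. A n i - b i) \<in> lp p \<and> lp_norm p (\<lambda>i. A n i - b i) \<le> e" if e: "e > 0" for e
    proof -
      obtain M where M: "\<And>m n. m \<ge> M \<Longrightarrow> n \<ge> M \<Longrightarrow> dist (X m) (X n) < c * e"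
        using e c metric_CauchyD[OF cau, of "c * e"] by auto
      have "(\<lambda>i. A n i - b i) \<in> lp p \<and> lp_norm p (\<lambda>i. A n i - b i) \<le> e" if n: "n \<ge> M" for n
      proof -
        \<comment> \<open>With only \<open>r\<close> coordinates the limit in \<open>m\<close> can
          be taken coordinatewise; the bound does not depend on \<open>r\<close>, so it survives in
          the full series.\<close>
        have le: "(\<Sum>i<r. \<bar>A n i - b i\<bar> powr p) \<le> e powr p" for r
        proof (rule LIMSEQ_le_const2)
          show "(\<lambda>m. \<Sum>i<r. \<bar>A n i - A m i\<bar> powr p) \<longlonglongrightarrow> (\<Sum>i<r. \<bar>A n i - b i\<bar> powr p)"
            using p by (intro tendsto_sum tendsto_powr' tendsto_rabs tendsto_diff b tendsto_const) auto
          have "(\<Sum>i<r. \<bar>A n i - A m i\<bar> powr p) \<le> e powr p" if m: "m \<ge> M" for m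
          proof -
            have D: "(\<lambda>i. A n i - A m i) \<in> lp p" by (rule lp_diff[OF p A(1) A(1)])
            have "c * lp_norm p (\<lambda>i. A n i - A m i) \<le> norm (X n - X m)"
              using U_lower[OF D] U_diff[OF A(1) A(1)] A(2) by metis
            also have "\<dots> < c * e" using M[OF n m] by (simp add: dist_norm)
            finally have "(\<Sum>i<r. \<bar>A n i - A m i\<bar> powr p) powr (1 / p) \<le> e"
              using partial_le[OF D, of r] c by simp
            then have "((\<Sum>i<r. \<bar>A n i - A m i\<bar> powr p) powr (1 / p)) powr p \<le> e powr p"
              using p by (intro powr_mono2) auto
            then show ?thesis using p by (simp add: powr_powr sum_nonneg)
          qed
          then show "\<exists>N. \<forall>m\<ge>N. (\<Sum>i<r. \<bar>A n i - A m i\<bar> powr p) \<le> e powr p" by blast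
        qed
        have s: "summable (\<lambda>i. \<bar>A n i - b i\<bar> powr p)"
          by (rule summableI_nonneg_bounded[OF _ le]) auto
        have "lp_norm p (\<lambda>i. A n i - b i) \<le> (e powr p) powr (1 / p)"
          unfolding lp_norm_def using p s le
          by (intro powr_mono2 suminf_le_const suminf_nonneg) auto
        then show ?thesis using s e p by (simp add: lp_def powr_powr)
      qed
      then show ?thesis by blast
    qed
    obtain M where "(\<lambda>i. A M i - b i) \<in> lp p" using near[of 1] by auto
    then have bl: "b \<in> lp p" using lp_diff[OF p A(1)[of M], of "\<lambda>i. A M i - b i"] by simp
    have "X \<longlonglongrightarrow> U b"
    proof (rule LIMSEQ_I)
      fix e :: real assume e: "e > 0"
      obtain M where M: "\<And>n. n \<ge> M \<Longrightarrow> lp_norm p (\<lambda>i. A n i - b i) \<le> e / (2 * C)"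
        using near[of "e / (2 * C)"] e C by auto
      have "norm (X n - U b) < e" if "n \<ge> M" for n
      proof -
        have "norm (X n - U b) \<le> C * lp_norm p (\<lambda>i. A n i - b i)"
          using U_upper[OF lp_diff[OF p A(1)[of n] bl]] U_diff[OF A(1)[of n] bl] A(2)[of n] by simp
        also have "\<dots> \<le> C * (e / (2 * C))" using M[OF that] C by (intro mult_left_mono) auto
        also have "\<dots> < e" using e C by simp
        finally show ?thesis .
      qed
      then show "\<exists>N. \<forall>n\<ge>N. norm (X n - U b) < e" by blast
    qed
    then have "x = U b" using X(2) LIMSEQ_unique by blast
    then show "x \<in> ?Z" using bl by blast
  qed
  moreover have "isomorphic_to (lp p) (lp_norm p) ?Z"
    unfolding isomorphic_to_def
  proof (intro exI[of _ U] conjI ballI allI impI)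
    show "linear_map_on (lp p) U" using U_add U_scale by (auto simp: linear_map_on_def)
    show "bij_betw U (lp p) ?Z" using U_inj by (rule inj_on_imp_bij_betw)
  next
    fix a and e :: real assume a: "a \<in> lp p" and e: "e > 0"
    have "norm (U b - U a) < e" if b: "b \<in> lp p" "lp_norm p (\<lambda>n. b n - a n) < e / C" for b
    proof -
      have "norm (U b - U a) \<le> C * lp_norm p (\<lambda>n. b n - a n)"
        using U_upper[OF lp_diff[OF p b(1) a]] U_diff[OF b(1) a] by simp
      also have "\<dots> < C * (e / C)" using b(2) C by (intro mult_strict_left_mono)
      finally show ?thesis using C by simp
    qed
    then show "\<exists>\<delta>>0. \<forall>b\<in>lp p. lp_norm p (\<lambda>n. b n - a n) < \<delta> \<longrightarrow> norm (U b - U a) < e"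
      using e C by (intro exI[of _ "e / C"]) auto
  next
    fix a and e :: real assume a: "a \<in> lp p" and e: "e > 0"
    have "lp_norm p (\<lambda>n. b n - a n) < e" if b: "b \<in> lp p" "norm (U b - U a) < c * e" for b
    proof -
      have "c * lp_norm p (\<lambda>n. b n - a n) < c * e"
        using U_lower[OF lp_diff[OF p b(1) a]] U_diff[OF b(1) a] b(2) by simp
      then show ?thesis using c by simp
    qed
    then show "\<exists>\<delta>>0. \<forall>b\<in>lp p. norm (U b - U a) < \<delta> \<longrightarrow> lp_norm p (\<lambda>n. b n - a n) < e"
      using e c by (intro exI[of _ "c * e"]) auto
  qed
  ultimately show ?thesis by blast
qed

section \<open>Estimates for abstract splitting processes\<close>

text \<open>Hoelder's inequality for at most \<open>d\<close> terms, with equality for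
  \<open>d\<close> equal ones. The factor is the value of \<theta> in the theorem.\<close>

lemma powr_sum_le:
  fixes T :: "'i \<Rightarrow> real"
  assumes fin: "finite L" and card: "card L \<le> d" and p: "p \<ge> 1" and T: "\<And>l. l \<in> L \<Longrightarrow> T l \<ge> 0"
  shows "real d powr (1 / p - 1) * (\<Sum>l\<in>L. T l powr (1 / p)) \<le> (\<Sum>l\<in>L. T l) powr (1 / p)"
proof (cases "(\<Sum>l\<in>L. T l) = 0")
  case True
  then have "\<forall>l\<in>L. T l = 0" using sum_nonneg_eq_0_iff[OF fin, of T] T by simp
  then show ?thesis by simp
next
  case False
  define W where "W = (\<Sum>l\<in>L. T l)"
  have W: "W > 0" using False sum_nonneg[OF T] by (simp add: W_def less_le)
  have d: "d > 0" using False card fin by (cases "L = {}") (auto simp: card_gt_0_iff intro: less_le_trans)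
  \<comment> \<open>\<open>?K\<close> is the value of x^(1/p) at the mean \<open>W / d\<close>. The
    bound \<open>each\<close> is the tangent line at this point, which Young's inequality places
    above the concave function.\<close>
  let ?K = "W powr (1 / p) * real d powr (- (1 / p))"
  have each: "T l powr (1 / p) \<le> ?K * ((d / (p * W)) * T l + (1 - 1 / p))" if l: "l \<in> L" for l
  proof (cases "T l = 0")
    case True
    then show ?thesis using p W d by simp
  next
    case False
    then have t: "T l > 0" using T[OF l] by simp
    have "(d * T l / W) powr (1 / p) * 1 powr (1 - 1 / p) \<le> (1 / p) * (d * T l / W) + (1 - 1 / p) * 1"
      using p t W d by (intro Youngs_inequality_0) auto
    then have "(d * T l / W) powr (1 / p) \<le> (d / (p * W)) * T l + (1 - 1 / p)" by simp
    then have "?K * (d * T l / W) powr (1 / p) \<le> ?K * ((d / (p * W)) * T l + (1 - 1 / p))"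
      by (rule mult_left_mono) simp
    moreover have "?K * (d * T l / W) powr (1 / p) = T l powr (1 / p)"
      using t W d by (simp add: powr_divide powr_mult powr_minus field_simps)
    ultimately show ?thesis by simp
  qed
  have "(\<Sum>l\<in>L. T l powr (1 / p)) \<le> (\<Sum>l\<in>L. ?K * ((d / (p * W)) * T l + (1 - 1 / p)))"
    by (rule sum_mono[OF each])
  also have "\<dots> = ?K * ((d / (p * W)) * W + card L * (1 - 1 / p))"
    unfolding W_def by (simp only: sum_distrib_left[symmetric] sum.distrib sum_constant)
  also have "\<dots> \<le> ?K * (d / p + d * (1 - 1 / p))"
    using W card p by (intro mult_left_mono add_mono mult_right_mono) (auto simp: field_simps)
  also have "\<dots> = ?K * d" using p by (simp add: field_simps)
  finally have "real d powr (1 / p - 1) * (\<Sum>l\<in>L. T l powr (1 / p)) \<le> real d powr (1 / p - 1) * (?K * d)"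
    by (rule mult_left_mono) simp
  also have "\<dots> = W powr (1 / p)" using d by (simp add: powr_diff powr_minus field_simps)
  finally show ?thesis by (simp add: W_def)
qed

text \<open>Index \<open>i\<close> is placed at the midpoint \<open>c i\<close> of an interval of length \<open>w i\<close>. If an interval of length
  \<open>l\<close> contains two of these points, their weights are less than \<open>2 * l\<close>; this keeps the weights
  comparable to the length of the interval until only one point is left.\<close>

lemma interval_splitting_lower_bound:
  fixes F :: "nat set \<Rightarrow> real" and w c :: "nat \<Rightarrow> real"
  assumes p: "p > 1" and d: "d \<ge> 2" and S: "finite S"
    and w: "\<And>i. i \<in> S \<Longrightarrow> w i > 0"
    and c: "\<And>i j. i \<in> S \<Longrightarrow> j \<in> S \<Longrightarrow> i < j \<Longrightarrow> c i + w i / 2 + w j / 2 \<le> c j"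
    and single: "\<And>i. i \<in> S \<Longrightarrow> w i powr (1 / p) \<le> F {i}" and empty: "F {} \<ge> 0"
    and split: "\<And>A g. A \<subseteq> S \<Longrightarrow> (\<And>i. i \<in> A \<Longrightarrow> g i < d) \<Longrightarrow>
      (\<And>i j. i \<in> A \<Longrightarrow> j \<in> A \<Longrightarrow> i \<le> j \<Longrightarrow> g i \<le> g j) \<Longrightarrow>
      real d powr (1 / p - 1) * (\<Sum>l<d. F {i\<in>A. g i = l}) \<le> F A"
    and l: "l > 0" and A: "A = {i\<in>S. \<alpha> \<le> c i \<and> c i < \<alpha> + l}"
    and large: "\<And>i. i \<in> A \<Longrightarrow> w i \<le> 2 * real d * l"
    and small: "\<And>i. i \<in> A \<Longrightarrow> 2 * l \<le> real d ^ n * w i"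
  shows "(2 * real d) powr (1 / p - 1) * l powr (1 / p - 1) * (\<Sum>i\<in>A. w i) \<le> F A"
proof -
  \<comment> \<open>The exponent 1/p - 1 is negative, so the upper bound \<open>2 * d * l\<close> on
    the last remaining weight turns into a lower bound. The constant arises here alone.\<close>
  have base: "(2 * real d) powr (1 / p - 1) * l powr (1 / p - 1) * (\<Sum>i\<in>A. w i) \<le> F A"
    if l: "l > 0" and A: "A = {i\<in>S. \<alpha> \<le> c i \<and> c i < \<alpha> + l}"
      and large: "\<And>i. i \<in> A \<Longrightarrow> w i \<le> 2 * real d * l" and one: "A = {} \<or> (\<exists>i. A = {i})"
    for \<alpha> l :: real and A
  proof (cases "A = {}")
    case True
    then show ?thesis using empty by simp
  next
    case False
    then obtain i where i: "A = {i}" using one by blast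
    then have iS: "i \<in> S" using A by blast
    have "(2 * real d * l) powr (1 / p - 1) \<le> w i powr (1 / p - 1)"
      using p large[of i] w[OF iS] i by (intro powr_mono2') auto
    then have "(2 * real d * l) powr (1 / p - 1) * w i \<le> w i powr (1 / p - 1) * w i"
      using w[OF iS] by (intro mult_right_mono) auto
    also have "\<dots> = w i powr (1 / p)" using w[OF iS] by (simp add: powr_diff)
    also have "\<dots> \<le> F {i}" by (rule single[OF iS])
    finally show ?thesis using i l d by (simp add: powr_mult)
  qed
  \<comment> \<open>\<open>n\<close> counts the levels still available: after \<open>n\<close>
    divisions by \<open>d\<close> the length is at most half of every weight.\<close>
  show ?thesis
    using l A large small
  proof (induction n arbitrary: \<alpha> l A)
    case (0 \<alpha> l A)
    have "A = {} \<or> (\<exists>i. A = {i})"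
    proof (rule ccontr)
      assume "\<not> ?thesis"
      then obtain i j where ij: "i \<in> A" "j \<in> A" "i < j" by (metis is_singletonI' is_singletonE linorder_neqE_nat)
      \<comment> \<open>Now both weights are at least \<open>2 * l\<close>, so two points would be
        too far apart for an interval of length \<open>l\<close>.\<close>
      then have "c i + w i / 2 + w j / 2 \<le> c j" "w i > 0" "w j > 0" using c w 0 by auto
      then show False using 0(2) 0(4)[of i] 0(4)[of j] ij by auto
    qed
    from 0(1-3) this show ?case by (rule base)
  next
    case (Suc n \<alpha> l A)
    show ?case
    proof (cases "A = {} \<or> (\<exists>i. A = {i})")
      case True
      from Suc.prems(1-3) this show ?thesis by (rule base)
    next
      case False
      have AS: "A \<subseteq> S" using Suc.prems(2) by blast
      have fin: "finite A" using AS S finite_subset by blast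
      have dl: "real d > 0" "l > 0" using d Suc.prems(1) by auto
      \<comment> \<open>This is precisely the hypothesis \<open>large\<close> for parts of length
        \<open>l / d\<close>, and it restores the invariant after each division.\<close>
      have wl: "w i \<le> 2 * l" if i: "i \<in> A" for i
      proof -
        obtain j where j: "j \<in> A" "j \<noteq> i" using False i by blast
        have "c i + w i / 2 + w j / 2 \<le> c j \<or> c j + w j / 2 + w i / 2 \<le> c i"
          using c[of i j] c[of j i] i j AS by (meson linorder_neqE_nat subsetD)
        then show ?thesis using w[of j] i j AS Suc.prems(2) by auto
      qed
      define g where "g i = nat \<lfloor>(c i - \<alpha>) * d / l\<rfloor>" for i
      have arg: "0 \<le> (c i - \<alpha>) * d / l" "(c i - \<alpha>) * d / l < d" if i: "i \<in> A" for i
      proof -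
        have i': "0 \<le> c i - \<alpha>" "c i - \<alpha> < l" using i Suc.prems(2) by auto
        show "0 \<le> (c i - \<alpha>) * d / l" using i'(1) dl by simp
        have "(c i - \<alpha>) * d < l * d" using i'(2) dl by (intro mult_strict_right_mono)
        then show "(c i - \<alpha>) * d / l < d" using dl by (simp add: pos_divide_less_eq mult.commute)
      qed
      have gl: "g i = m \<longleftrightarrow> \<alpha> + m * l / d \<le> c i \<and> c i < \<alpha> + m * l / d + l / d" if i: "i \<in> A" for i m
      proof -
        have "g i = m \<longleftrightarrow> \<lfloor>(c i - \<alpha>) * d / l\<rfloor> = int m" using arg(1)[OF i] unfolding g_def by linarith
        also have "\<dots> \<longleftrightarrow> m \<le> (c i - \<alpha>) * d / l \<and> (c i - \<alpha>) * d / l < m + 1"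
          by (simp add: floor_eq_iff add.commute)
        also have "\<dots> \<longleftrightarrow> \<alpha> + m * l / d \<le> c i \<and> c i < \<alpha> + m * l / d + l / d"
          using dl by (simp add: field_simps)
        finally show ?thesis .
      qed
      have gd: "g i < d" if i: "i \<in> A" for i
        using arg[OF i] unfolding g_def by linarith
      have cm: "c i \<le> c j" if "i \<in> A" "j \<in> A" "i \<le> j" for i j
        using c[of i j] w[of i] w[of j] that AS by (cases "i = j") fastforce+
      have gm: "g i \<le> g j" if "i \<in> A" "j \<in> A" "i \<le> j" for i j
        unfolding g_def using cm[OF that] dl
        by (intro nat_mono floor_mono divide_right_mono mult_right_mono) auto
      let ?K = "(2 * real d) powr (1 / p - 1) * (l / d) powr (1 / p - 1)"
      have IH: "?K * (\<Sum>i\<in>{i\<in>A. g i = m}. w i) \<le> F {i\<in>A. g i = m}" if m: "m < d" for m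
      proof (rule Suc.IH)
        show "l / d > 0" using dl by simp
        have "real m * l / d + l / d = (real m + 1) * l / d" by (simp add: distrib_right add_divide_distrib)
        also have "\<dots> \<le> real d * l / d" using m dl by (intro divide_right_mono mult_right_mono) auto
        finally have "\<alpha> + real m * l / d + l / d \<le> \<alpha> + l" "\<alpha> \<le> \<alpha> + real m * l / d" using dl by auto
        then have "x \<in> A" if "x \<in> S" "\<alpha> + m * l / d \<le> c x" "c x < \<alpha> + m * l / d + l / d" for x
          using that unfolding Suc.prems(2) by auto
        then show "{i\<in>A. g i = m} = {i\<in>S. \<alpha> + m * l / d \<le> c i \<and> c i < \<alpha> + m * l / d + l / d}"
          using gl AS by blast
        show "w i \<le> 2 * real d * (l / d)" if "i \<in> {i\<in>A. g i = m}" for i using wl that dl by simp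
        show "2 * (l / d) \<le> real d ^ n * w i" if "i \<in> {i\<in>A. g i = m}" for i
          using Suc.prems(4)[of i] that dl by (simp add: field_simps)
      qed
      have "(\<Sum>i\<in>A. w i) = (\<Sum>m\<in>{..<d}. \<Sum>i\<in>{i\<in>A. g i = m}. w i)"
        by (rule sum.group[symmetric, OF fin]) (use gd in auto)
      then have "?K * (\<Sum>i\<in>A. w i) \<le> (\<Sum>m<d. F {i\<in>A. g i = m})"
        using sum_mono[of "{..<d}", OF IH] by (simp add: sum_distrib_left)
      then have "real d powr (1 / p - 1) * (?K * (\<Sum>i\<in>A. w i)) \<le>
          real d powr (1 / p - 1) * (\<Sum>m<d. F {i\<in>A. g i = m})"
        by (rule mult_left_mono) simp
      also have "\<dots> \<le> F A" by (rule split[OF AS gd gm])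
      finally have "real d powr (1 / p - 1) * (?K * (\<Sum>i\<in>A. w i)) \<le> F A" .
      \<comment> \<open>The splitting factor cancels the change from \<open>l / d\<close> to
        \<open>l\<close>, so the constant does not depend on the depth.\<close>
      moreover have "real d powr (1 / p - 1) * (?K * (\<Sum>i\<in>A. w i)) =
          (2 * real d) powr (1 / p - 1) * l powr (1 / p - 1) * (\<Sum>i\<in>A. w i)"
        using dl by (simp add: powr_divide)
      ultimately show ?thesis by simp
    qed
  qed
qed

text \<open>Intervals of lengths |a_i|^p are laid end to end and fill [0, W), where W is the p-th
  power of the l_p norm. Representing each interval by its midpoint means that no index is ever
  divided between two parts.\<close>

lemma lower_bound_of_splitting:
  fixes F :: "nat set \<Rightarrow> real" and a :: "nat \<Rightarrow> real"
  assumes p: "p > 1" and d: "d \<ge> 2" and S: "finite S"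
    and single: "\<And>i. i \<in> S \<Longrightarrow> \<bar>a i\<bar> \<le> F {i}" and empty: "F {} \<ge> 0"
    and split: "\<And>A g. A \<subseteq> S \<Longrightarrow> (\<And>i. i \<in> A \<Longrightarrow> g i < d) \<Longrightarrow>
      (\<And>i j. i \<in> A \<Longrightarrow> j \<in> A \<Longrightarrow> i \<le> j \<Longrightarrow> g i \<le> g j) \<Longrightarrow>
      real d powr (1 / p - 1) * (\<Sum>l<d. F {i\<in>A. g i = l}) \<le> F A"
    and nz: "\<And>i. i \<in> S \<Longrightarrow> a i \<noteq> 0"
  shows "(2 * real d) powr (1 / p - 1) * (\<Sum>i\<in>S. \<bar>a i\<bar> powr p) powr (1 / p) \<le> F S"
proof (cases "S = {}")
  case True
  then show ?thesis using empty by simp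
next
  case False
  define w where "w i = \<bar>a i\<bar> powr p" for i
  define W where "W = (\<Sum>i\<in>S. w i)"
  define c where "c i = (\<Sum>j\<in>{j\<in>S. j < i}. w j) + w i / 2" for i
  have w: "w i > 0" if "i \<in> S" for i using nz[OF that] by (simp add: w_def)
  have W: "W > 0" unfolding W_def using w S False by (intro sum_pos) auto
  have ins: "(\<Sum>j\<in>{j\<in>S. j < i}. w j) + w i = (\<Sum>j\<in>insert i {j\<in>S. j < i}. w j)" for i
    using S by simp
  have le: "(\<Sum>j\<in>{j\<in>S. j < i}. w j) + w i \<le> (\<Sum>j\<in>B. w j)"
    if "insert i {j\<in>S. j < i} \<subseteq> B" "B \<subseteq> S" for i B
    unfolding ins using that S by (intro sum_mono2) (auto simp: w_def intro: finite_subset)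
  have c1: "c i + w i / 2 + w j / 2 \<le> c j" if ij: "i \<in> S" "j \<in> S" "i < j" for i j
  proof -
    have "insert i {j\<in>S. j < i} \<subseteq> {x\<in>S. x < j}" using ij by auto
    then show ?thesis using le[of i "{x\<in>S. x < j}"] by (simp add: c_def)
  qed
  have c2: "0 \<le> c i \<and> c i < 0 + W" if i: "i \<in> S" for i
  proof -
    have "0 \<le> (\<Sum>j\<in>{j\<in>S. j < i}. w j)" by (rule sum_nonneg) (simp add: w_def)
    then show ?thesis using le[of i S] i w[OF i] by (auto simp: c_def W_def)
  qed
  have "Min (w ` S) > 0" using w S False by simp
  \<comment> \<open>A depth at which \<open>W / d ^ n\<close> is below half of the smallest weight;
    it exists because all weights are positive.\<close>
  obtain n where n: "2 * W / Min (w ` S) < real d ^ n"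
    using real_arch_pow[of "real d" "2 * W / Min (w ` S)"] d by auto
  have "(2 * real d) powr (1 / p - 1) * W powr (1 / p - 1) * (\<Sum>i\<in>S. w i) \<le> F S"
  proof (rule interval_splitting_lower_bound[OF p d S w c1 _ empty split W])
    show "w i powr (1 / p) \<le> F {i}" if "i \<in> S" for i
      using single[OF that] p by (simp add: w_def powr_powr)
    show "S = {i\<in>S. 0 \<le> c i \<and> c i < 0 + W}" using c2 by blast
    fix i assume i: "i \<in> S"
    have "w i \<le> W" unfolding W_def using i S by (intro member_le_sum) (auto simp: w_def)
    also have "\<dots> \<le> 2 * real d * W" using W d by simp
    finally show "w i \<le> 2 * real d * W" by simp
    have "2 * W \<le> real d ^ n * Min (w ` S)" using n \<open>Min (w ` S) > 0\<close> by (simp add: field_simps)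
    also have "\<dots> \<le> real d ^ n * w i" using S i by (intro mult_left_mono) auto
    finally show "2 * W \<le> real d ^ n * w i" .
  qed
  moreover have "W powr (1 / p - 1) * W = W powr (1 / p)" using W by (simp add: powr_diff)
  ultimately show ?thesis by (simp add: W_def w_def mult.assoc)
qed

section \<open>Initial segments and the order \<prec>\<close>

lemma strict_prefix_prec:
  assumes "strict_prefix s t" "sorted t" shows "s \<prec>\<^sub>s t"
proof (cases "s = []")
  case True
  then show ?thesis using assms(1) by (auto simp: prec_def)
next
  case False
  obtain a r where t: "t = s @ a # r" using assms(1) by (auto elim: strict_prefixE')
  have "last s \<le> last t" using assms(2) False unfolding t by (auto simp: sorted_append)
  moreover have "(s, t) \<in> lexord {(a, b). a < b}" unfolding t by (rule lexord_append_rightI) simp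
  ultimately show ?thesis using False t by (auto simp: prec_def)
qed

lemma last_less_prec: "last s < last t \<Longrightarrow> s \<noteq> [] \<Longrightarrow> t \<noteq> [] \<Longrightarrow> s \<prec>\<^sub>s t"
  by (simp add: prec_def)

lemma ndseqs_le_take: "u \<in> ndseqs_le k \<Longrightarrow> take n u \<in> ndseqs_le k"
  by (auto simp: ndseqs_le_def intro: sorted_wrt_take)

section \<open>Initial segments of members of \<open>\<E>\<^sub>k\<close>\<close>

text \<open>The order \<prec> compares last entries before anything else, so a bound on the last
  entry cuts off an initial segment of \<open>X\<close>. It is finite and therefore equals
  \<open>restr n X\<close> with \<open>n\<close> its cardinality.\<close>

lemma AR_initial_segment:
  assumes k: "k \<ge> 1" and X: "X \<in> ek_space k" and ne: "{x \<in> X. last x \<le> M} \<noteq> {}"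
  shows "{x \<in> X. last x \<le> M} \<in> AR k"
proof -
  let ?E = "{x \<in> X. last x \<le> M}"
  have X': "X \<subseteq> ndseqs k" by (rule ek_space_subset[OF X])
  have nonempty: "x \<noteq> []" if "x \<in> X" for x using that X' k by (auto simp: ndseqs_def)
  have fin: "finite {y \<in> X. y \<prec>\<^sub>s x}" for x
    using X' ndseqs_subset by (intro finite_preds'[of X k]) blast
  have finE: "finite ?E"
  proof (rule finite_subset)
    show "?E \<subseteq> {y \<in> X. y \<prec>\<^sub>s [Suc M]}"
      using nonempty by (auto intro!: last_less_prec)
  qed (rule fin)
  have "restr (card ?E) X = ?E"
  proof (intro set_eqI iffI)
    fix x assume x: "x \<in> restr (card ?E) X"
    show "x \<in> ?E"
    proof (rule ccontr)
      assume "x \<notin> ?E"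
      then have "?E \<subseteq> {y \<in> X. y \<prec>\<^sub>s x}"
        using x nonempty by (auto simp: restr_def intro!: last_less_prec)
      then have "card ?E \<le> card {y \<in> X. y \<prec>\<^sub>s x}" by (rule card_mono[OF fin])
      then show False using x by (simp add: restr_def)
    qed
  next
    fix x assume x: "x \<in> ?E"
    have "y \<in> ?E - {x}" if "y \<in> X" "y \<prec>\<^sub>s x" for y
      using that x prec_irrefl[of x] by (auto simp: prec_def nonempty)
    then have "{y \<in> X. y \<prec>\<^sub>s x} \<subset> ?E" using x by blast
    then show "x \<in> restr (card ?E) X" using psubset_card_mono[OF finE] x by (simp add: restr_def)
  qed
  moreover have "card ?E \<ge> 1" using finE ne by (simp add: Suc_le_eq card_gt_0_iff)
  ultimately show ?thesis using X unfolding AR_def AR_n_def by force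
qed

text \<open>Along the zero sequences this tree runs through the initial segments of \<open>s\<close>; the other entries are
  shifted by \<open>N\<close>.\<close>

definition stem_tree :: "nat list \<Rightarrow> nat \<Rightarrow> nat list \<Rightarrow> nat list" where
  "stem_tree s N u = map2 (\<lambda>j a. if j < length s \<and> a = 0 then s ! j else N + a) [0..<length u] u"

lemma length_stem_tree [simp]: "length (stem_tree s N u) = length u"
  by (simp add: stem_tree_def)

lemma nth_stem_tree: "j < length u \<Longrightarrow>
    stem_tree s N u ! j = (if j < length s \<and> u ! j = 0 then s ! j else N + u ! j)"
  by (simp add: stem_tree_def)

lemma last_stem_tree: "u \<noteq> [] \<Longrightarrow>
    last (stem_tree s N u) = (if length u \<le> length s \<and> last u = 0 then s ! (length u - 1) else N + last u)"
proof -
  assume u: "u \<noteq> []"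
  then have "stem_tree s N u \<noteq> []" by (metis length_stem_tree length_0_conv)
  then have "last (stem_tree s N u) = stem_tree s N u ! (length u - 1)" by (simp add: last_conv_nth)
  moreover have "length u - 1 < length u" using u by (simp add: Suc_le_eq)
  moreover have "length u - 1 < length s \<longleftrightarrow> length u \<le> length s" using calculation(2) by linarith
  ultimately show ?thesis using u by (simp add: nth_stem_tree last_conv_nth)
qed

lemma take_stem_tree: "take n (stem_tree s N u) = stem_tree s N (take n u)"
  by (rule nth_equalityI) (simp_all add: nth_stem_tree)

lemma strict_prefix_iff_take: "strict_prefix s t \<longleftrightarrow> length s < length t \<and> s = take (length s) t"
  by (metis append_eq_conv_conj prefix_def prefix_length_less strict_prefix_def take_all_iff linorder_not_le order_less_irrefl)

text \<open>In each coordinate the replacement is strictly increasing: zero goes to an entry of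
  \<open>s\<close>, which is at most \<open>N\<close>, and a positive \<open>a\<close> goes to
  \<open>N + a\<close>. This transfers the lexicographic comparison; last entries need a separate
  look.\<close>

lemma ek_tree_stem_tree:
  assumes s: "sorted s" "\<forall>e\<in>set s. e \<le> N"
  shows "ek_tree k (stem_tree s N)"
proof -
  have sj: "s ! j \<le> N" if "j < length s" for j using s(2) that by simp
  have prefix: "strict_prefix (stem_tree s N u) (stem_tree s N w)" if "strict_prefix u w" for u w
    using that by (auto simp: strict_prefix_iff_take take_stem_tree)
  have sorted: "sorted (stem_tree s N u)" if u: "sorted u" for u
    unfolding sorted_iff_nth_mono
  proof (intro allI impI)
    fix i j assume "i \<le> j" "j < length (stem_tree s N u)"
    then show "stem_tree s N u ! i \<le> stem_tree s N u ! j"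
      using sorted_nth_mono[OF u, of i j] sorted_nth_mono[OF s(1), of i j] sj[of i]
      by (auto simp: nth_stem_tree)
  qed
  have prec: "stem_tree s N u \<prec>\<^sub>s stem_tree s N w"
    if u: "u \<in> ndseqs_le k" and w: "w \<in> ndseqs_le k" and uw: "u \<prec>\<^sub>s w" for u w
  proof (cases "u = []")
    case True
    then show ?thesis using uw by (auto simp: prec_def stem_tree_def)
  next
    case False
    then have ne: "u \<noteq> []" "w \<noteq> []" using uw by (auto simp: prec_def)
    then have ne': "stem_tree s N u \<noteq> []" "stem_tree s N w \<noteq> []" by (metis length_stem_tree length_0_conv)+
    consider "last u < last w" | "last u = last w" "(u, w) \<in> lexord {(a, b). a < b}"
      using uw ne by (auto simp: prec_def)
    then show ?thesis
    proof cases
      case 1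
      have "s ! (length u - 1) \<le> N" if "length u \<le> length s" using that ne by (intro sj) (cases u, auto)
      then have "last (stem_tree s N u) < last (stem_tree s N w)"
        using ne 1 by (auto simp: last_stem_tree)
      then show ?thesis using ne' by (rule last_less_prec)
    next
      case 2
      from 2(2) consider (pre) "strict_prefix u w"
        | (diff) c a b v v' where "a < b" "u = c @ a # v" "w = c @ b # v'"
        by (auto simp: lexord_def strict_prefix_def)
      then show ?thesis
      proof cases
        case pre
        then show ?thesis using sorted w by (intro strict_prefix_prec prefix) (auto simp: ndseqs_le_def)
      next
        case diff
        \<comment> \<open>The larger entry at the first difference is positive, hence so is the
          common last entry of \<open>u\<close> and \<open>w\<close>. Neither last entry falls on
          the stem, and both are shifted by \<open>N\<close>.\<close>
        have "last w > 0" using w diff by (cases v' rule: rev_cases) (auto simp: ndseqs_le_def sorted_append)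
        then have last: "last (stem_tree s N u) = last (stem_tree s N w)"
          using 2(1) ne by (simp add: last_stem_tree)
        let ?n = "length c"
        have "take ?n (stem_tree s N u) = take ?n (stem_tree s N w)"
          by (simp add: take_stem_tree diff)
        moreover have "stem_tree s N u ! ?n < stem_tree s N w ! ?n"
          using diff sj[of ?n] by (auto simp: nth_stem_tree)
        moreover have "?n < length u" "?n < length w" using diff by auto
        ultimately have "(stem_tree s N u, stem_tree s N w) \<in> lexord {(a, b). a < b}"
          by (auto simp: lexord_take_index_conv)
        then show ?thesis using last ne' by (simp add: prec_def)
      qed
    qed
  qed
  show ?thesis
    unfolding ek_tree_def using prefix prec sorted by (auto simp: ndseqs_le_def)
qed

text \<open>The stem tree is cut at last entry \<open>M\<close>. The set may also contain sequences
  that leave \<open>s\<close> early; this does no harm, because later only the last entries decide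
  about separation.\<close>

lemma ex_AR_stem:
  assumes s: "sorted s" "length s < k" "\<forall>e\<in>set s. e \<le> N" and NM: "N \<le> M"
  shows "\<exists>E\<in>AR k. (\<forall>x\<in>E. N \<le> last x \<and> last x \<le> M) \<and>
    (\<forall>t. sorted t \<and> length t = k - length s \<and> set t \<subseteq> {N..M} \<longrightarrow> s @ t \<in> E)"
proof -
  let ?X = "stem_tree s N ` ndseqs k"
  let ?E = "{x \<in> ?X. last x \<le> M}"
  have X: "?X \<in> ek_space k" using ek_tree_stem_tree[OF s(1,3)] by (auto simp: ek_space_def)
  have mem: "s @ t \<in> ?E" if t: "sorted t" "length t = k - length s" "set t \<subseteq> {N..M}" for t
  proof -
    \<comment> \<open>Zeros stay on the stem. Beyond it the tree adds \<open>N\<close>, which undoes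
      the truncated subtraction since all entries of \<open>t\<close> are at least
      \<open>N\<close>.\<close>
    let ?u = "replicate (length s) 0 @ map (\<lambda>x. x - N) t"
    have "sorted (map (\<lambda>x. x - N) t)" using t(1) by (auto simp: sorted_iff_nth_mono intro: diff_le_mono)
    then have "?u \<in> ndseqs k" using t(2) s(2) by (auto simp: ndseqs_def sorted_append)
    moreover have "stem_tree s N ?u = s @ t"
    proof (rule nth_equalityI)
      fix j assume j: "j < length (stem_tree s N ?u)"
      have "t ! i \<ge> N" if "i < length t" for i using t(3) nth_mem[OF that] by auto
      then show "stem_tree s N ?u ! j = (s @ t) ! j" using j by (auto simp: nth_stem_tree nth_append)
    qed simp
    moreover have "last (s @ t) \<le> M"
    proof -
      have "t \<noteq> []" using t(2) s(2) by auto
      then have "last t \<in> {N..M}" using t(3) last_in_set by blast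
      then show ?thesis using \<open>t \<noteq> []\<close> by simp
    qed
    ultimately show ?thesis by (metis (mono_tags, lifting) imageI mem_Collect_eq)
  qed
  have "s @ replicate (k - length s) N \<in> ?E" using NM by (intro mem) auto
  then have ne: "?E \<noteq> {}" by blast
  have AR: "?E \<in> AR k" using s(2) by (intro AR_initial_segment[OF _ X ne]) simp
  have lower: "N \<le> last x" if x: "x \<in> ?E" for x
  proof -
    obtain u where u: "u \<in> ndseqs k" "x = stem_tree s N u" using x by blast
    then have "u \<noteq> []" "length u = k" using s(2) by (auto simp: ndseqs_def)
    then show ?thesis using s(2) u(2) by (simp add: last_stem_tree)
  qed
  show ?thesis
  proof (intro bexI[OF _ AR] conjI ballI allI impI)
    show "s @ t \<in> ?E" if "sorted t \<and> length t = k - length s \<and> set t \<subseteq> {N..M}" for t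
      using that by (intro mem) auto
    show "N \<le> last x" if "x \<in> ?E" for x by (rule lower[OF that])
    show "last x \<le> M" if "x \<in> ?E" for x using that by simp
  qed
qed

section \<open>Admissible sets with prescribed gaps\<close>

text \<open>Any strictly \<open>\<prec>\<close>-monotone function may be prescribed as the last entry of the values of a tree.\<close>

definition tree_of :: "(nat list \<Rightarrow> nat) \<Rightarrow> nat list \<Rightarrow> nat list" where
  "tree_of \<beta> u = map (\<lambda>j. \<beta> (take (Suc j) u)) [0..<length u]"

lemma last_tree_of: "u \<noteq> [] \<Longrightarrow> last (tree_of \<beta> u) = \<beta> u"
  by (cases u rule: rev_cases) (auto simp: tree_of_def)

text \<open>The images are compared by their last entries alone, so the lexicographic clause never
  matters. They are sorted because \<beta> increases along initial segments.\<close>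

lemma ek_tree_tree_of:
  assumes \<beta>: "\<And>u w. u \<in> ndseqs_le k \<Longrightarrow> w \<in> ndseqs_le k \<Longrightarrow> u \<prec>\<^sub>s w \<Longrightarrow> \<beta> u < \<beta> w"
  shows "ek_tree k (tree_of \<beta>)"
proof -
  have len: "length (tree_of \<beta> u) = length u" for u by (simp add: tree_of_def)
  have "sorted (tree_of \<beta> u)" if u: "u \<in> ndseqs_le k" for u
    unfolding sorted_iff_nth_mono
  proof (intro allI impI)
    fix i j assume ij: "i \<le> j" "j < length (tree_of \<beta> u)"
    show "tree_of \<beta> u ! i \<le> tree_of \<beta> u ! j"
    proof (cases "i = j")
      case False
      then have "strict_prefix (take (Suc i) u) (take (Suc j) u)"
        using ij by (auto simp: strict_prefix_iff_take len min_def)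
      then have "take (Suc i) u \<prec>\<^sub>s take (Suc j) u"
        using ndseqs_le_take[OF u] by (intro strict_prefix_prec) (auto simp: ndseqs_le_def)
      then show ?thesis using \<beta>[OF ndseqs_le_take[OF u] ndseqs_le_take[OF u]] ij by (simp add: tree_of_def less_imp_le)
    qed simp
  qed
  moreover have "tree_of \<beta> u \<prec>\<^sub>s tree_of \<beta> w" if "u \<in> ndseqs_le k" "w \<in> ndseqs_le k" "u \<prec>\<^sub>s w" for u w
  proof (cases "u = []")
    case True
    then show ?thesis using that by (auto simp: prec_def tree_of_def)
  next
    case False
    then have ne: "u \<noteq> []" "w \<noteq> []" using that by (auto simp: prec_def)
    then have "tree_of \<beta> u \<noteq> []" "tree_of \<beta> w \<noteq> []" by (auto simp: tree_of_def)
    then show ?thesis using \<beta>[OF that] ne by (intro last_less_prec) (simp_all add: last_tree_of)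
  qed
  moreover have "strict_prefix (tree_of \<beta> u) (tree_of \<beta> w)" if "strict_prefix u w" for u w
  proof -
    have u: "length u < length w" "u = take (length u) w" using that by (auto simp: strict_prefix_iff_take)
    have "tree_of \<beta> u ! j = tree_of \<beta> w ! j" if "j < length u" for j
    proof -
      have "take (Suc j) u = take (Suc j) w" by (subst u(2)) (use that in \<open>simp add: min_def\<close>)
      then show ?thesis using that u(1) by (simp add: tree_of_def)
    qed
    then have "tree_of \<beta> u = take (length u) (tree_of \<beta> w)"
      using u(1) by (intro nth_equalityI) (simp_all add: len)
    then show ?thesis using u(1) by (simp add: strict_prefix_iff_take len)
  qed
  ultimately show ?thesis unfolding ek_tree_def by (auto simp: ndseqs_le_def len)
qed

section \<open>Ranks in the well-order and the first elements of a tree\<close>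

lemma prec_card_less:
  assumes "u \<prec>\<^sub>s w" "u \<in> D" "D \<subseteq> ndseqs_le k"
  shows "card {y \<in> D. y \<prec>\<^sub>s u} < card {y \<in> D. y \<prec>\<^sub>s w}"
proof (rule psubset_card_mono[OF finite_preds'[OF assms(3)]])
  show "{y \<in> D. y \<prec>\<^sub>s u} \<subset> {y \<in> D. y \<prec>\<^sub>s w}"
    using assms prec_trans prec_irrefl by blast
qed

text \<open>All predecessors of the least \<open>u\<close> of position at least \<open>n\<close>
  have distinct positions below \<open>n\<close>, so there are at most \<open>n\<close> of
  them.\<close>

lemma ex_nth_ndseqs:
  assumes "k \<ge> 1" shows "\<exists>u\<in>ndseqs k. card {y \<in> ndseqs k. y \<prec>\<^sub>s u} = n"
proof -
  let ?pos = "\<lambda>u. card {y \<in> ndseqs k. y \<prec>\<^sub>s u}"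
  have inj: "inj_on ?pos (ndseqs k)"
  proof (rule inj_onI)
    fix u w assume "u \<in> ndseqs k" "w \<in> ndseqs k" "?pos u = ?pos w"
    then show "u = w" using prec_card_less[of u w "ndseqs k" k] prec_card_less[of w u "ndseqs k" k]
        prec_linear[of u w] ndseqs_subset by auto
  qed
  have "inj (\<lambda>n::nat. replicate k n)" using assms by (auto simp: inj_def)
  moreover have "range (\<lambda>n::nat. replicate k n) \<subseteq> ndseqs k" by (auto simp: ndseqs_def)
  ultimately have "infinite (ndseqs k)" using infinite_UNIV_nat finite_subset finite_imageD by metis
  then have "infinite (?pos ` ndseqs k)" using inj finite_imageD by blast
  then obtain u where "u \<in> ndseqs k" "?pos u \<ge> n"
    by (metis (no_types, lifting) finite_nat_set_iff_bounded imageE linorder_not_le)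
  then obtain u where u: "u \<in> ndseqs k" "?pos u \<ge> n"
    and least: "\<And>w. w \<in> ndseqs k \<Longrightarrow> ?pos w \<ge> n \<Longrightarrow> ?pos u \<le> ?pos w"
    using ex_has_least_nat[of "\<lambda>u. u \<in> ndseqs k \<and> ?pos u \<ge> n" u ?pos] by blast
  have "?pos y < n" if y: "y \<in> ndseqs k" "y \<prec>\<^sub>s u" for y
    using least[of y] prec_card_less[OF y(2,1) ndseqs_subset] y by force
  then have "card (?pos ` {y \<in> ndseqs k. y \<prec>\<^sub>s u}) \<le> card {..<n}" by (intro card_mono) auto
  moreover have "card (?pos ` {y \<in> ndseqs k. y \<prec>\<^sub>s u}) = ?pos u"
    by (intro card_image inj_on_subset[OF inj]) auto
  ultimately show ?thesis using u by force
qed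

text \<open>As \<prec> is linear, a tree is an order isomorphism onto its image and preserves the
  number of predecessors.\<close>

lemma restr_tree_image:
  assumes T: "ek_tree k T" shows "restr m (T ` ndseqs k) = T ` restr m (ndseqs k)"
proof -
  have iff: "T y \<prec>\<^sub>s T u \<longleftrightarrow> y \<prec>\<^sub>s u" if "y \<in> ndseqs k" "u \<in> ndseqs k" for y u
    using T that ndseqs_subset[of k] prec_linear[of y u] prec_trans prec_irrefl
    unfolding ek_tree_def by (metis subsetD)
  have inj: "inj_on T (ndseqs k)" using iff prec_linear prec_irrefl by (metis inj_onI)
  have "{y \<in> T ` ndseqs k. y \<prec>\<^sub>s T u} = T ` {y \<in> ndseqs k. y \<prec>\<^sub>s u}" if "u \<in> ndseqs k" for u
    using iff that by auto
  then have "card {y \<in> T ` ndseqs k. y \<prec>\<^sub>s T u} = card {y \<in> ndseqs k. y \<prec>\<^sub>s u}" if "u \<in> ndseqs k" for u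
    using that inj by (simp add: card_image inj_on_subset)
  then show ?thesis unfolding restr_def by auto
qed

text \<open>Supplies the vectors v_i for admissibility: each passes a prescribed threshold
  \<open>H i\<close> but overshoots it by at most \<open>G\<close>, which is chosen before
  \<open>H\<close>. The prescribed last entry is the rank, which makes it strictly monotone, plus a
  jump at each element of \<open>ndseqs k\<close>.\<close>

lemma ex_admissible_vectors:
  assumes k: "k \<ge> 1"
  shows "\<exists>G. \<forall>H m. mono (H :: nat \<Rightarrow> nat) \<and> 1 \<le> m \<and> m \<le> d \<longrightarrow>
    (\<exists>v. v ` {1..m} \<in> A_fam k d \<and> (\<forall>i\<in>{1..m}. v i \<in> ndseqs k \<and> H i < last (v i) \<and> last (v i) \<le> G + H i))"
proof -
  let ?rank = "\<lambda>u. card {y \<in> ndseqs_le k. y \<prec>\<^sub>s u}"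
  let ?pos = "\<lambda>u. card {y \<in> ndseqs k. y \<prec>\<^sub>s u}"
  obtain l where l: "\<And>n. l n \<in> ndseqs k" "\<And>n. ?pos (l n) = n" using ex_nth_ndseqs[OF k] by metis
  have lne: "l n \<noteq> []" for n using l(1)[of n] k by (auto simp: ndseqs_def)
  have restr: "restr m (ndseqs k) = (\<lambda>i. l (i - 1)) ` {1..m}" for m
  proof (intro set_eqI iffI)
    fix u assume u: "u \<in> restr m (ndseqs k)"
    then have "u = l (?pos u)"
      using l prec_card_less[of u "l (?pos u)" "ndseqs k" k] prec_card_less[of "l (?pos u)" u "ndseqs k" k]
        prec_linear[of u "l (?pos u)"] ndseqs_subset[of k] by (auto simp: restr_def)
    moreover have "Suc (?pos u) \<in> {1..m}" using u by (simp add: restr_def)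
    ultimately show "u \<in> (\<lambda>i. l (i - 1)) ` {1..m}" by (intro image_eqI[of _ _ "Suc (?pos u)"]) simp_all
  qed (auto simp: restr_def l)
  \<comment> \<open>A common bound for the ranks of the first \<open>d\<close> elements of
    \<open>ndseqs k\<close>.\<close>
  define G where "G = (\<Sum>i\<in>{1..d}. ?rank (l (i - 1)))"
  have "\<exists>v. v ` {1..m} \<in> A_fam k d \<and> (\<forall>i\<in>{1..m}. v i \<in> ndseqs k \<and> H i < last (v i) \<and> last (v i) \<le> G + H i)"
    if H: "mono H" and m: "1 \<le> m" "m \<le> d" for H :: "nat \<Rightarrow> nat" and m
  proof -
    \<comment> \<open>Counting \<open>u\<close> itself makes the \<open>i\<close>-th element of
      \<open>ndseqs k\<close>, numbered from 1, receive \<open>H i\<close>.\<close>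
    define \<beta> where "\<beta> u = ?rank u + H (card {y \<in> ndseqs k. y \<preceq>\<^sub>s u})" for u
    have fin: "finite {y \<in> ndseqs k. y \<preceq>\<^sub>s u}" for u
      by (rule finite_subset[of _ "insert u {y \<in> ndseqs k. y \<prec>\<^sub>s u}"])
         (auto simp: preceq_def finite_preds'[OF ndseqs_subset])
    have T: "ek_tree k (tree_of \<beta>)"
    proof (rule ek_tree_tree_of)
      fix u w assume uw: "u \<in> ndseqs_le k" "w \<in> ndseqs_le k" "u \<prec>\<^sub>s w"
      have "{y \<in> ndseqs k. y \<preceq>\<^sub>s u} \<subseteq> {y \<in> ndseqs k. y \<preceq>\<^sub>s w}"
        using preceq_prec_trans[OF _ uw(3)] by (auto simp: preceq_def)
      then have "H (card {y \<in> ndseqs k. y \<preceq>\<^sub>s u}) \<le> H (card {y \<in> ndseqs k. y \<preceq>\<^sub>s w})"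
        by (intro monoD[OF H] card_mono fin)
      then show "\<beta> u < \<beta> w" using prec_card_less[OF uw(3,1) order_refl] by (simp add: \<beta>_def)
    qed
    define v where "v i = tree_of \<beta> (l (i - 1))" for i
    have "v ` {1..m} = restr m (tree_of \<beta> ` ndseqs k)"
      unfolding restr_tree_image[OF T] restr by (auto simp: v_def)
    moreover have "tree_of \<beta> ` ndseqs k \<in> ek_space k" using T by (auto simp: ek_space_def)
    ultimately have "v ` {1..m} \<in> A_fam k d" using m unfolding A_fam_def AR_n_def by auto
    moreover have "v i \<in> ndseqs k \<and> H i < last (v i) \<and> last (v i) \<le> G + H i" if i: "i \<in> {1..m}" for i
    proof -
      have "{y \<in> ndseqs k. y \<preceq>\<^sub>s l (i - 1)} = insert (l (i - 1)) {y \<in> ndseqs k. y \<prec>\<^sub>s l (i - 1)}"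
        using l(1) by (auto simp: preceq_def)
      then have "card {y \<in> ndseqs k. y \<preceq>\<^sub>s l (i - 1)} = i"
        using l(2)[of "i - 1"] i finite_preds'[OF ndseqs_subset, of k "l (i - 1)"] prec_irrefl by simp
      then have last: "last (v i) = ?rank (l (i - 1)) + H i"
        by (simp add: v_def last_tree_of[OF lne] \<beta>_def)
      \<comment> \<open>The empty sequence makes the rank positive, which gives the strict
        inequality above \<open>H i\<close>.\<close>
      have "[] \<in> {y \<in> ndseqs_le k. y \<prec>\<^sub>s l (i - 1)}" using lne by (auto simp: ndseqs_le_def prec_def)
      then have "?rank (l (i - 1)) > 0" using finite_preds[of k] by (metis card_gt_0_iff empty_iff)
      moreover have "?rank (l (i - 1)) \<le> G" unfolding G_def using i m by (intro member_le_sum) auto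
      moreover have "v i \<in> ndseqs k"
        using ek_space_subset[of "tree_of \<beta> ` ndseqs k" k] T l(1) by (auto simp: v_def ek_space_def)
      ultimately show ?thesis using last by simp
    qed
    ultimately show ?thesis by blast
  qed
  then show ?thesis by blast
qed

section \<open>Basic properties of the norm\<close>

locale ellentuck_norm =
  fixes k d :: nat and \<theta> :: real
  assumes k1: "k \<ge> 1" and d1: "d \<ge> 1" and th0: "0 < \<theta>" and th1: "\<theta> < 1"
begin

abbreviation "sn \<equiv> tnorm_seq k d \<theta>"
abbreviation "tn \<equiv> tnorm k d \<theta>"

lemma sn_0_ge: "x \<in> c00 k \<Longrightarrow> \<bar>x v\<bar> \<le> sn 0 x"
proof -
  assume x: "x \<in> c00 k"
  show ?thesis
  proof (cases "v \<in> ndseqs k")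
    case True
    then show ?thesis using finite_tnorm_0_values[OF x] by (auto intro: Max_ge)
  next
    case False
    then have "x v = 0" using x by (auto simp: c00_def)
    moreover obtain w where "w \<in> ndseqs k" using ndseqs_nonempty by blast
    then have "\<bar>x w\<bar> \<le> sn 0 x" using finite_tnorm_0_values[OF x] by (auto intro: Max_ge)
    ultimately show ?thesis by simp
  qed
qed

lemma sn_0_le:
  assumes "x \<in> c00 k" "\<And>v. \<bar>x v\<bar> \<le> B" shows "sn 0 x \<le> B"
  using assms finite_tnorm_0_values[OF assms(1)] ndseqs_nonempty by (auto intro!: Max.boundedI)

lemma sn_admissible:
  assumes "x \<in> c00 k" "admissible k d m E"
  shows "\<theta> * (\<Sum>i=1..m. sn j (proj (E i) x)) \<le> sn (Suc j) x"
proof -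
  have "(\<Sum>i=1..m. sn j (proj (E i) x)) \<le> Max {\<Sum>i=1..m. sn j (proj (E i) x) | m E. admissible k d m E}"
    using finite_tnorm_values[OF assms(1)] assms(2) by (intro Max_ge) blast+
  then show ?thesis using th0 by (simp add: max.coboundedI2)
qed

lemma sn_Suc_le:
  assumes "x \<in> c00 k" "sn j x \<le> B"
    and "\<And>m E. admissible k d m E \<Longrightarrow> \<theta> * (\<Sum>i=1..m. sn j (proj (E i) x)) \<le> B"
  shows "sn (Suc j) x \<le> B"
proof -
  let ?A = "{\<Sum>i=1..m. sn j (proj (E i) x) | m E. admissible k d m E}"
  have "Max ?A \<in> ?A"
    using finite_tnorm_values[OF assms(1)] ex_admissible[OF k1 d1] by (intro Max_in) auto
  then have "\<theta> * Max ?A \<le> B" using assms(3) by force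
  then show ?thesis using assms(2) by simp
qed

lemma c00_dominated:
  assumes "y \<in> c00 k" "\<And>v. \<bar>x v\<bar> \<le> \<bar>y v\<bar>" shows "x \<in> c00 k"
proof (rule c00_subset[OF assms(1)])
  have "x v = 0" if "y v = 0" for v using assms(2)[of v] that by simp
  then show "{v. x v \<noteq> 0} \<subseteq> {v. y v \<noteq> 0}" by blast
qed

text \<open>The canonical basis is 1-unconditional: domination survives every projection, so it
  passes through the recursion.\<close>

lemma sn_dominated:
  assumes "y \<in> c00 k" "\<And>v. \<bar>x v\<bar> \<le> \<bar>y v\<bar>" shows "sn j x \<le> sn j y"
  using assms
proof (induction j arbitrary: x y)
  case 0
  have "x \<in> c00 k" by (rule c00_dominated[OF 0])
  then show ?case using sn_0_ge[OF 0(1)] 0(2) by (intro sn_0_le) (auto intro: order_trans)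
next
  case (Suc j)
  have x: "x \<in> c00 k" by (rule c00_dominated[OF Suc.prems])
  show ?case
  proof (rule sn_Suc_le[OF x])
    show "sn j x \<le> sn (Suc j) y" using Suc.IH[OF Suc.prems] by simp
    fix m E assume adm: "admissible k d m E"
    have "(\<Sum>i=1..m. sn j (proj (E i) x)) \<le> (\<Sum>i=1..m. sn j (proj (E i) y))"
      by (intro sum_mono Suc.IH proj_c00 Suc.prems(1)) (use Suc.prems(2) in \<open>auto simp: proj_def\<close>)
    then have "\<theta> * (\<Sum>i=1..m. sn j (proj (E i) x)) \<le> \<theta> * (\<Sum>i=1..m. sn j (proj (E i) y))"
      using th0 by simp
    also have "\<dots> \<le> sn (Suc j) y" by (rule sn_admissible[OF Suc.prems(1) adm])
    finally show "\<theta> * (\<Sum>i=1..m. sn j (proj (E i) x)) \<le> sn (Suc j) y" .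
  qed
qed

lemma sn_nonneg: "x \<in> c00 k \<Longrightarrow> 0 \<le> sn j x"
  using nfun_attained[OF k1 d1, of x \<theta> j] nfun_le[OF th0, of k d j _ x]
  by (metis abs_ge_zero order_trans)

lemma c00_add: "x \<in> c00 k \<Longrightarrow> y \<in> c00 k \<Longrightarrow> (\<lambda>v. x v + y v) \<in> c00 k"
proof -
  assume *: "x \<in> c00 k" "y \<in> c00 k"
  have "{v. x v + y v \<noteq> 0} \<subseteq> {v. x v \<noteq> 0} \<union> {v. y v \<noteq> 0}" by auto
  then show ?thesis using * by (auto simp: c00_def intro: finite_subset)
qed

lemma c00_scale: "x \<in> c00 k \<Longrightarrow> (\<lambda>v. c * x v) \<in> c00 k"
  by (erule c00_subset) auto

lemma c00_sum: "finite S \<Longrightarrow> (\<And>i. i \<in> S \<Longrightarrow> w i \<in> c00 k) \<Longrightarrow> (\<lambda>v. \<Sum>i\<in>S. a i * w i v) \<in> c00 k"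
proof (induction S rule: finite_induct)
  case empty
  then show ?case by (simp add: c00_def)
next
  case (insert i S)
  then show ?case using c00_add[OF c00_scale[of "w i" "a i"], of "\<lambda>v. \<Sum>i\<in>S. a i * w i v"] by simp
qed

text \<open>Evaluated at a norming functional that attains the norm of the sum, where additivity is
  available.\<close>

lemma sn_triangle:
  assumes "x \<in> c00 k" "y \<in> c00 k" shows "sn j (\<lambda>v. x v + y v) \<le> sn j x + sn j y"
proof -
  obtain f where f: "nfun k d \<theta> j f" "f (\<lambda>v. x v + y v) = sn j (\<lambda>v. x v + y v)"
    using nfun_attained[OF k1 d1 c00_add[OF assms]] by blast
  then have "sn j (\<lambda>v. x v + y v) = f x + f y" using nfun_add by metis
  also have "\<dots> \<le> sn j x + sn j y"
    using nfun_le[OF th0 f(1) assms(1)] nfun_le[OF th0 f(1) assms(2)] by linarith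
  finally show ?thesis .
qed

lemma sn_tendsto: "x \<in> c00 k \<Longrightarrow> (\<lambda>j. sn j x) \<longlonglongrightarrow> tn x"
  unfolding tnorm_def
  by (rule LIMSEQ_incseq_SUP)
     (auto intro!: bdd_aboveI[of _ "\<Sum>v | x v \<noteq> 0. \<bar>x v\<bar>"] incseq_SucI
        simp: tnorm_seq_bound[OF k1 d1 th0 th1])

lemma sn_le_tn: "x \<in> c00 k \<Longrightarrow> sn j x \<le> tn x"
  by (rule incseq_le[OF _ sn_tendsto]) (auto intro: incseq_SucI)

lemma tn_le: "x \<in> c00 k \<Longrightarrow> (\<And>j. sn j x \<le> B) \<Longrightarrow> tn x \<le> B"
  by (rule LIMSEQ_le_const2[OF sn_tendsto]) auto

lemma tn_nonneg: "x \<in> c00 k \<Longrightarrow> 0 \<le> tn x"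
  using sn_nonneg sn_le_tn order_trans by blast

lemma coord_le_tn: "x \<in> c00 k \<Longrightarrow> \<bar>x v\<bar> \<le> tn x"
  using sn_0_ge sn_le_tn order_trans by blast

lemma tn_dominated:
  assumes "y \<in> c00 k" "\<And>v. \<bar>x v\<bar> \<le> \<bar>y v\<bar>" shows "tn x \<le> tn y"
proof -
  have x: "x \<in> c00 k" by (rule c00_dominated[OF assms])
  show ?thesis
    using sn_dominated[OF assms] sn_le_tn[OF assms(1)] by (intro tn_le[OF x]) (rule order_trans)
qed

text \<open>One half of the implicit equation of the norm: the index drop from \<open>Suc j\<close>
  to \<open>j\<close> disappears in the limit.\<close>

lemma tn_admissible:
  assumes "x \<in> c00 k" "admissible k d m E"
  shows "\<theta> * (\<Sum>i=1..m. tn (proj (E i) x)) \<le> tn x"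
proof (rule LIMSEQ_le_const2)
  show "(\<lambda>j. \<theta> * (\<Sum>i=1..m. sn j (proj (E i) x))) \<longlonglongrightarrow> \<theta> * (\<Sum>i=1..m. tn (proj (E i) x))"
    by (intro tendsto_intros sn_tendsto proj_c00 assms(1))
  show "\<exists>N. \<forall>j\<ge>N. \<theta> * (\<Sum>i=1..m. sn j (proj (E i) x)) \<le> tn x"
    using sn_admissible[OF assms] sn_le_tn[OF assms(1)] order_trans by blast
qed

lemma tn_triangle:
  assumes "x \<in> c00 k" "y \<in> c00 k" shows "tn (\<lambda>v. x v + y v) \<le> tn x + tn y"
  by (rule tn_le[OF c00_add[OF assms]])
     (use sn_triangle[OF assms] sn_le_tn[OF assms(1)] sn_le_tn[OF assms(2)] in
       \<open>meson add_mono order_trans\<close>)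

lemma tn_l1: "x \<in> c00 k \<Longrightarrow> tn x \<le> (\<Sum>v | x v \<noteq> 0. \<bar>x v\<bar>)"
  by (rule tn_le) (auto intro: tnorm_seq_bound[OF k1 d1 th0 th1])

lemma tn_scale:
  assumes x: "x \<in> c00 k" shows "tn (\<lambda>v. c * x v) = \<bar>c\<bar> * tn x"
proof -
  have le: "tn (\<lambda>v. c * x v) \<le> \<bar>c\<bar> * tn x" if x: "x \<in> c00 k" for c x
  proof (rule tn_le[OF c00_scale[OF x]])
    fix j
    obtain f where f: "nfun k d \<theta> j f" "f (\<lambda>v. c * x v) = sn j (\<lambda>v. c * x v)"
      using nfun_attained[OF k1 d1 c00_scale[OF x]] by blast
    have "c * f x \<le> \<bar>c\<bar> * \<bar>f x\<bar>" by (metis abs_ge_self abs_mult)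
    also have "\<dots> \<le> \<bar>c\<bar> * tn x"
      using nfun_le[OF th0 f(1) x] sn_le_tn[OF x, of j] by (intro mult_left_mono) auto
    finally show "sn j (\<lambda>v. c * x v) \<le> \<bar>c\<bar> * tn x" using nfun_scale[OF f(1)] f(2) by metis
  qed
  show ?thesis
  proof (cases "c = 0")
    case True
    then show ?thesis using le[OF x, of 0] tn_nonneg[OF c00_scale[OF x, of 0]] by simp
  next
    case False
    have "tn x \<le> \<bar>1 / c\<bar> * tn (\<lambda>v. c * x v)"
      using le[OF c00_scale[OF x, of c], of "1 / c"] False by simp
    then show ?thesis using le[OF x, of c] False by (simp add: field_simps)
  qed
qed

end

section \<open>Upper \<open>p\<close>-estimate\<close>

lemma sum_le_if_at_most_one_nonzero:
  fixes f :: "'i \<Rightarrow> real"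
  assumes fin: "finite L" and B: "B \<ge> 0" "\<And>l. l \<in> L \<Longrightarrow> f l \<le> B"
    and one: "\<And>l l'. l \<in> L \<Longrightarrow> l' \<in> L \<Longrightarrow> f l \<noteq> 0 \<Longrightarrow> f l' \<noteq> 0 \<Longrightarrow> l = l'"
  shows "sum f L \<le> B"
proof (cases "\<exists>l\<in>L. f l \<noteq> 0")
  case True
  then obtain l where l: "l \<in> L" "f l \<noteq> 0" by blast
  have "sum f (L - {l}) = 0" by (rule sum.neutral) (use one l in blast)
  then show ?thesis using B(2)[OF l(1)] sum.remove[OF fin l(1), of f] by simp
next
  case False
  then show ?thesis using B(1) by simp
qed

text \<open>In the upper estimate, a vector living on the blocks \<open>a, \<dots>, b\<close> is bounded with weight \<open>A\<close> at the
  two extreme blocks and \<open>M\<close> inside. When a vector is split, an inner block becomes an extreme block of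
  at most two pieces, and every other piece that meets it meets nothing else; hence \<open>M = 2 * A + d\<close>.\<close>

definition end_weight :: "real \<Rightarrow> real \<Rightarrow> nat \<Rightarrow> nat \<Rightarrow> nat \<Rightarrow> real" where
  "end_weight A M a b i =
     (if i < a \<or> b < i then 0 else if a = b then 1 else if i = a \<or> i = b then A else M)"

lemma end_weight_nonneg: "A \<ge> 1 \<Longrightarrow> M \<ge> A \<Longrightarrow> 0 \<le> end_weight A M a b i"
  and end_weight_le: "A \<ge> 1 \<Longrightarrow> M \<ge> A \<Longrightarrow> end_weight A M a b i \<le> M"
  and end_weight_ge_1: "A \<ge> 1 \<Longrightarrow> M \<ge> A \<Longrightarrow> a \<le> i \<Longrightarrow> i \<le> b \<Longrightarrow> 1 \<le> end_weight A M a b i"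
  and end_weight_le_end: "A \<ge> 1 \<Longrightarrow> M \<ge> A \<Longrightarrow> a' \<ge> i \<or> b' \<le> i \<Longrightarrow> end_weight A M a' b' i \<le> A"
  by (auto simp: end_weight_def)

lemma sum_end_weight_le:
  fixes a b :: "nat \<Rightarrow> nat"
  assumes fin: "finite L" and card: "card L \<le> d" and A: "A \<ge> 1"
    and ab: "\<And>l. l \<in> L \<Longrightarrow> a l \<le> b l"
    and ord: "\<And>l l'. l \<in> L \<Longrightarrow> l' \<in> L \<Longrightarrow> l < l' \<Longrightarrow> b l \<le> a l'"
  shows "(\<Sum>l\<in>(L::nat set). end_weight A (2 * A + d) (a l) (b l) i) \<le> 2 * A + d"
proof (cases "\<exists>l\<in>L. a l < i \<and> i < b l")
  case True
  then obtain l where l: "l \<in> L" "a l < i" "i < b l" by blast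
  have "end_weight A (2 * A + d) (a l') (b l') i = 0" if "l' \<in> L" "l' \<noteq> l" for l'
    using ord[of l l'] ord[of l' l] l that by (cases "l < l'") (auto simp: end_weight_def)
  then have "(\<Sum>l\<in>L. end_weight A (2 * A + d) (a l) (b l) i) = end_weight A (2 * A + d) (a l) (b l) i"
    by (simp add: sum.remove[OF fin l(1)])
  then show ?thesis using end_weight_le[OF A, of "2 * A + d"] A by simp
next
  case False
  let ?f = "\<lambda>l. if a l < i \<and> b l = i then A else 0"
  let ?g = "\<lambda>l. if a l = i \<and> i < b l then A else 0"
  have "(\<Sum>l\<in>L. end_weight A (2 * A + d) (a l) (b l) i) \<le> (\<Sum>l\<in>L. ?f l + ?g l + 1)"
    using False ab A by (intro sum_mono) (force simp: end_weight_def)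
  also have "\<dots> = sum ?f L + sum ?g L + card L" by (simp add: sum.distrib)
  finally have "(\<Sum>l\<in>L. end_weight A (2 * A + d) (a l) (b l) i) \<le> sum ?f L + sum ?g L + card L" .
  moreover have "sum ?f L \<le> A"
  proof (rule sum_le_if_at_most_one_nonzero[OF fin])
    fix l l' assume "l \<in> L" "l' \<in> L" "?f l \<noteq> 0" "?f l' \<noteq> 0"
    then show "l = l'" using ord[of l l'] ord[of l' l] by (cases l l' rule: linorder_cases) (auto split: if_splits)
  qed (use A in auto)
  moreover have "sum ?g L \<le> A"
  proof (rule sum_le_if_at_most_one_nonzero[OF fin])
    fix l l' assume "l \<in> L" "l' \<in> L" "?g l \<noteq> 0" "?g l' \<noteq> 0"
    then show "l = l'" using ord[of l l'] ord[of l' l] by (cases l l' rule: linorder_cases) (auto split: if_splits)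
  qed (use A in auto)
  ultimately show ?thesis using card by simp
qed

lemma admissible_prec:
  assumes adm: "admissible k d m E" and ij: "1 \<le> i" "i < j" "j \<le> m" and xy: "x \<in> E i" "y \<in> E j"
  shows "x \<prec>\<^sub>s y"
proof -
  obtain v where v: "\<forall>i\<in>{1..m}. set_le {v i} (E i)" "\<forall>i\<in>{1..<m}. set_less (E i) {v (Suc i)}"
    using adm by (auto simp: admissible_def)
  have bounds: "x \<preceq>\<^sub>s prec_max (E i) \<and> prec_min (E i) \<preceq>\<^sub>s x" if "1 \<le> i" "i \<le> m" "x \<in> E i" for i x
  proof -
    have "E i \<in> AR k" using adm that by (auto simp: admissible_def)
    then show ?thesis using prec_max[of "E i"] prec_min[of "E i"] AR_props[of "E i" k] that by blast
  qed
  have step: "prec_max (E i) \<prec>\<^sub>s prec_min (E (Suc i))" if "1 \<le> i" "Suc i \<le> m" for i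
    using v(1)[rule_format, of "Suc i"] v(2)[rule_format, of i] that
    by (auto simp: set_le_def set_less_def intro: prec_preceq_trans)
  show ?thesis
    using ij(2,3) xy(2)
  proof (induction j arbitrary: y)
    case (Suc j)
    have y: "prec_min (E (Suc j)) \<preceq>\<^sub>s y" using bounds[of "Suc j" y] Suc.prems ij(1) by auto
    show ?case
    proof (cases "i = j")
      case True
      then have "x \<preceq>\<^sub>s prec_max (E j)" using bounds[of i x] xy(1) ij Suc.prems by auto
      then show ?thesis using step[of j] True y ij Suc.prems
        by (auto intro: preceq_prec_trans prec_preceq_trans)
    next
      case False
      have "E j \<in> AR k" using adm Suc.prems ij by (auto simp: admissible_def)
      then obtain z where z: "z \<in> E j" using AR_props(2) by blast
      have "x \<prec>\<^sub>s z" using Suc.IH[of z] False Suc.prems z by auto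
      moreover have "z \<preceq>\<^sub>s prec_max (E j)" using bounds[of j z] z Suc.prems ij by auto
      moreover have "prec_max (E j) \<prec>\<^sub>s prec_min (E (Suc j))" using step[of j] Suc.prems ij by auto
      ultimately show ?thesis using y prec_trans prec_preceq_trans by blast
    qed
  qed simp
qed


context ellentuck_norm
begin

lemma sn_zero: "sn j (\<lambda>_. 0) = 0"
  using sn_nonneg[of "\<lambda>_. 0" j] tnorm_seq_bound[OF k1 d1 th0 th1, of "\<lambda>_. 0" j]
  by (simp add: c00_def)

lemma sn_le_remove_blocks:
  assumes u: "u \<in> c00 k" and R: "finite R"
  shows "sn j (proj D u) \<le> sn j (proj D (proj {v. \<kappa> v \<notin> R} u)) + (\<Sum>e\<in>R. sn j (proj D (proj {v. \<kappa> v = e} u)))"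
  using R
proof (induction R rule: finite_induct)
  case empty
  then show ?case by (simp add: proj_def)
next
  case (insert e R)
  have "proj D (proj {v. \<kappa> v \<notin> R} u) =
      (\<lambda>v. proj D (proj {v. \<kappa> v \<notin> insert e R} u) v + proj D (proj {v. \<kappa> v = e} u) v)"
    using insert.hyps(2) by (auto simp: proj_def fun_eq_iff)
  then have "sn j (proj D (proj {v. \<kappa> v \<notin> R} u)) \<le>
      sn j (proj D (proj {v. \<kappa> v \<notin> insert e R} u)) + sn j (proj D (proj {v. \<kappa> v = e} u))"
    using sn_triangle[OF proj_c00[OF proj_c00[OF u]] proj_c00[OF proj_c00[OF u]]] by simp
  then show ?case using insert by simp
qed

text \<open>Induction on \<open>j\<close>, with the extreme blocks weighted separately because a
  bound with one weight for all blocks would deteriorate at each level. The value \<open>A\<close>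
  is determined by \<theta>^p * A = 1: then \<theta> * (A * t^p)^(1/p) = t, and an extreme block
  that is cut can be entered as one more piece of mass A * t^p. The block estimate \<open>t\<close>
  is fixed throughout; only \<open>u\<close> and its range vary.\<close>

lemma sn_upper_p_estimate:
  fixes \<kappa> :: "nat list \<Rightarrow> nat" and p :: real
  defines "A \<equiv> real d powr (p - 1)"
  defines "M \<equiv> 2 * A + d"
  assumes p: "p > 1" "\<theta> = real d powr (1 / p - 1)"
    and \<kappa>: "\<And>v w. v \<prec>\<^sub>s w \<Longrightarrow> v \<in> ndseqs k \<Longrightarrow> w \<in> ndseqs k \<Longrightarrow> \<kappa> v \<le> \<kappa> w"
    and u: "u \<in> c00 k" and t: "\<And>i. tn (proj {v. \<kappa> v = i} u) \<le> t i"
    and ab: "a \<le> b" "\<And>v. u v \<noteq> 0 \<Longrightarrow> a \<le> \<kappa> v \<and> \<kappa> v \<le> b"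
  shows "sn j u \<le> (\<Sum>i\<in>{a..b}. end_weight A M a b i * t i powr p) powr (1 / p)"
proof -
  define \<Phi> where "\<Phi> a b = (\<Sum>i\<in>{a..b}. end_weight A M a b i * t i powr p)" for a b
  have A1: "A \<ge> 1" unfolding A_def using d1 p(1) by (intro ge_one_powr_ge_zero) auto
  have MA: "M \<ge> A" using A1 by (simp add: M_def)
  have t0: "0 \<le> t i" for i using order_trans[OF tn_nonneg[OF proj_c00[OF u]] t] .
  have root: "t i \<le> \<Phi> a b powr (1 / p)" if "a \<le> i" "i \<le> b" for a b i
  proof -
    have "t i powr p \<le> end_weight A M a b i * t i powr p"
      using mult_right_mono[OF end_weight_ge_1[OF A1 MA that], of "t i powr p"] by simp
    also have "\<dots> \<le> \<Phi> a b"
      unfolding \<Phi>_def using that end_weight_nonneg[OF A1 MA] by (intro member_le_sum) auto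
    finally have "(t i powr p) powr (1 / p) \<le> \<Phi> a b powr (1 / p)" using p(1) by (intro powr_mono2) auto
    then show ?thesis using p(1) t0 by (simp add: powr_powr)
  qed
  have "sn j u \<le> \<Phi> a b powr (1 / p)"
    using u t ab
  proof (induction j arbitrary: u a b)
    case (0 u a b)
    show ?case
    proof (rule sn_0_le[OF 0(1)])
      fix v
      show "\<bar>u v\<bar> \<le> \<Phi> a b powr (1 / p)"
      proof (cases "u v = 0")
        case False
        have "\<bar>u v\<bar> = \<bar>proj {w. \<kappa> w = \<kappa> v} u v\<bar>" by (simp add: proj_def)
        also have "\<dots> \<le> t (\<kappa> v)" using coord_le_tn[OF proj_c00[OF 0(1)]] 0(2) order_trans by blast
        also have "\<dots> \<le> \<Phi> a b powr (1 / p)" using 0(4)[OF False] by (intro root) auto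
        finally show ?thesis .
      qed simp
    qed
  next
    case (Suc j u a b)
    note u = Suc.prems(1) and t = Suc.prems(2) and ab = Suc.prems(3) and supp = Suc.prems(4)
    show ?case
    proof (rule sn_Suc_le[OF u])
      show "sn j u \<le> \<Phi> a b powr (1 / p)" by (rule Suc.IH[OF Suc.prems])
    next
      fix m E assume adm: "admissible k d m E"
      show "\<theta> * (\<Sum>i=1..m. sn j (proj (E i) u)) \<le> \<Phi> a b powr (1 / p)"
      proof (cases "a = b")
        \<comment> \<open>A single block needs no splitting analysis, as \<open>t a\<close> already
          bounds its full norm; hence its weight can be 1.\<close>
        case True
        have "proj {v. \<kappa> v = a} u = u" using supp True by (force simp: proj_def fun_eq_iff)
        then have "tn u \<le> t a" using t[of a] by simp
        then have "sn (Suc j) u \<le> t a" using sn_le_tn[OF u] order_trans by blast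
        then show ?thesis using sn_admissible[OF u adm, of j] root[of a a b] True by linarith
      next
        case False
        with ab have ab: "a < b" by simp
        define K where "K l = \<kappa> ` {v. proj (E l) u v \<noteq> 0}" for l
        have Kab: "K l \<subseteq> {a..b}" for l using supp by (force simp: K_def proj_def split: if_splits)
        have Kord: "x \<le> y" if h: "1 \<le> l" "l < l'" "l' \<le> m" "x \<in> K l" "y \<in> K l'" for x y l l'
        proof -
          obtain v w where "v \<in> E l" "u v \<noteq> 0" "x = \<kappa> v" "w \<in> E l'" "u w \<noteq> 0" "y = \<kappa> w"
            using h(4,5) by (auto simp: K_def proj_def split: if_splits)
          then show ?thesis using \<kappa>[OF admissible_prec[OF adm h(1-3)], of v w] u
            by (auto simp: c00_def)
        qed
        \<comment> \<open>An extreme block that is split would cost more than its weight. It is estimated separately by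
          \<open>t e\<close>, which takes the place of the piece that acts on this block alone.\<close>
        define R where "R = {e\<in>{a,b}. \<exists>l\<in>{1..m}. \<exists>l'\<in>{1..m}. l < l' \<and> e \<in> K l \<and> e \<in> K l'}"
        define L where "L = {l\<in>{1..m}. K l - R \<noteq> {}}"
        have fR: "finite R" unfolding R_def by simp
        have fL: "finite L" unfolding L_def by simp
        \<comment> \<open>If the first block \<open>a\<close> meets two pieces, monotonicity
          confines the earlier one to \<open>a\<close>; for \<open>b\<close> it is the later one
          that meets nothing else.\<close>
        have "\<exists>l\<in>{1..m}. K l = {e}" if e: "e \<in> R" for e
        proof -
          obtain l l' where l: "l \<in> {1..m}" "l' \<in> {1..m}" "l < l'" "e \<in> K l" "e \<in> K l'" and "e = a \<or> e = b"
            using e unfolding R_def by blast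
          then consider "e = a" | "e = b" by blast
          then show ?thesis
          proof cases
            case 1
            have "x = e" if "x \<in> K l" for x using Kord[of l l' x e] l that Kab[of l] 1 by force
            then show ?thesis using l by blast
          next
            case 2
            have "x = e" if "x \<in> K l'" for x using Kord[of l l' e x] l that Kab[of l'] 2 by force
            then show ?thesis using l by blast
          qed
        qed
        then obtain f where f: "\<And>e. e \<in> R \<Longrightarrow> f e \<in> {1..m} \<and> K (f e) = {e}" by metis
        \<comment> \<open>The pieces \<open>f e\<close> are distinct and become empty once
          \<open>R\<close> is removed, so they leave room for the additional pieces among the
          \<open>d\<close> allowed.\<close>
        have "inj_on f R" using f by (metis inj_onI singleton_inject)
        then have "card R = card (f ` R)" by (simp add: card_image)
        moreover have "card (L \<union> f ` R) = card L + card (f ` R)"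
          using f fL fR by (intro card_Un_disjoint) (auto simp: L_def)
        moreover have "card (L \<union> f ` R) \<le> card {1..m}" using f by (intro card_mono) (auto simp: L_def)
        moreover have "m \<le> d" using adm by (simp add: admissible_def)
        ultimately have card: "card L + card R \<le> d" by simp
        define u' where "u' = proj {v. \<kappa> v \<notin> R} u"
        have u': "u' \<in> c00 k" unfolding u'_def by (rule proj_c00[OF u])
        have Ku': "\<kappa> ` {v. proj (E l) u' v \<noteq> 0} = K l - R" for l
          by (auto simp: K_def u'_def proj_def split: if_splits)
        define al where "al l = Min (K l - R)" for l
        define bl where "bl l = Max (K l - R)" for l
        have fK: "finite (K l - R)" for l using finite_subset[OF Kab] by simp
        have al: "al l \<in> K l - R" and bl: "bl l \<in> K l - R"
          and albl: "\<And>x. x \<in> K l - R \<Longrightarrow> al l \<le> x \<and> x \<le> bl l" if "l \<in> L" for l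
          using that fK[of l] unfolding al_def bl_def L_def by (auto intro!: Min_in Max_in simp del: Diff_iff)
        have le: "al l \<le> bl l" if "l \<in> L" for l using albl[OF that al[OF that]] by simp
        have ord: "bl l \<le> al l'" if "l \<in> L" "l' \<in> L" "l < l'" for l l'
          using Kord[of l l' "bl l" "al l'"] bl[OF that(1)] al[OF that(2)] that by (auto simp: L_def)
        have IH: "sn j (proj (E l) u') \<le> \<Phi> (al l) (bl l) powr (1 / p)" if l: "l \<in> L" for l
        proof (rule Suc.IH[OF proj_c00[OF u'] _ le[OF l]])
          show "tn (proj {v. \<kappa> v = i} (proj (E l) u')) \<le> t i" for i
            by (rule order_trans[OF tn_dominated[OF proj_c00[OF u]] t]) (auto simp: proj_def u'_def)
          show "al l \<le> \<kappa> v \<and> \<kappa> v \<le> bl l" if "proj (E l) u' v \<noteq> 0" for v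
            using albl[OF l, of "\<kappa> v"] Ku'[of l] that by blast
        qed
        have zero: "sn j (proj (E l) u') = 0" if "l \<in> {1..m} - L" for l
        proof -
          have "{v. proj (E l) u' v \<noteq> 0} = {}" using that Ku'[of l] by (auto simp: L_def)
          then have "proj (E l) u' = (\<lambda>_. 0)" by auto
          then show ?thesis by (simp add: sn_zero)
        qed
        \<comment> \<open>All fragments of one block together cost no more than the norm of that
          block.\<close>
        have te: "\<theta> * (\<Sum>l=1..m. sn j (proj (E l) (proj {v. \<kappa> v = e} u))) \<le> t e" for e
          using sn_admissible[OF proj_c00[OF u] adm] sn_le_tn[OF proj_c00[OF u]] t order_trans by meson
        have "\<theta> * (\<Sum>l=1..m. sn j (proj (E l) u)) \<le>
            \<theta> * (\<Sum>l=1..m. sn j (proj (E l) u') + (\<Sum>e\<in>R. sn j (proj (E l) (proj {v. \<kappa> v = e} u))))"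
          unfolding u'_def using th0 by (intro mult_left_mono sum_mono sn_le_remove_blocks[OF u fR]) auto
        also have "\<dots> = \<theta> * (\<Sum>l=1..m. sn j (proj (E l) u')) +
            (\<Sum>e\<in>R. \<theta> * (\<Sum>l=1..m. sn j (proj (E l) (proj {v. \<kappa> v = e} u))))"
          by (simp add: sum.distrib distrib_left sum_distrib_left sum.swap[of _ R])
        also have "\<dots> \<le> \<theta> * (\<Sum>l\<in>L. \<Phi> (al l) (bl l) powr (1 / p)) + (\<Sum>e\<in>R. t e)"
        proof (intro add_mono mult_left_mono sum_mono te)
          have "(\<Sum>l=1..m. sn j (proj (E l) u')) = (\<Sum>l\<in>L. sn j (proj (E l) u'))"
            using zero by (intro sum.mono_neutral_right) (auto simp: L_def)
          also have "\<dots> \<le> (\<Sum>l\<in>L. \<Phi> (al l) (bl l) powr (1 / p))" by (rule sum_mono[OF IH])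
          finally show "(\<Sum>l=1..m. sn j (proj (E l) u')) \<le> (\<Sum>l\<in>L. \<Phi> (al l) (bl l) powr (1 / p))" .
        qed (use th0 in auto)
        also have "\<dots> = \<theta> * (\<Sum>x\<in>L <+> R.
            (case x of Inl l \<Rightarrow> \<Phi> (al l) (bl l) | Inr e \<Rightarrow> A * t e powr p) powr (1 / p))"
        proof -
          \<comment> \<open>This identity is the origin of \<open>A\<close>.\<close>
          have "\<theta> * (A * t e powr p) powr (1 / p) = t e" for e
          proof -
            have "\<theta> * (A * t e powr p) powr (1 / p) =
                (real d powr (1 / p - 1) * real d powr ((p - 1) / p)) * t e"
              using p t0[of e] by (simp add: A_def powr_mult powr_powr)
            also have "real d powr (1 / p - 1) * real d powr ((p - 1) / p) = 1"
              using d1 p(1) by (simp add: powr_add[symmetric] diff_divide_distrib)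
            finally show ?thesis by simp
          qed
          then show ?thesis using fL fR by (simp add: sum.Plus distrib_left sum_distrib_left)
        qed
        also have "\<dots> \<le> (\<Sum>x\<in>L <+> R. case x of Inl l \<Rightarrow> \<Phi> (al l) (bl l) | Inr e \<Rightarrow> A * t e powr p) powr (1 / p)"
          unfolding p(2)
        proof (rule powr_sum_le)
          show "finite (L <+> R)" using fL fR by simp
          show "card (L <+> R) \<le> d" using fL fR card by (simp add: card_Plus)
          fix x :: "nat + nat"
          show "0 \<le> (case x of Inl l \<Rightarrow> \<Phi> (al l) (bl l) | Inr e \<Rightarrow> A * t e powr p)"
            using A1 end_weight_nonneg[OF A1 MA] by (auto simp: \<Phi>_def intro!: sum_nonneg split: sum.split)
        qed (use p in simp)
        also have "\<dots> \<le> \<Phi> a b powr (1 / p)"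
        proof (rule powr_mono2)
          have ext: "\<Phi> (al l) (bl l) = (\<Sum>i\<in>{a..b}. end_weight A M (al l) (bl l) i * t i powr p)" if "l \<in> L" for l
            unfolding \<Phi>_def using al[OF that] bl[OF that] Kab[of l]
            by (intro sum.mono_neutral_left) (auto simp: end_weight_def)
          have "(\<Sum>e\<in>R. A * t e powr p) = (\<Sum>i\<in>{a..b}. (if i \<in> R then A else 0) * t i powr p)"
            using ab by (intro sum.mono_neutral_cong_left) (auto simp: R_def)
          then have "(\<Sum>x\<in>L <+> R. case x of Inl l \<Rightarrow> \<Phi> (al l) (bl l) | Inr e \<Rightarrow> A * t e powr p) =
              (\<Sum>i\<in>{a..b}. ((\<Sum>l\<in>L. end_weight A M (al l) (bl l) i) + (if i \<in> R then A else 0)) * t i powr p)"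
            using fL fR ext by (simp add: sum.Plus sum.swap[of _ L] distrib_right sum.distrib sum_distrib_right)
          also have "\<dots> \<le> \<Phi> a b"
            unfolding \<Phi>_def
          proof (intro sum_mono mult_right_mono)
            fix i assume i: "i \<in> {a..b}"
            let ?S = "\<Sum>l\<in>L. end_weight A M (al l) (bl l) i"
            \<comment> \<open>A removed block meets no remaining range and pays \<open>A\<close> for
              its own piece. An extreme block that was not removed meets at most one piece, as an
              end of it. For inner blocks the weight \<open>M\<close> was designed.\<close>
            consider "i \<in> R" | "i \<notin> R" "i = a \<or> i = b" | "i \<notin> R" "a < i" "i < b" using i by force
            then show "?S + (if i \<in> R then A else 0) \<le> end_weight A M a b i"
            proof cases
              case 1
              have iab: "i = a \<or> i = b" using 1 unfolding R_def by blast
              have "end_weight A M (al l) (bl l) i = 0" if l: "l \<in> L" for l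
              proof -
                have "al l \<in> {a..b}" "bl l \<in> {a..b}" "al l \<noteq> i" "bl l \<noteq> i"
                  using al[OF l] bl[OF l] Kab[of l] 1 by auto
                then show ?thesis using iab by (auto simp: end_weight_def)
              qed
              then have "?S = 0" by simp
              then show ?thesis using 1 iab ab by (auto simp: end_weight_def)
            next
              case 2
              have mem: "i \<in> K l" if l: "l \<in> L" "end_weight A M (al l) (bl l) i \<noteq> 0" for l
              proof -
                have "al l \<in> {a..b}" "bl l \<in> {a..b}" using al[OF l(1)] bl[OF l(1)] Kab[of l] by auto
                moreover have "al l \<le> i" "i \<le> bl l" using l(2) by (auto simp: end_weight_def split: if_splits)
                ultimately have "al l = i \<or> bl l = i" using 2(2) by auto
                then show ?thesis using al[OF l(1)] bl[OF l(1)] by auto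
              qed
              have "?S \<le> A"
              proof (rule sum_le_if_at_most_one_nonzero[OF fL])
                fix l assume l: "l \<in> L"
                have "al l \<in> {a..b}" "bl l \<in> {a..b}" using al[OF l] bl[OF l] Kab[of l] by auto
                then show "end_weight A M (al l) (bl l) i \<le> A"
                  using 2(2) by (intro end_weight_le_end[OF A1 MA]) auto
              next
                fix l l' assume l: "l \<in> L" "l' \<in> L" "end_weight A M (al l) (bl l) i \<noteq> 0" "end_weight A M (al l') (bl l') i \<noteq> 0"
                have "i \<in> K l" "i \<in> K l'" using mem l by auto
                moreover have "l \<in> {1..m}" "l' \<in> {1..m}" using l by (auto simp: L_def)
                ultimately have "\<not> l < l'" "\<not> l' < l" using 2 unfolding R_def by blast+
                then show "l = l'" by simp
              qed (use A1 in simp)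
              then show ?thesis using 2 ab by (auto simp: end_weight_def)
            next
              case 3
              have "?S \<le> 2 * A + d"
                unfolding M_def using card le ord by (intro sum_end_weight_le[OF fL _ A1]) auto
              then show ?thesis using 3 ab by (simp add: end_weight_def M_def)
            qed
          qed simp
          finally show "(\<Sum>x\<in>L <+> R. case x of Inl l \<Rightarrow> \<Phi> (al l) (bl l) | Inr e \<Rightarrow> A * t e powr p) \<le> \<Phi> a b" .
          show "0 \<le> (\<Sum>x\<in>L <+> R. case x of Inl l \<Rightarrow> \<Phi> (al l) (bl l) | Inr e \<Rightarrow> A * t e powr p)"
            using A1 end_weight_nonneg[OF A1 MA] by (auto simp: \<Phi>_def intro!: sum_nonneg split: sum.split)
        qed (use p in simp)
        finally show ?thesis .
      qed
    qed
  qed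
  then show ?thesis by (simp add: \<Phi>_def)
qed

lemma tn_upper_p_estimate:
  fixes \<kappa> :: "nat list \<Rightarrow> nat" and p :: real
  assumes p: "p > 1" "\<theta> = real d powr (1 / p - 1)"
    and \<kappa>: "\<And>v w. v \<prec>\<^sub>s w \<Longrightarrow> v \<in> ndseqs k \<Longrightarrow> w \<in> ndseqs k \<Longrightarrow> \<kappa> v \<le> \<kappa> w"
    and u: "u \<in> c00 k" and t: "\<And>i. tn (proj {v. \<kappa> v = i} u) \<le> t i"
    and supp: "\<And>v. u v \<noteq> 0 \<Longrightarrow> \<kappa> v < n"
  shows "tn u \<le> ((2 * real d powr (p - 1) + d) * (\<Sum>i<n. t i powr p)) powr (1 / p)"
proof -
  let ?A = "real d powr (p - 1)"
  let ?M = "2 * ?A + d"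
  have A1: "?A \<ge> 1" using d1 p(1) by (intro ge_one_powr_ge_zero) auto
  show ?thesis
  proof (cases n)
    case 0
    then have "u = (\<lambda>_. 0)" using supp by auto
    then show ?thesis using tn_l1[OF u] 0 by simp
  next
    case (Suc n')
    show ?thesis
    proof (rule tn_le[OF u])
      fix j
      have "sn j u \<le> (\<Sum>i\<in>{0..n'}. end_weight ?A ?M 0 n' i * t i powr p) powr (1 / p)"
        by (rule sn_upper_p_estimate[OF p \<kappa> u t]) (use supp Suc in \<open>auto simp: less_Suc_eq_le\<close>)
      also have "\<dots> \<le> (\<Sum>i\<in>{0..n'}. ?M * t i powr p) powr (1 / p)"
        using A1 p(1) by (intro powr_mono2 sum_mono mult_right_mono end_weight_le sum_nonneg mult_nonneg_nonneg end_weight_nonneg) auto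
      also have "(\<Sum>i\<in>{0..n'}. ?M * t i powr p) = ?M * (\<Sum>i<n. t i powr p)"
        unfolding Suc lessThan_Suc_atMost atLeast0AtMost sum_distrib_left ..
      finally show "sn j u \<le> (?M * (\<Sum>i<n. t i powr p)) powr (1 / p)" .
    qed
  qed
qed

end

section \<open>Lower \<open>p\<close>-estimate\<close>

context ellentuck_norm
begin

lemma tn_zero: "tn (\<lambda>_. 0) = 0"
  using tn_nonneg[of "\<lambda>_. 0"] tn_l1[of "\<lambda>_. 0"] by (simp add: c00_def)

definition gap :: nat where
  "gap = (SOME G. \<forall>H m. mono (H :: nat \<Rightarrow> nat) \<and> 1 \<le> m \<and> m \<le> d \<longrightarrow>
    (\<exists>v. v ` {1..m} \<in> A_fam k d \<and> (\<forall>i\<in>{1..m}. v i \<in> ndseqs k \<and> H i < last (v i) \<and> last (v i) \<le> G + H i)))"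

lemma gap:
  assumes "mono (H :: nat \<Rightarrow> nat)" "1 \<le> m" "m \<le> d"
  shows "\<exists>v. v ` {1..m} \<in> A_fam k d \<and> (\<forall>i\<in>{1..m}. v i \<in> ndseqs k \<and> H i < last (v i) \<and> last (v i) \<le> gap + H i)"
  using someI_ex[OF ex_admissible_vectors[OF k1, of d], folded gap_def] assms by simp

text \<open>Monotonicity of \<open>g\<close> makes the groups {g = l} successive. Each nonempty
  group is cut out exactly by one set from \<open>ex_AR_stem\<close>, and the gaps between the
  intervals [N i, M i] leave room for the separating vectors.\<close>

lemma tn_splitting:
  fixes N M :: "nat \<Rightarrow> nat" and g :: "nat \<Rightarrow> nat" and a :: "nat \<Rightarrow> real"
  assumes s: "sorted s" "length s < k" "\<forall>e\<in>set s. e \<le> N 0"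
    and N0: "gap < N 0" and NM: "\<And>i. N i \<le> M i" and sep: "\<And>i. M i + gap < N (Suc i)"
    and w: "\<And>i. w i \<in> c00 k"
    and supp: "\<And>i v. w i v \<noteq> 0 \<Longrightarrow> \<exists>t. v = s @ t \<and> sorted t \<and> set t \<subseteq> {N i..M i}"
    and A: "finite A" and gd: "\<And>i. i \<in> A \<Longrightarrow> g i < d"
    and gm: "\<And>i j. i \<in> A \<Longrightarrow> j \<in> A \<Longrightarrow> i \<le> j \<Longrightarrow> g i \<le> g j"
  shows "\<theta> * (\<Sum>l<d. tn (\<lambda>v. \<Sum>i\<in>{i\<in>A. g i = l}. a i * w i v)) \<le> tn (\<lambda>v. \<Sum>i\<in>A. a i * w i v)"
proof (cases "A = {}")
  case True
  then show ?thesis by (simp add: tn_zero)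
next
  case False
  define L where "L = g ` A"
  define m where "m = card L"
  have L: "finite L" "L \<noteq> {}" "L \<subseteq> {..<d}" using A False gd by (auto simp: L_def)
  have "card L \<le> card {..<d}" by (rule card_mono[OF _ L(3)]) simp
  moreover have "card L > 0" using L by (simp add: card_gt_0_iff)
  ultimately have m: "1 \<le> m" "m \<le> d" by (simp_all add: m_def)
  \<comment> \<open>Members of an admissible sequence are nonempty, so only the groups that occur
    are enumerated, in increasing order and then with indices from 1.\<close>
  obtain h where h: "bij_betw h {0..<m} L" "strict_mono_on {0..<m} h"
    by (rule ex_bij_betw_strict_mono_card[OF L(1), folded m_def, unfolded lessThan_atLeast0])
  define e where "e i = h (i - 1)" for i
  have "bij_betw (\<lambda>i. i - 1) {1..m} {0..<m}" by (rule bij_betw_byWitness[of _ Suc]) auto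
  moreover have "e = h \<circ> (\<lambda>i. i - 1)" by (simp add: e_def fun_eq_iff)
  ultimately have e: "bij_betw e {1..m} L" using bij_betw_trans[OF _ h(1)] by blast
  have e_less: "e i < e j" if "1 \<le> i" "i < j" "j \<le> m" for i j
    unfolding e_def using that by (intro strict_mono_onD[OF h(2)]) auto
  define B where "B i = {x\<in>A. g x = e i}" for i
  have B: "finite (B i)" "B i \<noteq> {}" if "1 \<le> i" "i \<le> m" for i
  proof -
    have "e i \<in> g ` A" using bij_betwE[OF e] that by (auto simp: L_def)
    then show "B i \<noteq> {}" by (auto simp: B_def)
    show "finite (B i)" using A by (simp add: B_def)
  qed
  define lo where "lo i = Min (B i)" for i
  define hi where "hi i = Max (B i)" for i
  have lo: "lo i \<in> B i" "\<And>x. x \<in> B i \<Longrightarrow> lo i \<le> x" and hi: "hi i \<in> B i" "\<And>x. x \<in> B i \<Longrightarrow> x \<le> hi i"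
    if "1 \<le> i" "i \<le> m" for i
    using B[OF that] by (auto simp: lo_def hi_def)
  have below: "x < y" if "x \<in> A" "y \<in> A" "g x < g y" for x y
    using gm[of y x] that by (cases "y \<le> x") auto
  have hilo: "hi i < lo j" if "1 \<le> i" "i < j" "j \<le> m" for i j
    using below[of "hi i" "lo j"] hi(1)[of i] lo(1)[of j] e_less[OF that] that by (auto simp: B_def)
  have "N i \<le> N (Suc i)" "M i \<le> M (Suc i)" for i
    using NM[of i] NM[of "Suc i"] sep[of i] by linarith+
  then have NN: "N i \<le> N j" and MM: "M i \<le> M j" if "i \<le> j" for i j
    using lift_Suc_mono_le[of N, OF _ that] lift_Suc_mono_le[of M, OF _ that] by blast+
  have MGN: "M i + gap < N j" if "i < j" for i j
    using sep[of i] NN[of "Suc i" j] that by simp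
  define Q where "Q i D \<longleftrightarrow> D \<in> AR k \<and> (\<forall>x\<in>D. N (lo i) \<le> last x \<and> last x \<le> M (hi i)) \<and>
      (\<forall>t. sorted t \<and> length t = k - length s \<and> set t \<subseteq> {N (lo i)..M (hi i)} \<longrightarrow> s @ t \<in> D)" for i D
  have "\<exists>D. Q i D" if i: "i \<in> {1..m}" for i
  proof -
    have i': "1 \<le> i" "i \<le> m" using i by auto
    have "\<forall>e\<in>set s. e \<le> N (lo i)" using s(3) NN[of 0 "lo i"] by auto
    moreover have "lo i \<le> hi i" using lo(2)[OF i' hi(1)[OF i']] .
    then have "N (lo i) \<le> M (hi i)" using NM MM order_trans by blast
    ultimately show ?thesis using ex_AR_stem[OF s(1,2), of "N (lo i)" "M (hi i)"] unfolding Q_def by blast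
  qed
  then obtain E where Q: "\<And>i. i \<in> {1..m} \<Longrightarrow> Q i (E i)" by metis
  have E: "E i \<in> AR k"
    and E_last: "\<And>x. x \<in> E i \<Longrightarrow> N (lo i) \<le> last x \<and> last x \<le> M (hi i)"
    and E_mem: "\<And>t. sorted t \<Longrightarrow> length t = k - length s \<Longrightarrow> set t \<subseteq> {N (lo i)..M (hi i)} \<Longrightarrow> s @ t \<in> E i"
    if "1 \<le> i" "i \<le> m" for i
    using Q[of i] that unfolding Q_def by auto
  \<comment> \<open>The largest last entry allowed before the \<open>i\<close>-th set. For the first
    set the default 0 takes over, and \<open>gap < N 0\<close> provides the room.\<close>
  define H where "H i = Max (insert 0 ((\<lambda>j. M (hi j)) ` {j\<in>{1..m}. j < i}))" for i
  have "mono H" unfolding H_def by (intro monoI Max_mono) auto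
  from gap[OF this m] obtain v where v: "v ` {1..m} \<in> A_fam k d"
    "\<And>i. i \<in> {1..m} \<Longrightarrow> v i \<in> ndseqs k \<and> H i < last (v i) \<and> last (v i) \<le> gap + H i" by blast
  have H_less: "gap + H i < N (lo i)" if "1 \<le> i" "i \<le> m" for i
  proof -
    have "H i \<in> insert 0 ((\<lambda>j. M (hi j)) ` {j\<in>{1..m}. j < i})" unfolding H_def by (rule Max_in) auto
    then show ?thesis using MGN[OF hilo] that N0 NN[of 0 "lo i"] by (auto simp: add.commute)
  qed
  have H_ge: "M (hi i) \<le> H (Suc i)" if "1 \<le> i" "i \<le> m" for i
    unfolding H_def using that by (intro Max_ge) auto
  have ne: "x \<noteq> []" if "x \<in> ndseqs k" for x using that k1 by (auto simp: ndseqs_def)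
  have adm: "admissible k d m E"
    unfolding admissible_def
  proof (intro conjI m exI[of _ v] v(1) ballI)
    fix i assume i: "i \<in> {1..m}"
    then have Ei: "E i \<in> AR k" using E by simp
    then show "E i \<in> AR k" .
    have mn: "prec_min (E i) \<in> E i" using prec_min[OF AR_props(1,2)[OF Ei]] by simp
    then have "last (v i) < last (prec_min (E i))"
      using E_last[of i "prec_min (E i)"] H_less[of i] v(2)[OF i] i by simp
    moreover have "v i \<noteq> []" "prec_min (E i) \<noteq> []"
      using ne v(2)[OF i] mn AR_props(3)[OF Ei] by auto
    ultimately show "set_le {v i} (E i)" by (simp add: set_le_def preceq_def last_less_prec)
  next
    fix i assume i: "i \<in> {1..<m}"
    then have Ei: "E i \<in> AR k" using E by simp
    have mx: "prec_max (E i) \<in> E i" using prec_max[OF AR_props(1,2)[OF Ei]] by simp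
    then have "last (prec_max (E i)) < last (v (Suc i))"
      using E_last[of i "prec_max (E i)"] H_ge[of i] v(2)[of "Suc i"] i by simp
    moreover have "v (Suc i) \<noteq> []" "prec_max (E i) \<noteq> []"
      using ne v(2)[of "Suc i"] i mx AR_props(3)[OF Ei] by auto
    ultimately show "set_less (E i) {v (Suc i)}" by (simp add: set_less_def last_less_prec)
  qed
  \<comment> \<open>Other groups are excluded by their last entries, which lie outside the range of
    \<open>E i\<close>; the vectors of the group itself are contained in \<open>E i\<close> because
    of their common stem \<open>s\<close>.\<close>
  have proj: "proj (E i) (\<lambda>v. \<Sum>x\<in>A. a x * w x v) = (\<lambda>v. \<Sum>x\<in>B i. a x * w x v)"
    if i: "1 \<le> i" "i \<le> m" for i
  proof
    fix v
    have zero: "w x v = 0" if x: "x \<in> A" "x \<notin> B i" and v: "v \<in> E i" for x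
    proof (rule ccontr)
      assume nz: "w x v \<noteq> 0"
      then obtain t where t: "v = s @ t" "set t \<subseteq> {N x..M x}" using supp by blast
      have "v \<in> ndseqs k" using nz w[of x] by (auto simp: c00_def)
      then have "t \<noteq> []" using t(1) s(2) by (auto simp: ndseqs_def)
      then have last: "last v \<in> {N x..M x}" using t last_in_set[of t] by (auto simp del: last_in_set)
      have "g x < e i \<or> e i < g x" using x by (auto simp: B_def)
      then have "x < lo i \<or> hi i < x"
        using below[of x "lo i"] below[of "hi i" x] x lo(1)[OF i] hi(1)[OF i] by (auto simp: B_def)
      then show False using MGN[of x "lo i"] MGN[of "hi i" x] last E_last[OF i v] by auto
    qed
    have zero': "w x v = 0" if x: "x \<in> B i" and v: "v \<notin> E i" for x
    proof (rule ccontr)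
      assume nz: "w x v \<noteq> 0"
      then obtain t where t: "v = s @ t" "sorted t" "set t \<subseteq> {N x..M x}" using supp by blast
      have "v \<in> ndseqs k" using nz w[of x] by (auto simp: c00_def)
      then have "length t = k - length s" using t(1) by (auto simp: ndseqs_def)
      moreover have "set t \<subseteq> {N (lo i)..M (hi i)}"
        using t(3) NN[OF lo(2)[OF i x]] MM[OF hi(2)[OF i x]] by fastforce
      ultimately have "v \<in> E i" using E_mem[OF i t(2)] t(1) by simp
      then show False using v by simp
    qed
    show "proj (E i) (\<lambda>v. \<Sum>x\<in>A. a x * w x v) v = (\<Sum>x\<in>B i. a x * w x v)"
    proof (cases "v \<in> E i")
      case True
      have "(\<Sum>x\<in>A. a x * w x v) = (\<Sum>x\<in>B i. a x * w x v)"
        using A zero True by (intro sum.mono_neutral_right) (auto simp: B_def)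
      then show ?thesis using True by (simp add: proj_def)
    next
      case False
      have "(\<Sum>x\<in>B i. a x * w x v) = 0" by (rule sum.neutral) (use zero' False in simp)
      then show ?thesis using False by (simp add: proj_def)
    qed
  qed
  let ?F = "\<lambda>l. tn (\<lambda>v. \<Sum>i\<in>{i\<in>A. g i = l}. a i * w i v)"
  have "?F l = 0" if "l \<in> {..<d} - L" for l
  proof -
    have none: "{i\<in>A. g i = l} = {}" using that by (auto simp: L_def)
    show ?thesis unfolding none by (simp add: tn_zero)
  qed
  then have "(\<Sum>l<d. ?F l) = (\<Sum>l\<in>L. ?F l)" using L(3) by (intro sum.mono_neutral_right) auto
  also have "\<dots> = (\<Sum>i\<in>{1..m}. ?F (e i))" by (rule sum.reindex_bij_betw[OF e, symmetric])
  also have "\<dots> = (\<Sum>i\<in>{1..m}. tn (proj (E i) (\<lambda>v. \<Sum>x\<in>A. a x * w x v)))"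
    by (rule sum.cong) (simp_all add: proj B_def)
  finally show ?thesis using tn_admissible[OF c00_sum[OF A w] adm] by simp
qed

lemma tn_lower_p_estimate:
  fixes p :: real and N M :: "nat \<Rightarrow> nat" and a :: "nat \<Rightarrow> real"
  assumes p: "p > 1" "\<theta> = real d powr (1 / p - 1)" and d2: "d \<ge> 2"
    and s: "sorted s" "length s < k" "\<forall>e\<in>set s. e \<le> N 0"
    and N0: "gap < N 0" and NM: "\<And>i. N i \<le> M i" and sep: "\<And>i. M i + gap < N (Suc i)"
    and w: "\<And>i. w i \<in> c00 k" "\<And>i. \<eta> \<le> tn (w i)"
    and supp: "\<And>i v. w i v \<noteq> 0 \<Longrightarrow> \<exists>t. v = s @ t \<and> sorted t \<and> set t \<subseteq> {N i..M i}"
    and \<eta>: "\<eta> > 0" and S: "finite S"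
  shows "(2 * real d) powr (1 / p - 1) * (\<eta> * (\<Sum>i\<in>S. \<bar>a i\<bar> powr p) powr (1 / p))
    \<le> tn (\<lambda>v. \<Sum>i\<in>S. a i * w i v)"
proof -
  \<comment> \<open>Zero coefficients would give intervals of length zero, for which the recursion
    does not end.\<close>
  define S' where "S' = {i\<in>S. a i \<noteq> 0}"
  have S': "finite S'" using S by (simp add: S'_def)
  let ?F = "\<lambda>A. tn (\<lambda>v. \<Sum>i\<in>A. a i * w i v)"
  have "(2 * real d) powr (1 / p - 1) * (\<Sum>i\<in>S'. \<bar>\<eta> * a i\<bar> powr p) powr (1 / p) \<le> ?F S'"
  proof (rule lower_bound_of_splitting[OF p(1) d2 S'])
    show "\<bar>\<eta> * a i\<bar> \<le> ?F {i}" if "i \<in> S'" for i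
      using tn_scale[OF w(1)[of i], of "a i"] w(2)[of i] \<eta> mult_right_mono[of \<eta> "tn (w i)" "\<bar>a i\<bar>"]
      by (simp add: abs_mult mult.commute)
    show "0 \<le> ?F {}" by (simp add: tn_zero)
    show "real d powr (1 / p - 1) * (\<Sum>l<d. ?F {i\<in>A. g i = l}) \<le> ?F A"
      if A: "A \<subseteq> S'" "\<And>i. i \<in> A \<Longrightarrow> g i < d" "\<And>i j. i \<in> A \<Longrightarrow> j \<in> A \<Longrightarrow> i \<le> j \<Longrightarrow> g i \<le> g j" for A g
      unfolding p(2)[symmetric]
    proof (rule tn_splitting[where s = s and N = N and M = M])
      show "finite A" by (rule finite_subset[OF A(1) S'])
    qed (use s N0 NM sep w(1) supp A(2,3) in auto)
    show "\<eta> * a i \<noteq> 0" if "i \<in> S'" for i using that \<eta> by (simp add: S'_def)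
  qed
  moreover have "(\<Sum>i\<in>S'. \<bar>\<eta> * a i\<bar> powr p) = \<eta> powr p * (\<Sum>i\<in>S. \<bar>a i\<bar> powr p)"
    unfolding sum_distrib_left using S \<eta>
    by (intro sum.mono_neutral_cong_left) (auto simp: S'_def abs_mult powr_mult)
  moreover have "(\<lambda>v. \<Sum>i\<in>S'. a i * w i v) = (\<lambda>v. \<Sum>i\<in>S. a i * w i v)"
    using S by (intro ext sum.mono_neutral_left) (auto simp: S'_def)
  ultimately show ?thesis using \<eta> p(1) by (simp add: powr_mult powr_powr sum_nonneg)
qed

section \<open>Block sequences\<close>

text \<open>Blocks are separated by last entries, and \<prec> never decreases the last entry. So the
  block number \<kappa> is monotone, as the upper estimate requires.\<close>

lemma tn_block_upper_p_estimate:
  fixes b :: "nat \<Rightarrow> nat" and u :: "nat \<Rightarrow> nat list \<Rightarrow> real" and a :: "nat \<Rightarrow> real" and p :: real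
  assumes p: "p > 1" "\<theta> = real d powr (1 / p - 1)"
    and b: "strict_mono b" and u: "\<And>i. u i \<in> c00 k" and u1: "\<And>i. tn (u i) \<le> K"
    and supp: "\<And>i v. u i v \<noteq> 0 \<Longrightarrow> last v \<le> b i" "\<And>i v. u (Suc i) v \<noteq> 0 \<Longrightarrow> b i < last v"
  shows "tn (\<lambda>v. \<Sum>i<n. a i * u i v) \<le>
    (2 * real d powr (p - 1) + d) powr (1 / p) * (K * (\<Sum>i<n. \<bar>a i\<bar> powr p) powr (1 / p))"
proof -
  define \<kappa> where "\<kappa> v = (LEAST i. last v \<le> b i)" for v :: "nat list"
  have ex: "last v \<le> b (\<kappa> v)" for v :: "nat list"
    unfolding \<kappa>_def by (rule LeastI[of _ "last v"]) (use strict_mono_imp_increasing[OF b] in blast)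
  have least: "\<kappa> v \<le> i" if "last v \<le> b i" for v :: "nat list" and i
    unfolding \<kappa>_def using that by (rule Least_le)
  have \<kappa>u: "\<kappa> v = i" if v: "u i v \<noteq> 0" for i v
  proof (rule antisym)
    show "\<kappa> v \<le> i" using supp(1)[OF v] by (rule least)
    show "i \<le> \<kappa> v"
    proof (cases i)
      case (Suc j)
      then have "b j < b (\<kappa> v)" using supp(2)[of j v] v ex[of v] by simp
      then show ?thesis using Suc strict_mono_less[OF b] by simp
    qed simp
  qed
  have mono: "\<kappa> v \<le> \<kappa> w" if "v \<prec>\<^sub>s w" "v \<in> ndseqs k" for v w
  proof -
    have "v \<noteq> []" using that(2) k1 by (auto simp: ndseqs_def)
    then have "last v \<le> last w" using that(1) by (auto simp: prec_def)
    then show ?thesis using ex[of w] by (intro least) simp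
  qed
  have K: "K \<ge> 0" using tn_nonneg[OF u] u1 order_trans by blast
  let ?x = "\<lambda>v. \<Sum>i<n. a i * u i v"
  have x: "?x \<in> c00 k" by (intro c00_sum u) simp
  have xv: "?x v = (if \<kappa> v < n then a (\<kappa> v) * u (\<kappa> v) v else 0)" for v
  proof -
    have "?x v = (\<Sum>i<n. if i = \<kappa> v then a (\<kappa> v) * u (\<kappa> v) v else 0)"
      using \<kappa>u by (intro sum.cong) auto
    then show ?thesis by simp
  qed
  have "tn ?x \<le> ((2 * real d powr (p - 1) + d) * (\<Sum>i<n. (\<bar>a i\<bar> * K) powr p)) powr (1 / p)"
  proof (rule tn_upper_p_estimate[OF p mono x])
    fix i
    have "tn (proj {v. \<kappa> v = i} ?x) \<le> tn (\<lambda>v. a i * u i v)"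
      by (rule tn_dominated[OF c00_scale[OF u]]) (auto simp: proj_def xv)
    also have "\<dots> \<le> \<bar>a i\<bar> * K" unfolding tn_scale[OF u] using u1 by (intro mult_left_mono) auto
    finally show "tn (proj {v. \<kappa> v = i} ?x) \<le> \<bar>a i\<bar> * K" .
  next
    show "\<kappa> v < n" if "?x v \<noteq> 0" for v using that xv[of v] by (auto split: if_splits)
  qed
  also have "(\<Sum>i<n. (\<bar>a i\<bar> * K) powr p) = (\<Sum>i<n. \<bar>a i\<bar> powr p) * K powr p"
    using K by (simp add: powr_mult sum_distrib_right)
  finally show ?thesis using K p(1) by (simp add: powr_mult powr_powr sum_nonneg mult_ac)
qed

section \<open>Concentration of a block sequence in a cone\<close>

definition cone :: "nat list \<Rightarrow> nat list set" where
  "cone s = {v. prefix s v}"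

lemma tn_remove_cones:
  fixes m :: nat
  assumes u: "u \<in> c00 k"
  shows "tn (proj D u) \<le> tn (proj (D - (\<Union>n<m. C n)) u) + (\<Sum>n<m. tn (proj (C n) u))"
proof (induction m)
  case (Suc m)
  let ?D = "\<lambda>m. D - (\<Union>n<m. C n)"
  have "proj (?D m) u = (\<lambda>v. proj (?D (Suc m)) u v + proj (?D m \<inter> C m) u v)"
    by (auto simp: proj_def less_Suc_eq fun_eq_iff)
  then have "tn (proj (?D m) u) \<le> tn (proj (?D (Suc m)) u) + tn (proj (?D m \<inter> C m) u)"
    using tn_triangle[OF proj_c00[OF u] proj_c00[OF u]] by simp
  moreover have "tn (proj (?D m \<inter> C m) u) \<le> tn (proj (C m) u)"
    by (rule tn_dominated[OF proj_c00[OF u]]) (auto simp: proj_def)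
  ultimately show ?case using Suc.IH by simp
qed simp

text \<open>Otherwise \<open>s\<close> could be prolonged up to length \<open>k\<close>, refining
  the infinite index set at each entry. A cone of length \<open>k\<close> contains only one basis
  vector, which disjoint supports allow for at most one index.\<close>

lemma ex_maximal_cone:
  fixes u :: "nat \<Rightarrow> nat list \<Rightarrow> real"
  assumes u: "\<And>i. u i \<in> c00 k" and \<delta>0: "\<delta>0 > 0" "\<And>i. \<delta>0 \<le> tn (u i)"
    and disj: "\<And>i j v. u i v \<noteq> 0 \<Longrightarrow> u j v \<noteq> 0 \<Longrightarrow> i = j"
  shows "\<exists>s \<delta> I. sorted s \<and> length s < k \<and> \<delta> > 0 \<and> infinite I \<and>
    (\<forall>i\<in>I. \<delta> \<le> tn (proj (cone s) (u i))) \<and>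
    (\<forall>n. \<forall>\<epsilon>>0. finite {i\<in>I. \<epsilon> \<le> tn (proj (cone (s @ [n])) (u i))})"
proof (rule ccontr)
  assume none: "\<not> ?thesis"
  define large where "large s \<delta> I \<longleftrightarrow> \<delta> > 0 \<and> infinite I \<and> (\<forall>i\<in>I. \<delta> \<le> tn (proj (cone s) (u i)))"
    for s \<delta> and I :: "nat set"
  have ex: "\<exists>v\<in>ndseqs k. prefix s v \<and> u i v \<noteq> 0" if "large s \<delta> I" "i \<in> I" for s \<delta> I i
  proof (rule ccontr)
    assume h: "\<not> ?thesis"
    have "proj (cone s) (u i) v = 0" for v
      using u[of i] h by (cases "v \<in> ndseqs k") (auto simp: proj_def cone_def c00_def)
    then have "proj (cone s) (u i) = (\<lambda>_. 0)" by blast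
    then show False using that by (auto simp: large_def tn_zero)
  qed
  have "\<exists>s \<delta> I. length s = l \<and> large s \<delta> I" if "l \<le> k" for l
    using that
  proof (induction l)
    case 0
    have "proj (cone []) (u i) = u i" for i by (simp add: proj_def cone_def)
    then have "large [] \<delta>0 UNIV" using \<delta>0 by (simp add: large_def)
    then show ?case by (intro exI[of _ "[]"]) auto
  next
    case (Suc l)
    then obtain s \<delta> I where s: "length s = l" "large s \<delta> I" by auto
    obtain i where "i \<in> I" using s(2) by (metis large_def finite.emptyI ex_in_conv)
    then obtain v where "v \<in> ndseqs k" "prefix s v" using ex[OF s(2)] by blast
    \<comment> \<open>The cone carries a nonzero part of some \<open>u i\<close>, so
      \<open>s\<close> begins a non-decreasing sequence.\<close>
    then have "sorted s" by (auto simp: ndseqs_def prefix_def sorted_append)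
    moreover have "length s < k" "\<delta> > 0" "infinite I" "\<forall>i\<in>I. \<delta> \<le> tn (proj (cone s) (u i))"
      using s Suc.prems by (auto simp: large_def)
    ultimately obtain n \<epsilon> where "\<epsilon> > 0" "infinite {i\<in>I. \<epsilon> \<le> tn (proj (cone (s @ [n])) (u i))}"
      using none by blast
    then have "large (s @ [n]) \<epsilon> {i\<in>I. \<epsilon> \<le> tn (proj (cone (s @ [n])) (u i))}" by (simp add: large_def)
    moreover have "length (s @ [n]) = Suc l" using s(1) by simp
    ultimately show ?case by blast
  qed
  from this[OF order_refl] obtain s \<delta> I where s: "length s = k" "large s \<delta> I" by blast
  have nz: "u i s \<noteq> 0" if i: "i \<in> I" for i
  proof -
    obtain v where "v \<in> ndseqs k" "prefix s v" "u i v \<noteq> 0" using ex[OF s(2) i] by blast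
    then show ?thesis using s(1) by (auto simp: ndseqs_def prefix_def)
  qed
  then have "I \<subseteq> {i}" if "i \<in> I" for i using disj that by blast
  moreover have "I \<noteq> {}" using s(2) by (auto simp: large_def)
  ultimately have "finite I" by (metis ex_in_conv finite.emptyI finite_insert finite_subset)
  then show False using s(2) by (simp add: large_def)
qed

text \<open>Removing the cones bounds the entry right after \<open>s\<close> from below, and
  sortedness passes this on to all later entries.\<close>

lemma cone_tail_entries:
  assumes v: "v \<in> ndseqs k" "v \<in> cone s - (\<Union>n<N. cone (s @ [n]))" and s: "length s < k"
    and M: "last v \<le> M"
  shows "\<exists>t. v = s @ t \<and> sorted t \<and> set t \<subseteq> {N..M}"
proof -
  obtain t where t: "v = s @ t" using v(2) by (auto simp: cone_def prefix_def)
  have st: "sorted t" and "t \<noteq> []" using v(1) t s by (auto simp: ndseqs_def sorted_append)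
  then obtain n r where n: "t = n # r" by (cases t) auto
  then have "v \<in> cone (s @ [n])" using t by (simp add: cone_def)
  then have Nn: "N \<le> n" using v(2) by (auto simp: not_less[symmetric])
  have le_last: "x \<le> last t" if "x \<in> set t" for x
  proof -
    obtain xs y where "t = xs @ [y]" using \<open>t \<noteq> []\<close> by (cases t rule: rev_cases) auto
    then show ?thesis using st that by (auto simp: sorted_append)
  qed
  have "last t = last v" using t \<open>t \<noteq> []\<close> by simp
  moreover have "n \<le> x" if "x \<in> set t" for x using st that unfolding n by auto
  ultimately have "set t \<subseteq> {N..M}" using M Nn le_last by fastforce
  then show ?thesis using t st by blast
qed

text \<open>In each step \<open>N j\<close> comes first, beyond the preceding block, and the index
  \<open>r j\<close> second: only finitely many cones lie below \<open>N j\<close>, and on each of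
  them the projections tend to zero along \<open>I\<close>.\<close>

lemma ex_sparse_subsequence:
  fixes u :: "nat \<Rightarrow> nat list \<Rightarrow> real" and b :: "nat \<Rightarrow> nat" and c :: real
  assumes b: "strict_mono b" and \<delta>: "\<delta> > 0" and I: "infinite I"
    and small: "\<And>n \<epsilon>. \<epsilon> > 0 \<Longrightarrow> finite {i\<in>I. \<epsilon> \<le> tn (proj (cone (s @ [n])) (u i))}"
    and c: "c > 0"
  shows "\<exists>r N. strict_mono r \<and> (\<forall>j::nat. r j \<in> I \<and> G < N j \<and> N j \<le> b (r j) \<and> b (r j) + G < N (Suc j) \<and>
    (\<Sum>n<N j. tn (proj (cone (s @ [n])) (u (r j)))) \<le> \<delta> \<and> (1/2) ^ r j \<le> c * (1/2) ^ j)"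
proof -
  define P where "P j x \<longleftrightarrow> fst x \<in> I \<and> G < snd x \<and> snd x \<le> b (fst x) \<and>
    (\<Sum>n<snd x. tn (proj (cone (s @ [n])) (u (fst x)))) \<le> \<delta> \<and> (1/2) ^ fst x \<le> c * (1/2) ^ j"
    for j :: nat and x :: "nat \<times> nat"
  have ex: "\<exists>i>l. P j (i, N)" if N: "G < N" for N j l
  proof -
    \<comment> \<open>The allowance \<delta> is shared equally among the \<open>N\<close>
      cones.\<close>
    let ?bad = "\<Union>n<N. {i\<in>I. \<delta> / N \<le> tn (proj (cone (s @ [n])) (u i))}"
    have "c * (1/2) ^ j > 0" using c by simp
    then obtain q where q: "(1/2) ^ q < c * (1/2) ^ j" using real_arch_pow_inv[of "c * (1/2) ^ j" "1/2"] by auto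
    have fin: "finite ({..l} \<union> {..N} \<union> {..q} \<union> ?bad)" using small \<delta> N by auto
    have "\<not> I \<subseteq> {..l} \<union> {..N} \<union> {..q} \<union> ?bad" using I finite_subset[OF _ fin] by blast
    then obtain i where i: "i \<in> I" "i > l" "i > N" "i > q" "i \<notin> ?bad" by force
    have "(\<Sum>n<N. tn (proj (cone (s @ [n])) (u i))) \<le> (\<Sum>n<N. \<delta> / N)"
      using i(1,5) by (intro sum_mono) force
    then have "(\<Sum>n<N. tn (proj (cone (s @ [n])) (u i))) \<le> \<delta>" using N by simp
    moreover have "(1/2::real) ^ i \<le> (1/2) ^ q" using i(4) by (intro power_decreasing) auto
    then have "(1/2::real) ^ i \<le> c * (1/2) ^ j" using q by linarith
    moreover have "N \<le> b i" using i(3) strict_mono_imp_increasing[OF b, of i] by linarith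
    ultimately show ?thesis using i(1,2) N unfolding P_def by (intro exI[of _ i]) auto
  qed
  have "\<exists>f. \<forall>j. P j (f j) \<and> (fst (f j) < fst (f (Suc j)) \<and> b (fst (f j)) + G < snd (f (Suc j)))"
  proof (rule dependent_nat_choice)
    show "\<exists>x. P 0 x" using ex[of "Suc G" 0 0] by auto
    fix x j assume "P j x"
    show "\<exists>y. P (Suc j) y \<and> (fst x < fst y \<and> b (fst x) + G < snd y)"
      using ex[of "Suc (b (fst x) + G)" "fst x" "Suc j"] by force
  qed
  then obtain f where f: "\<And>j. P j (f j)" "\<And>j. fst (f j) < fst (f (Suc j)) \<and> b (fst (f j)) + G < snd (f (Suc j))" by blast
  have "strict_mono (\<lambda>j. fst (f j))" using f(2) by (simp add: strict_mono_Suc_iff)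
  then show ?thesis using f unfolding P_def
    by (intro exI[of _ "\<lambda>j. fst (f j)"] exI[of _ "\<lambda>j. snd (f j)"]) auto
qed

section \<open>The completion\<close>

text \<open>Points of the completion are not functions, but coordinates are bounded by the norm and
  hence extend to \<open>T\<close>. The inequality determines \<open>g\<close> on \<open>T\<close>,
  and its linearity follows by approximation.\<close>

lemma ex_coordinate_functional:
  assumes comp: "is_completion (c00 k) tn J T"
  shows "\<exists>g. \<forall>y\<in>T. \<forall>x\<in>c00 k. \<bar>x v - g y\<bar> \<le> norm (J x - y)"
proof -
  have J: "linear_map_on (c00 k) J" "\<And>x. x \<in> c00 k \<Longrightarrow> norm (J x) = tn x" "closure (J ` c00 k) = T"
    using comp by (auto simp: is_completion_def)
  have coord: "\<bar>x v - x' v\<bar> \<le> norm (J x - J x')" if "x \<in> c00 k" "x' \<in> c00 k" for x x'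
  proof -
    have x': "(\<lambda>v. -1 * x' v) \<in> c00 k" by (rule c00_scale[OF that(2)])
    have "J (\<lambda>v. x v + -1 * x' v) = J x + (-1) *\<^sub>R J x'"
      using J(1) that x' unfolding linear_map_on_def by metis
    then have "norm (J x - J x') = tn (\<lambda>v. x v + -1 * x' v)"
      using J(2)[OF c00_add[OF that(1) x']] by simp
    then show ?thesis using coord_le_tn[OF c00_add[OF that(1) x'], of v] by simp
  qed
  have "\<exists>c. \<forall>x\<in>c00 k. \<bar>x v - c\<bar> \<le> norm (J x - y)" if y: "y \<in> T" for y
  proof -
    obtain z where z: "\<And>n::nat. z n \<in> J ` c00 k" "z \<longlonglongrightarrow> y"
      using y unfolding J(3)[symmetric] closure_sequential by blast
    have "\<forall>n. \<exists>x. x \<in> c00 k \<and> z n = J x" using z(1) by blast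
    then obtain X where X: "\<And>n. X n \<in> c00 k" "\<And>n. z n = J (X n)" by metis
    have "Cauchy (\<lambda>n. X n v)"
    proof (rule metric_CauchyI)
      fix e :: real assume "e > 0"
      then obtain M where M: "\<And>m n. m \<ge> M \<Longrightarrow> n \<ge> M \<Longrightarrow> dist (z m) (z n) < e"
        using metric_CauchyD[OF LIMSEQ_imp_Cauchy[OF z(2)]] by blast
      have "dist (X m v) (X n v) < e" if "m \<ge> M" "n \<ge> M" for m n
        using coord[OF X(1)[of m] X(1)[of n]] M[OF that] X(2) by (simp add: dist_norm)
      then show "\<exists>M. \<forall>m\<ge>M. \<forall>n\<ge>M. dist (X m v) (X n v) < e" by blast
    qed
    then obtain c where c: "(\<lambda>n. X n v) \<longlonglongrightarrow> c" using convergent_eq_Cauchy by blast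
    have "\<bar>x v - c\<bar> \<le> norm (J x - y)" if x: "x \<in> c00 k" for x
    proof (rule LIMSEQ_le)
      show "(\<lambda>n. \<bar>x v - X n v\<bar>) \<longlonglongrightarrow> \<bar>x v - c\<bar>" by (intro tendsto_intros c)
      show "(\<lambda>n. norm (J x - z n)) \<longlonglongrightarrow> norm (J x - y)" by (intro tendsto_intros z(2))
      show "\<exists>N. \<forall>n\<ge>N. \<bar>x v - X n v\<bar> \<le> norm (J x - z n)" using coord[OF x X(1)] X(2) by auto
    qed
    then show ?thesis by blast
  qed
  then show ?thesis by metis
qed

text \<open>The kernel and one vector outside it span \<open>Y\<close>, so the kernel cannot have
  finite dimension.\<close>

lemma infinite_dimensional_kernel:
  fixes g :: "'c::real_vector \<Rightarrow> real"
  assumes Y: "subspace Y" "infinite_dimensional Y"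
    and add: "\<And>x y. x \<in> Y \<Longrightarrow> y \<in> Y \<Longrightarrow> g (x + y) = g x + g y"
    and scale: "\<And>t x. x \<in> Y \<Longrightarrow> g (t *\<^sub>R x) = t * g x"
  shows "subspace {y\<in>Y. g y = 0} \<and> infinite_dimensional {y\<in>Y. g y = 0}"
proof
  let ?K = "{y\<in>Y. g y = 0}"
  have "g 0 = 0" using scale[of 0 0] subspace_0[OF Y(1)] by simp
  then show "subspace ?K"
    using Y(1) add scale by (auto simp: subspace_def)
  show "infinite_dimensional ?K"
  proof (cases "\<exists>y0\<in>Y. g y0 \<noteq> 0")
    case False
    then have "?K = Y" by blast
    then show ?thesis using Y(2) by simp
  next
    case True
    then obtain y0 where y0: "y0 \<in> Y" "g y0 \<noteq> 0" by blast
    show ?thesis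
      unfolding infinite_dimensional_def
    proof
      assume "\<exists>B. finite B \<and> ?K \<subseteq> span B"
      then obtain B where B: "finite B" "?K \<subseteq> span B" by blast
      have "y \<in> span (insert y0 B)" if y: "y \<in> Y" for y
      proof -
        let ?t = "g y / g y0"
        have m: "(- ?t) *\<^sub>R y0 \<in> Y" using y0(1) Y(1) by (rule subspace_scale[rotated])
        have "g (y + (- ?t) *\<^sub>R y0) = 0" using add[OF y m] scale[OF y0(1), of "- ?t"] y0(2) by simp
        moreover have "y + (- ?t) *\<^sub>R y0 \<in> Y" by (rule subspace_add[OF Y(1) y m])
        ultimately have "y + (- ?t) *\<^sub>R y0 \<in> span (insert y0 B)" using B(2) span_mono[of B "insert y0 B"] by blast
        moreover have "?t *\<^sub>R y0 \<in> span (insert y0 B)" by (intro span_scale span_base) simp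
        ultimately have "(y + (- ?t) *\<^sub>R y0) + ?t *\<^sub>R y0 \<in> span (insert y0 B)" by (rule span_add)
        then show ?thesis by simp
      qed
      then show False using Y(2) B(1) unfolding infinite_dimensional_def by (metis finite_insert subsetI)
    qed
  qed
qed

text \<open>Only finitely many \<open>v\<close> in \<open>ndseqs k\<close> have
  \<open>last v\<close> at most \<open>B\<close>, so their coordinates vanish together on an
  infinite dimensional subspace of \<open>Y\<close>. For a unit vector there, a finitely supported
  approximation is small at these \<open>v\<close>, and its values there can be deleted.\<close>

lemma ex_near_block:
  fixes J :: "(nat list \<Rightarrow> real) \<Rightarrow> 'b::banach" and B :: nat
  assumes comp: "is_completion (c00 k) tn J T"
    and Y: "Y \<subseteq> T" "subspace Y" "infinite_dimensional Y" and \<epsilon>: "\<epsilon> > 0"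
  shows "\<exists>y\<in>Y. norm y = 1 \<and> (\<exists>x\<in>c00 k. norm (J x - y) < \<epsilon> \<and> (\<forall>v. x v \<noteq> 0 \<longrightarrow> B < last v))"
proof -
  have J_add: "J (\<lambda>v. x v + x' v) = J x + J x'" if "x \<in> c00 k" "x' \<in> c00 k" for x x'
    using comp that by (simp add: is_completion_def linear_map_on_def)
  have J_scale: "J (\<lambda>v. t * x v) = t *\<^sub>R J x" if "x \<in> c00 k" for t x
    using comp that by (simp add: is_completion_def linear_map_on_def)
  have J_norm: "norm (J x) = tn x" if "x \<in> c00 k" for x
    using comp that by (simp add: is_completion_def)
  have approx: "\<exists>x\<in>c00 k. norm (J x - y) < e" if "y \<in> T" "e > 0" for y and e :: real
    using comp that by (auto simp: is_completion_def closure_approachable dist_norm)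
  obtain g where g: "\<And>v y x. y \<in> T \<Longrightarrow> x \<in> c00 k \<Longrightarrow> \<bar>x v - g v y\<bar> \<le> norm (J x - y)"
    using ex_coordinate_functional[OF comp] by metis
  have g_add: "g v (y + z) = g v y + g v z" if y: "y \<in> Y" and z: "z \<in> Y" for v y z
  proof -
    have yz: "y \<in> T" "z \<in> T" "y + z \<in> T" using that Y subspace_add by blast+
    have "\<bar>g v (y + z) - (g v y + g v z)\<bar> \<le> 0 + e" if e: "e > 0" for e
    proof -
      obtain x x' where x: "x \<in> c00 k" "norm (J x - y) < e / 4" and x': "x' \<in> c00 k" "norm (J x' - z) < e / 4"
        using approx[OF yz(1), of "e / 4"] approx[OF yz(2), of "e / 4"] e by auto
      have "norm (J (\<lambda>v. x v + x' v) - (y + z)) \<le> norm (J x - y) + norm (J x' - z)"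
        unfolding J_add[OF x(1) x'(1)] by (metis add_diff_add norm_triangle_ineq)
      then show ?thesis
        using g[OF yz(3) c00_add[OF x(1) x'(1)], of v] g[OF yz(1) x(1), of v] g[OF yz(2) x'(1), of v] x(2) x'(2)
        by linarith
    qed
    then have "\<bar>g v (y + z) - (g v y + g v z)\<bar> \<le> 0" by (rule field_le_epsilon)
    then show ?thesis by simp
  qed
  have g_scale: "g v (t *\<^sub>R y) = t * g v y" if y: "y \<in> Y" for v y t
  proof -
    have ty: "y \<in> T" "t *\<^sub>R y \<in> T" using that Y subspace_scale by blast+
    have "\<bar>g v (t *\<^sub>R y) - t * g v y\<bar> \<le> 0 + e" if e: "e > 0" for e
    proof -
      obtain x where x: "x \<in> c00 k" "norm (J x - y) < e / (2 * (\<bar>t\<bar> + 1))"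
        using approx[OF ty(1), of "e / (2 * (\<bar>t\<bar> + 1))"] e by auto
      have "norm (J (\<lambda>v. t * x v) - t *\<^sub>R y) = \<bar>t\<bar> * norm (J x - y)"
        unfolding J_scale[OF x(1)] by (simp flip: scaleR_diff_right)
      then have "\<bar>t * x v - g v (t *\<^sub>R y)\<bar> \<le> \<bar>t\<bar> * norm (J x - y)"
        using g[OF ty(2) c00_scale[OF x(1)], of t v] by simp
      moreover have "\<bar>t * x v - t * g v y\<bar> \<le> \<bar>t\<bar> * norm (J x - y)"
        using mult_left_mono[OF g[OF ty(1) x(1), of v], of "\<bar>t\<bar>"] by (simp add: abs_mult flip: right_diff_distrib)
      moreover have "\<bar>t\<bar> * norm (J x - y) \<le> (\<bar>t\<bar> + 1) * (e / (2 * (\<bar>t\<bar> + 1)))"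
        using x(2) by (intro mult_mono) auto
      moreover have "(\<bar>t\<bar> + 1) * (e / (2 * (\<bar>t\<bar> + 1))) = e / 2"
      proof -
        have "q * (e / (2 * q)) = e / 2" if "q \<noteq> 0" for q using that by simp
        moreover have "\<bar>t\<bar> + 1 \<noteq> 0" by linarith
        ultimately show ?thesis by blast
      qed
      ultimately show ?thesis by linarith
    qed
    then have "\<bar>g v (t *\<^sub>R y) - t * g v y\<bar> \<le> 0" by (rule field_le_epsilon)
    then show ?thesis by simp
  qed
  define F where "F = {v\<in>ndseqs k. last v \<le> B}"
  have F: "finite F"
  proof (rule finite_subset)
    have "v \<noteq> []" if "v \<in> ndseqs k" for v using that k1 by (auto simp: ndseqs_def)
    then show "F \<subseteq> {y\<in>ndseqs k. y \<prec>\<^sub>s [Suc B]}" by (auto simp: F_def intro!: last_less_prec)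
  qed (rule finite_preds'[OF ndseqs_subset])
  have "\<exists>Y'\<subseteq>Y. subspace Y' \<and> infinite_dimensional Y' \<and> (\<forall>v\<in>F. \<forall>y\<in>Y'. g v y = 0)"
    using F
  proof (induction F rule: finite_induct)
    case empty
    then show ?case using Y by auto
  next
    case (insert v F)
    then obtain Y' where Y': "Y' \<subseteq> Y" "subspace Y'" "infinite_dimensional Y'" "\<forall>v\<in>F. \<forall>y\<in>Y'. g v y = 0"
      by blast
    have "subspace {y\<in>Y'. g v y = 0} \<and> infinite_dimensional {y\<in>Y'. g v y = 0}"
      using Y'(1) g_add g_scale by (intro infinite_dimensional_kernel[OF Y'(2,3)]) blast+
    then show ?case using Y' by (intro exI[of _ "{y\<in>Y'. g v y = 0}"]) auto
  qed
  then obtain Y' where Y': "Y' \<subseteq> Y" "subspace Y'" "infinite_dimensional Y'" "\<And>v y. v \<in> F \<Longrightarrow> y \<in> Y' \<Longrightarrow> g v y = 0"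
    by blast
  have "\<not> Y' \<subseteq> {0}" using Y'(3) unfolding infinite_dimensional_def by (metis finite.emptyI span_empty)
  then obtain y0 where y0: "y0 \<in> Y'" "y0 \<noteq> 0" by blast
  define y where "y = (1 / norm y0) *\<^sub>R y0"
  have y: "y \<in> Y'" "norm y = 1" unfolding y_def using y0 Y'(2) by (auto intro: subspace_scale)
  have yT: "y \<in> T" using y(1) Y'(1) Y(1) by blast
  \<comment> \<open>One share pays for approximating \<open>y\<close>, and one for each coordinate
    in \<open>F\<close> that is deleted.\<close>
  define \<eta> where "\<eta> = \<epsilon> / (card F + 2)"
  have \<eta>: "\<eta> > 0" using \<epsilon> by (simp add: \<eta>_def)
  obtain x0 where x0: "x0 \<in> c00 k" "norm (J x0 - y) < \<eta>" using approx[OF yT \<eta>] by blast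
  define x where "x = proj (- F) x0"
  have x: "x \<in> c00 k" unfolding x_def by (rule proj_c00[OF x0(1)])
  have "tn (proj F x0) \<le> (\<Sum>v | proj F x0 v \<noteq> 0. \<bar>proj F x0 v\<bar>)" by (rule tn_l1[OF proj_c00[OF x0(1)]])
  also have "\<dots> \<le> (\<Sum>v\<in>F. \<bar>proj F x0 v\<bar>)" using F by (intro sum_mono2) (auto simp: proj_def split: if_splits)
  also have "\<dots> \<le> (\<Sum>v\<in>F. \<eta>)"
  proof (rule sum_mono)
    fix v assume v: "v \<in> F"
    show "\<bar>proj F x0 v\<bar> \<le> \<eta>" using g[OF yT x0(1), of v] Y'(4)[OF v y(1)] x0(2) v by (simp add: proj_def)
  qed
  finally have tF: "tn (proj F x0) \<le> card F * \<eta>" by simp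
  have "x0 = (\<lambda>v. x v + proj F x0 v)" by (auto simp: x_def proj_def fun_eq_iff)
  then have "J x0 = J x + J (proj F x0)" using J_add[OF x proj_c00[OF x0(1)], of F] by simp
  then have "J x - y = (J x0 - y) - J (proj F x0)" by simp
  then have "norm (J x - y) \<le> norm (J x0 - y) + norm (J (proj F x0))"
    using norm_triangle_ineq4[of "J x0 - y" "J (proj F x0)"] by (simp only:)
  also have "\<dots> < \<eta> + card F * \<eta>" using x0(2) tF J_norm[OF proj_c00[OF x0(1)]] by simp
  also have "\<dots> \<le> \<epsilon>"
  proof -
    have "(card F + 2) * \<eta> = \<epsilon>" by (simp add: \<eta>_def)
    then show ?thesis using \<eta> by (simp add: distrib_right)
  qed
  finally have "norm (J x - y) < \<epsilon>" .
  moreover have "B < last v" if "x v \<noteq> 0" for v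
  proof -
    have "v \<in> ndseqs k" using x that by (auto simp: c00_def)
    moreover have "v \<notin> F" using that by (auto simp: x_def proj_def)
    ultimately show ?thesis by (auto simp: F_def)
  qed
  ultimately show ?thesis using x y Y'(1) by blast
qed

text \<open>A gliding hump. The triple carries the bound \<open>b\<close> because the next block is
  chosen beyond it.\<close>

lemma ex_near_block_sequence:
  fixes J :: "(nat list \<Rightarrow> real) \<Rightarrow> 'b::banach"
  assumes comp: "is_completion (c00 k) tn J T"
    and Y: "Y \<subseteq> T" "subspace Y" "infinite_dimensional Y"
  shows "\<exists>y u b. strict_mono (b :: nat \<Rightarrow> nat) \<and> (\<forall>i. y i \<in> Y \<and> norm (y i) = 1 \<and> u i \<in> c00 k \<and>
    norm (J (u i) - y i) < (1/2) ^ Suc i \<and>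
    (\<forall>v. u i v \<noteq> 0 \<longrightarrow> last v \<le> b i) \<and> (\<forall>v. u (Suc i) v \<noteq> 0 \<longrightarrow> b i < last v))"
proof -
  define P where "P i z \<longleftrightarrow> (case z of (y, u, b) \<Rightarrow> y \<in> Y \<and> norm y = 1 \<and> u \<in> c00 k \<and>
    norm (J u - y) < (1/2) ^ Suc i \<and> (\<forall>v. u v \<noteq> 0 \<longrightarrow> last v \<le> b))" for i :: nat and z :: "'b \<times> (nat list \<Rightarrow> real) \<times> nat"
  define Q where "Q z z' \<longleftrightarrow> (case z of (y, u, b) \<Rightarrow> case z' of (y', u', b') \<Rightarrow> b < b' \<and> (\<forall>v. u' v \<noteq> 0 \<longrightarrow> b < last v))"
    for z z' :: "'b \<times> (nat list \<Rightarrow> real) \<times> nat"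
  have ex: "\<exists>y u b. P i (y, u, b) \<and> B < b \<and> (\<forall>v. u v \<noteq> 0 \<longrightarrow> B < last v)" for i B
  proof -
    obtain y u where yu: "y \<in> Y" "norm y = 1" "u \<in> c00 k" "norm (J u - y) < (1/2) ^ Suc i" "\<forall>v. u v \<noteq> 0 \<longrightarrow> B < last v"
      using ex_near_block[OF comp Y, of "(1/2) ^ Suc i" B] by auto
    have "finite {v. u v \<noteq> 0}" using yu(3) by (simp add: c00_def)
    then have "\<forall>v. u v \<noteq> 0 \<longrightarrow> last v \<le> Max (insert (Suc B) (last ` {v. u v \<noteq> 0}))" by (auto intro!: Max_ge)
    moreover have "B < Max (insert (Suc B) (last ` {v. u v \<noteq> 0}))"
      using \<open>finite {v. u v \<noteq> 0}\<close> by (intro less_le_trans[OF lessI Max_ge]) auto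
    ultimately show ?thesis using yu unfolding P_def by blast
  qed
  have "\<exists>f. \<forall>i. P i (f i) \<and> Q (f i) (f (Suc i))"
  proof (rule dependent_nat_choice)
    show "\<exists>z. P 0 z" using ex by blast
    show "\<exists>z'. P (Suc i) z' \<and> Q z z'" for z i
      using ex[of "Suc i" "snd (snd z)"] by (cases z) (auto simp: Q_def)
  qed
  then obtain f where f: "\<And>i. P i (f i)" "\<And>i. Q (f i) (f (Suc i))" by blast
  have "strict_mono (\<lambda>i. snd (snd (f i)))"
    using f(2) unfolding strict_mono_Suc_iff Q_def case_prod_beta by blast
  then show ?thesis
    using f unfolding P_def Q_def
    by (intro exI[of _ "\<lambda>i. fst (f i)"] exI[of _ "\<lambda>i. fst (snd (f i))"] exI[of _ "\<lambda>i. snd (snd (f i))"])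
       (auto simp: case_prod_beta)
qed

section \<open>Small perturbations and the conclusion for a given subspace\<close>

lemma norm_perturbation_le:
  fixes x z :: "nat \<Rightarrow> 'c::real_normed_vector"
  assumes p: "p > 0" and \<epsilon>: "\<And>j. norm (x j - z j) \<le> c * (1/2) ^ j" and c: "c \<ge> 0"
  shows "norm ((\<Sum>j<n. a j *\<^sub>R x j) - (\<Sum>j<n. a j *\<^sub>R z j)) \<le> 2 * c * (\<Sum>j<n. \<bar>a j\<bar> powr p) powr (1 / p)"
proof -
  let ?S = "(\<Sum>j<n. \<bar>a j\<bar> powr p) powr (1 / p)"
  \<comment> \<open>A single coefficient is at most the l_p norm, so a geometric series of errors is
    summable against it.\<close>
  have a: "\<bar>a j\<bar> \<le> ?S" if "j < n" for j
  proof -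
    have "(\<bar>a j\<bar> powr p) powr (1 / p) \<le> ?S"
      using p that by (intro powr_mono2 member_le_sum) auto
    then show ?thesis using p by (simp add: powr_powr)
  qed
  have "norm ((\<Sum>j<n. a j *\<^sub>R x j) - (\<Sum>j<n. a j *\<^sub>R z j)) = norm (\<Sum>j<n. a j *\<^sub>R (x j - z j))"
    by (simp add: scaleR_diff_right sum_subtractf)
  also have "\<dots> \<le> (\<Sum>j<n. \<bar>a j\<bar> * norm (x j - z j))" by (rule order_trans[OF norm_sum]) simp
  also have "\<dots> \<le> (\<Sum>j<n. ?S * (c * (1/2) ^ j))"
    using a \<epsilon> by (intro sum_mono mult_mono) auto
  also have "\<dots> = ?S * c * (\<Sum>j<n. (1/2) ^ j)" by (simp add: sum_distrib_left mult.assoc)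
  also have "(\<Sum>j<n. (1/2) ^ j) = 2 - 2 * (1/2::real) ^ n" by (subst sum_gp_strict) simp
  also have "?S * c * (2 - 2 * (1/2) ^ n) \<le> ?S * c * 2" using c by (intro mult_left_mono) auto
  finally show ?thesis by (simp add: mult_ac)
qed

lemma lp_saturated_completion:
  fixes J :: "(nat list \<Rightarrow> real) \<Rightarrow> 'b::banach" and T :: "'b set"
  assumes p: "p > 1" "\<theta> = real d powr (1 / p - 1)" and d2: "d \<ge> 2"
    and comp: "is_completion (c00 k) tn J T"
  shows "lp_saturated p T"
  unfolding lp_saturated_def
proof (intro allI impI)
  fix Y assume "Y \<subseteq> T \<and> subspace Y \<and> closed Y \<and> infinite_dimensional Y"
  then have Y: "Y \<subseteq> T" "subspace Y" "infinite_dimensional Y" and closed: "closed Y" by auto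
  have J_sum: "J (\<lambda>v. \<Sum>i<n. a i * u i v) = (\<Sum>i<n. a i *\<^sub>R J (u i))" if "\<And>i. u i \<in> c00 k"
    for a :: "nat \<Rightarrow> real" and u and n :: nat
  proof (induction n)
    case 0
    have "norm (J (\<lambda>_. 0)) = 0"
      using comp tn_zero by (simp add: is_completion_def c00_def)
    then show ?case by simp
  next
    case (Suc n)
    have "J (\<lambda>v. (\<Sum>i<n. a i * u i v) + a n * u n v) = J (\<lambda>v. \<Sum>i<n. a i * u i v) + J (\<lambda>v. a n * u n v)"
      using comp c00_sum[of "{..<n}" u a] c00_scale[of "u n" "a n"] that
      by (auto simp: is_completion_def linear_map_on_def)
    moreover have "J (\<lambda>v. a n * u n v) = a n *\<^sub>R J (u n)"
      using comp that by (auto simp: is_completion_def linear_map_on_def)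
    ultimately show ?case using Suc by simp
  qed
  have J_norm: "norm (J x) = tn x" if "x \<in> c00 k" for x
    using comp that by (simp add: is_completion_def)
  obtain y u b where b: "strict_mono (b :: nat \<Rightarrow> nat)" and y: "\<And>i. y i \<in> Y" "\<And>i. norm (y i) = 1"
    and u: "\<And>i. u i \<in> c00 k" "\<And>i. norm (J (u i) - y i) < (1/2) ^ Suc i"
    and supp: "\<And>i v. u i v \<noteq> 0 \<Longrightarrow> last v \<le> b i" "\<And>i v. u (Suc i) v \<noteq> 0 \<Longrightarrow> b i < last v"
    using ex_near_block_sequence[OF comp Y] by blast
  have half: "(1/2::real) ^ Suc i \<le> 1/2" for i using power_decreasing[of 1 "Suc i" "1/2::real"] by simp
  have u1: "1/2 \<le> tn (u i)" "tn (u i) \<le> 2" for i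
    using u(2)[of i] y(2)[of i] J_norm[OF u(1)[of i]] half[of i] norm_triangle_ineq3[of "J (u i)" "y i"]
    by (auto simp: abs_le_iff)
  have disj: "i = j" if "u i v \<noteq> 0" "u j v \<noteq> 0" for i j v
  proof -
    have "\<not> i < j" if "u i v \<noteq> 0" "u j v \<noteq> 0" for i j
    proof
      assume "i < j"
      then obtain j' where "j = Suc j'" "i \<le> j'" by (cases j) auto
      then show False using supp(1)[OF that(1)] supp(2)[of j' v] that(2) strict_mono_less_eq[OF b, of i j'] by simp
    qed
    then show ?thesis using that by (meson linorder_neqE_nat)
  qed
  have "\<exists>s \<delta> I. sorted s \<and> length s < k \<and> \<delta> > 0 \<and> infinite I \<and>
      (\<forall>i\<in>I. \<delta> \<le> tn (proj (cone s) (u i))) \<and>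
      (\<forall>n. \<forall>\<epsilon>>0. finite {i\<in>I. \<epsilon> \<le> tn (proj (cone (s @ [n])) (u i))})"
  proof (rule ex_maximal_cone[OF u(1) _ u1(1)])
    show "i = j" if "u i v \<noteq> 0" "u j v \<noteq> 0" for i j v by (rule disj[OF that])
  qed simp
  then obtain s \<delta> I where s: "sorted s" "length s < k" and \<delta>: "\<delta> > 0" and I: "infinite I"
    and large: "\<And>i. i \<in> I \<Longrightarrow> \<delta> \<le> tn (proj (cone s) (u i))"
    and small: "\<And>n \<epsilon>. \<epsilon> > 0 \<Longrightarrow> finite {i\<in>I. \<epsilon> \<le> tn (proj (cone (s @ [n])) (u i))}"
    by blast
  \<comment> \<open>The constant of the lower estimate for vectors of norm at least \<delta>/2; the
    other half of \<delta> is spent on the removed cones.\<close>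
  define c where "c = (2 * real d) powr (1 / p - 1) * (\<delta> / 2)"
  have c: "c > 0" unfolding c_def using d2 \<delta> by simp
  \<comment> \<open>The summand \<open>sum_list s\<close> puts \<open>N 0\<close> above every entry
    of \<open>s\<close>, as the stem tree demands.\<close>
  have "\<exists>r N. strict_mono r \<and> (\<forall>j::nat. r j \<in> I \<and> gap + sum_list s < N j \<and> N j \<le> b (r j) \<and>
      b (r j) + (gap + sum_list s) < N (Suc j) \<and>
      (\<Sum>n<N j. tn (proj (cone (s @ [n])) (u (r j)))) \<le> \<delta> / 2 \<and> (1/2) ^ r j \<le> (c / 4) * (1/2) ^ j)"
    by (rule ex_sparse_subsequence[OF b _ I small]) (use \<delta> c in auto)
  then obtain r N where r: "strict_mono r" and rI: "\<And>j. r j \<in> I" and NG: "\<And>j. gap + sum_list s < N j"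
    and Nb: "\<And>j. N j \<le> b (r j)" and sep: "\<And>j. b (r j) + (gap + sum_list s) < N (Suc j)"
    and rest: "\<And>j. (\<Sum>n<N j. tn (proj (cone (s @ [n])) (u (r j)))) \<le> \<delta> / 2"
    and eps: "\<And>j. (1/2) ^ r j \<le> (c / 4) * (1/2) ^ j"
    by blast
  define w where "w j = proj (cone s - (\<Union>n<N j. cone (s @ [n]))) (u (r j))" for j
  define z where "z j = y (r j)" for j
  let ?S = "\<lambda>a n. (\<Sum>i<n. \<bar>a i\<bar> powr p) powr (1 / p)"
  let ?K = "(2 * real d powr (p - 1) + d) powr (1 / p)"
  \<comment> \<open>With the factor \<open>c / 4\<close> the geometric series adds up to half of
    \<open>c\<close>, and the other half remains as lower constant for \<open>z\<close>.\<close>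
  have near: "norm ((\<Sum>j<n. a j *\<^sub>R J (u (r j))) - (\<Sum>j<n. a j *\<^sub>R z j)) \<le> 2 * (c / 4) * ?S a n" for a n
  proof (rule norm_perturbation_le)
    show "norm (J (u (r j)) - z j) \<le> c / 4 * (1/2) ^ j" for j
    proof -
      have "(1/2::real) ^ Suc (r j) \<le> (1/2) ^ r j" by (rule power_decreasing) auto
      then show ?thesis using u(2)[of "r j"] eps[of j] unfolding z_def by linarith
    qed
  qed (use p c in auto)
  have norm_eq: "norm (\<Sum>i<n. a i *\<^sub>R J (u (r i))) = tn (\<lambda>v. \<Sum>i<n. a i * u (r i) v)" for a n
    unfolding J_sum[OF u(1), symmetric] by (intro J_norm c00_sum u(1)) simp
  have lower: "c / 2 * ?S a n \<le> norm (\<Sum>i<n. a i *\<^sub>R z i)" for a n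
  proof -
    have "(2 * real d) powr (1 / p - 1) * (\<delta> / 2 * ?S a n) \<le> tn (\<lambda>v. \<Sum>i<n. a i * w i v)"
    proof (rule tn_lower_p_estimate[OF p d2 s, where M = "\<lambda>j. b (r j)"])
      show "\<forall>e\<in>set s. e \<le> N 0" using NG[of 0] member_le_sum_list[of _ s] by fastforce
      show "gap < N 0" using NG[of 0] by simp
      show "N i \<le> b (r i)" "b (r i) + gap < N (Suc i)" for i using Nb[of i] sep[of i] by linarith+
      show "w i \<in> c00 k" for i unfolding w_def by (rule proj_c00[OF u(1)])
      show "\<delta> / 2 \<le> tn (w i)" for i
        using tn_remove_cones[OF u(1), of "cone s" "r i" "\<lambda>n. cone (s @ [n])" "N i"] large[OF rI[of i]] rest[of i]
        unfolding w_def by linarith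
      show "\<exists>t. v = s @ t \<and> sorted t \<and> set t \<subseteq> {N i..b (r i)}" if v: "w i v \<noteq> 0" for i v
      proof -
        have uv: "u (r i) v \<noteq> 0" "v \<in> cone s - (\<Union>n<N i. cone (s @ [n]))"
          using v by (auto simp: w_def proj_def split: if_splits)
        have "v \<in> ndseqs k" using u(1)[of "r i"] uv(1) by (auto simp: c00_def)
        from cone_tail_entries[OF this uv(2) s(2) supp(1)[OF uv(1)]] show ?thesis .
      qed
    qed (use \<delta> in auto)
    \<comment> \<open>The truncations \<open>w\<close> serve the lower estimate only. They restrict
      disjointly supported vectors, so passing to the full blocks cannot decrease the norm.\<close>
    also have "\<dots> \<le> tn (\<lambda>v. \<Sum>i<n. a i * u (r i) v)"
    proof (rule tn_dominated[OF c00_sum])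
      fix v
      show "\<bar>\<Sum>i<n. a i * w i v\<bar> \<le> \<bar>\<Sum>i<n. a i * u (r i) v\<bar>"
      proof (cases "\<exists>j<n. w j v \<noteq> 0")
        case False
        then have "(\<Sum>i<n. a i * w i v) = 0" by (intro sum.neutral) auto
        then show ?thesis by simp
      next
        case True
        then obtain j where j: "j < n" "w j v \<noteq> 0" by blast
        then have wu: "w j v = u (r j) v" "u (r j) v \<noteq> 0" by (auto simp: w_def proj_def split: if_splits)
        have other: "u (r i) v = 0" if "i \<noteq> j" for i
          using disj[OF wu(2), of "r i"] that strict_mono_eq[OF r, of i j] by auto
        then have "w i v = 0" if "i \<noteq> j" for i using that by (auto simp: w_def proj_def)
        then have "(\<Sum>i<n. a i * w i v) = a j * w j v" and "(\<Sum>i<n. a i * u (r i) v) = a j * u (r j) v"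
          using j(1) other by (auto simp: sum.remove[of "{..<n}" j])
        then show ?thesis using wu by simp
      qed
    qed (use u in auto)
    also have "\<dots> = norm (\<Sum>i<n. a i *\<^sub>R J (u (r i)))" by (simp only: norm_eq)
    also have "\<dots> \<le> norm (\<Sum>i<n. a i *\<^sub>R z i) + norm ((\<Sum>i<n. a i *\<^sub>R J (u (r i))) - (\<Sum>i<n. a i *\<^sub>R z i))"
      by (rule norm_triangle_sub)
    finally have "c * ?S a n \<le> norm (\<Sum>i<n. a i *\<^sub>R z i) +
        norm ((\<Sum>i<n. a i *\<^sub>R J (u (r i))) - (\<Sum>i<n. a i *\<^sub>R z i))" by (simp only: c_def mult.assoc)
    then show ?thesis using near[of a n] by linarith
  qed
  \<comment> \<open>Here the full blocks are used: the upper estimate needs neither cones nor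
    gaps.\<close>
  have upper: "norm (\<Sum>i<n. a i *\<^sub>R z i) \<le> (?K * 2 + c / 2) * ?S a n" for a n
  proof -
    have "norm (\<Sum>i<n. a i *\<^sub>R z i) \<le> norm (\<Sum>i<n. a i *\<^sub>R J (u (r i))) +
        norm ((\<Sum>i<n. a i *\<^sub>R J (u (r i))) - (\<Sum>i<n. a i *\<^sub>R z i))"
      by (subst norm_minus_commute) (rule norm_triangle_sub)
    also have "norm (\<Sum>i<n. a i *\<^sub>R J (u (r i))) = tn (\<lambda>v. \<Sum>i<n. a i * u (r i) v)"
      by (rule norm_eq)
    also have "\<dots> \<le> ?K * (2 * ?S a n)"
    proof (rule tn_block_upper_p_estimate[OF p, of "\<lambda>i. b (r i)"])
      show "strict_mono (\<lambda>i. b (r i))" using b r by (auto simp: strict_mono_def)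
      show "b (r i) < last v" if v: "u (r (Suc i)) v \<noteq> 0" for i v
      proof -
        have ri: "r i < r (Suc i)" using r by (simp add: strict_mono_Suc_iff)
        then have "b (r (Suc i) - 1) < last v" using supp(2)[of "r (Suc i) - 1" v] v by simp
        moreover have "b (r i) \<le> b (r (Suc i) - 1)" using ri strict_mono_less_eq[OF b] by simp
        ultimately show ?thesis by simp
      qed
    qed (use u(1) u1(2) supp(1) in auto)
    finally show ?thesis using near[of a n] by (simp add: distrib_right)
  qed
  obtain Z where Z: "Z \<subseteq> closure (span (range z))" "subspace Z" "closed Z" "isomorphic_to (lp p) (lp_norm p) Z"
    using equivalent_lp_basis_isomorphic[OF _ _ lower upper] p(1) c by auto
  have "range z \<subseteq> Y" using y(1) by (auto simp: z_def)
  then have "closure (span (range z)) \<subseteq> Y" by (intro closure_minimal span_minimal Y(2) closed)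
  then show "\<exists>Z\<subseteq>Y. subspace Z \<and> closed Z \<and> isomorphic_to (lp p) (lp_norm p) Z" using Z by blast
qed

end

theorem mainTheorem8:
  fixes k d :: nat and \<theta> p :: real
    and J :: "(nat list \<Rightarrow> real) \<Rightarrow> 'b::banach" and T :: "'b set"
  assumes "k \<ge> 2" and "d \<ge> 1"
    and "0 < \<theta>" and "\<theta> < 1" and "real d * \<theta> > 1"
    and "p > 1" and "real d * \<theta> = real d powr (1 / p)"
    and "is_completion (c00 k) (tnorm k d \<theta>) J T"
  shows "lp_saturated p T"
proof -
  interpret ellentuck_norm k d \<theta> using assms by unfold_locales auto
  have "d \<noteq> 1" using assms(4,5) by auto
  then have "d \<ge> 2" using assms(2) by simp
  moreover have "\<theta> = real d powr (1 / p - 1)"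
    using assms(2,7) by (simp add: powr_diff field_simps)
  ultimately show ?thesis using lp_saturated_completion assms(6,8) by blast
qed

end
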